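(* The Gabriel-Krull dimension of the $0$-Hecke category $\mathcal H$ (that is, of the category of finitely generated $\mathcal H$-modules) is infinite.
   Context: Fix a field $\mathbf k$. For $n\ge 0$ let $[n]=\{1,\dots,n\}$, and let $H_n(0)$ be the unital associative $\mathbf k$-algebra generated by $\pi_1,\dots,\pi_{n-1}$ with relations $\pi_i^2=\pi_i$, $\pi_i\pi_{i+1}\pi_i=\pi_{i+1}\pi_i\pi_{i+1}$, and $\pi_i\pi_j=\pi_j\pi_i$ for $|i-j|>1$. For $w\in\mathfrak S_n$ with reduced expression $w=s_{i_1}\cdots s_{i_r}$ in the adjacent transpositions $s_i=(i,i+1)$, put $\pi_w=\pi_{i_1}\cdots\pi_{i_r}$; the $\pi_w$ form a basis of $H_n(0)$ and a monoid $\mathcal M_n$ under multiplication. For $n\le m$, $\mathcal M_n\subseteq\mathcal M_m$ via $\pi_i\mapsto\pi_i$. The $0$-Hecke category $\mathcal H$ has objects $[n]$, $n\ge0$. For $n\le m$, $\mathrm{Hom}_{\mathcal H}([n],[m])$ is the set of braid diagrams from $n$ top vertices to $m$ bottom vertices with only positive crossings, modulo $\pi_i^2=\pi_i$, composed by padding with dummy strands, multiplying in the $0$-Hecke monoid and deleting dummy strands; there are no morphisms if $n>m$. Algebraically, $\mathrm{Hom}_{\mathcal H}([n],[m])$ is the quotient of $\mathcal M_m$ by the equivalence relation generated by $x\sim x\pi_j$ for $n+1\le j\le m-1$, and the composite of the class of $y\in\mathcal M_\ell$ in $\mathrm{Hom}([m],[\ell])$ with the class of $x\in\mathcal M_m$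 in $\mathrm{Hom}([n],[m])$ is the class of $yx\in\mathcal M_\ell$. An $\mathcal H$-module is a functor from $\mathcal H$ to $\mathbf k$-vector spaces; it is finitely generated if finitely many elements are contained in no proper submodule. Gabriel-Krull dimension: let $\mathcal A$ be the (abelian) category of finitely generated $\mathcal H$-modules, let $\mathcal A^{\le -1}$ be the Serre subcategory of finite length objects of $\mathcal A$ and, inductively for $d\ge0$, let $\mathcal A^{\le d}$ be the Serre subcategory of objects whose image in the Serre quotient $\mathcal A/\mathcal A^{\le d-1}$ has finite length. The Gabriel-Krull dimension of $\mathcal H$ is infinite if $\mathcal A^{\le d}\ne\mathcal A$ for every integer $d\ge -1$. *)

theory Defs
  imports "HOL-Library.FuncSet" "HOL-Computational_Algebra.Polynomial"
begin

section \<open>Categories and finite length\<close>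

text \<open>Morphism sets of different pairs of objects need not be disjoint, so composition takes its
  three objects as arguments: for \<open>g \<in> Mor K Y Z\<close> and \<open>f \<in> Mor K X Y\<close>, the composite of \<open>f\<close>
  followed by \<open>g\<close> is \<open>Cmp K X Y Z g f\<close>.\<close>

record ('o, 'm) category =
  Ob :: "'o set"
  Mor :: "'o \<Rightarrow> 'o \<Rightarrow> 'm set"
  Idn :: "'o \<Rightarrow> 'm"
  Cmp :: "'o \<Rightarrow> 'o \<Rightarrow> 'o \<Rightarrow> 'm \<Rightarrow> 'm \<Rightarrow> 'm"

definition monic :: "('o, 'm) category \<Rightarrow> 'o \<Rightarrow> 'o \<Rightarrow> 'm \<Rightarrow> bool" where
  "monic K Y X i \<longleftrightarrow> i \<in> Mor K Y X \<and>
     (\<forall>W\<in>Ob K. \<forall>g\<in>Mor K W Y. \<forall>h\<in>Mor K W Y. Cmp K W Y X i g = Cmp K W Y X i h \<longrightarrow> g = h)"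

text \<open>Subobjects are represented by monomorphisms, preordered by factorization; two of them are the
  same subobject iff each factors through the other, and \<open>sub_less\<close> is strict inclusion.\<close>

definition subobjects :: "('o, 'm) category \<Rightarrow> 'o \<Rightarrow> ('o \<times> 'm) set" where
  "subobjects K X = {(Y, i). Y \<in> Ob K \<and> monic K Y X i}"

definition sub_le :: "('o, 'm) category \<Rightarrow> 'o \<Rightarrow> 'o \<times> 'm \<Rightarrow> 'o \<times> 'm \<Rightarrow> bool" where
  "sub_le K X s t \<longleftrightarrow>
     (case s of (Y, i) \<Rightarrow> case t of (Z, j) \<Rightarrow> \<exists>h\<in>Mor K Y Z. i = Cmp K Y Z X j h)"

definition sub_less :: "('o, 'm) category \<Rightarrow> 'o \<Rightarrow> 'o \<times> 'm \<Rightarrow> 'o \<times> 'm \<Rightarrow> bool" where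
  "sub_less K X s t \<longleftrightarrow> sub_le K X s t \<and> \<not> sub_le K X t s"

text \<open>The length of an object is the supremum of the lengths of the strictly increasing chains of
  its subobjects.\<close>

definition finite_length :: "('o, 'm) category \<Rightarrow> 'o \<Rightarrow> bool" where
  "finite_length K X \<longleftrightarrow>
     (\<exists>L::nat. \<forall>ss. set ss \<subseteq> subobjects K X \<and> sorted_wrt (sub_less K X) ss \<longrightarrow> length ss \<le> L)"


section \<open>The 0-Hecke monoids and the 0-Hecke category\<close>

text \<open>\<open>hmonoid n\<close> is the monoid presented by generators \<open>\<pi>\<^sub>1, \<dots>, \<pi>\<^sub>n\<^sub>-\<^sub>1\<close> and the 0-Hecke relations,
  i.e. words in \<open>1, \<dots>, n - 1\<close> modulo these relations. The word \<open>[i\<^sub>1, \<dots>, i\<^sub>r]\<close> stands for the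
  product \<open>\<pi>\<^bsub>i\<^sub>1\<^esub> \<dots> \<pi>\<^bsub>i\<^sub>r\<^esub>\<close>. The defining relations of the algebra equate monomials, so the
  algebra is the monoid algebra of this monoid, and the elements \<open>\<pi>\<^sub>w\<close> are exactly the classes
  of words.\<close>

definition words :: "nat \<Rightarrow> nat list set" where
  "words n = lists {1..<n}"

inductive hecke_step :: "nat \<Rightarrow> nat list \<Rightarrow> nat list \<Rightarrow> bool" for n where
  idem: "\<lbrakk>u \<in> words n; v \<in> words n; i \<in> {1..<n}\<rbrakk>
    \<Longrightarrow> hecke_step n (u @ [i, i] @ v) (u @ [i] @ v)"
| braid: "\<lbrakk>u \<in> words n; v \<in> words n; i \<in> {1..<n}; i + 1 \<in> {1..<n}\<rbrakk>
    \<Longrightarrow> hecke_step n (u @ [i, i + 1, i] @ v) (u @ [i + 1, i, i + 1] @ v)"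
| comm: "\<lbrakk>u \<in> words n; v \<in> words n; i \<in> {1..<n}; j \<in> {1..<n}; \<bar>int i - int j\<bar> > 1\<rbrakk>
    \<Longrightarrow> hecke_step n (u @ [i, j] @ v) (u @ [j, i] @ v)"

type_synonym hmon = "nat list set"

definition hecke_rel :: "nat \<Rightarrow> (nat list \<times> nat list) set" where
  "hecke_rel n = {(u, v). u \<in> words n \<and> v \<in> words n \<and> equivclp (hecke_step n) u v}"

definition hmonoid :: "nat \<Rightarrow> hmon set" where
  "hmonoid n = words n // hecke_rel n"

definition hone :: "nat \<Rightarrow> hmon" where
  "hone n = hecke_rel n `` {[]}"

definition hgen :: "nat \<Rightarrow> nat \<Rightarrow> hmon" where
  "hgen n i = hecke_rel n `` {[i]}"

definition hmult :: "nat \<Rightarrow> hmon \<Rightarrow> hmon \<Rightarrow> hmon" where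
  "hmult n x y = (\<Union>u\<in>x. \<Union>v\<in>y. hecke_rel n `` {u @ v})"

text \<open>The map from \<open>hmonoid n\<close> to \<open>hmonoid m\<close>, for \<open>n \<le> m\<close>, sending each generator
  \<open>\<pi>\<^sub>i\<close> to \<open>\<pi>\<^sub>i\<close>.\<close>

definition hincl :: "nat \<Rightarrow> hmon \<Rightarrow> hmon" where
  "hincl m x = (\<Union>u\<in>x. hecke_rel m `` {u})"

type_synonym hmor = "hmon set"

inductive dummy_step :: "nat \<Rightarrow> nat \<Rightarrow> hmon \<Rightarrow> hmon \<Rightarrow> bool" for n m where
  "\<lbrakk>x \<in> hmonoid m; j \<in> {n + 1..<m}\<rbrakk> \<Longrightarrow> dummy_step n m x (hmult m x (hgen m j))"

definition dummy_rel :: "nat \<Rightarrow> nat \<Rightarrow> (hmon \<times> hmon) set" where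
  "dummy_rel n m =
     {(x, y). x \<in> hmonoid m \<and> y \<in> hmonoid m \<and> equivclp (dummy_step n m) x y}"

text \<open>The object \<open>[n]\<close> is represented by the number \<open>n\<close>.\<close>

definition hecke_cat :: "(nat, hmor) category" where
  "hecke_cat = \<lparr>
     Ob = UNIV,
     Mor = (\<lambda>n m. if n \<le> m then hmonoid m // dummy_rel n m else {}),
     Idn = (\<lambda>n. dummy_rel n n `` {hone n}),
     Cmp = (\<lambda>n m l \<psi> \<phi>. \<Union>y\<in>\<psi>. \<Union>x\<in>\<phi>. dummy_rel n l `` {hmult l y (hincl l x)})\<rparr>"


section \<open>Modules over the 0-Hecke category\<close>

text \<open>The vector spaces are taken to be linear subspaces of one ambient space, for which we use
  \<^typ>\<open>'k poly\<close> merely as a vector space of countably infinite dimension. This is only a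
  choice of universe: morphism sets of \<^const>\<open>hecke_cat\<close> are finite, so a finitely generated module
  is finite-dimensional at every object and hence isomorphic to one of this form.\<close>

record (overloaded) 'k::zero hmod =
  sp :: "nat \<Rightarrow> 'k poly set"
  act :: "nat \<Rightarrow> nat \<Rightarrow> hmor \<Rightarrow> 'k poly \<Rightarrow> 'k poly"

abbreviation subspace :: "'k::field poly set \<Rightarrow> bool" where
  "subspace \<equiv> module.subspace smult"

definition linear_map :: "'k::field poly set \<Rightarrow> 'k poly set \<Rightarrow> ('k poly \<Rightarrow> 'k poly) \<Rightarrow> bool" where
  "linear_map V W f \<longleftrightarrow> f ` V \<subseteq> W \<and>
     (\<forall>x\<in>V. \<forall>y\<in>V. f (x + y) = f x + f y) \<and> (\<forall>c. \<forall>x\<in>V. f (smult c x) = smult c (f x))"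

definition hmodule :: "'k::field hmod \<Rightarrow> bool" where
  "hmodule M \<longleftrightarrow>
     (\<forall>n. subspace (sp M n)) \<and>
     (\<forall>n m. \<forall>\<phi>\<in>Mor hecke_cat n m. linear_map (sp M n) (sp M m) (act M n m \<phi>)) \<and>
     (\<forall>n. \<forall>x\<in>sp M n. act M n n (Idn hecke_cat n) x = x) \<and>
     (\<forall>n m l. \<forall>\<phi>\<in>Mor hecke_cat n m. \<forall>\<psi>\<in>Mor hecke_cat m l. \<forall>x\<in>sp M n.
        act M n l (Cmp hecke_cat n m l \<psi> \<phi>) x = act M m l \<psi> (act M n m \<phi> x))"

definition submodule :: "(nat \<Rightarrow> 'k::field poly set) \<Rightarrow> 'k hmod \<Rightarrow> bool" where
  "submodule N M \<longleftrightarrow>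
     (\<forall>n. subspace (N n) \<and> N n \<subseteq> sp M n) \<and>
     (\<forall>n m. \<forall>\<phi>\<in>Mor hecke_cat n m. act M n m \<phi> ` N n \<subseteq> N m)"

text \<open>A submodule \<open>N\<close> of \<open>M\<close>, regarded as a module.\<close>

definition restrict_mod :: "'k::field hmod \<Rightarrow> (nat \<Rightarrow> 'k poly set) \<Rightarrow> 'k::field hmod" where
  "restrict_mod M N = M\<lparr>sp := N\<rparr>"

definition fin_gen :: "'k::field hmod \<Rightarrow> bool" where
  "fin_gen M \<longleftrightarrow> (\<exists>S. finite S \<and> S \<subseteq> (SIGMA n:UNIV. sp M n) \<and>
     (\<forall>N. submodule N M \<and> (\<forall>(n, x)\<in>S. x \<in> N n) \<longrightarrow> N = sp M))"

text \<open>Components are required to be extensional so that equality of morphisms is equality of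
  functions.\<close>

type_synonym 'k hmodmor = "nat \<Rightarrow> 'k poly \<Rightarrow> 'k poly"

definition mod_homs :: "'k::field hmod \<Rightarrow> 'k hmod \<Rightarrow> 'k hmodmor set" where
  "mod_homs M N = {f.
     (\<forall>n. f n \<in> extensional (sp M n) \<and> linear_map (sp M n) (sp N n) (f n)) \<and>
     (\<forall>n m. \<forall>\<phi>\<in>Mor hecke_cat n m. \<forall>x\<in>sp M n. f m (act M n m \<phi> x) = act N n m \<phi> (f n x))}"

definition fgmod_cat :: "('k::field hmod, 'k hmodmor) category" where
  "fgmod_cat = \<lparr>
     Ob = {M. hmodule M \<and> fin_gen M},
     Mor = mod_homs,
     Idn = (\<lambda>M n. \<lambda>x\<in>sp M n. x),
     Cmp = (\<lambda>L M N g f n. compose (sp L n) (g n) (f n))\<rparr>"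


section \<open>Serre quotients\<close>

text \<open>Throughout, \<open>C\<close> is the class of objects of a Serre subcategory of \<^const>\<open>fgmod_cat\<close>.
  The predicate \<open>quotient_in C M N\<close> says that \<open>M/N\<close> belongs to \<open>C\<close>.\<close>

definition quotient_in :: "'k::field hmod set \<Rightarrow> 'k hmod \<Rightarrow> (nat \<Rightarrow> 'k poly set) \<Rightarrow> bool" where
  "quotient_in C M N \<longleftrightarrow> (\<exists>Q\<in>C. \<exists>p\<in>mod_homs M Q. \<forall>n.
     p n ` sp M n = sp Q n \<and> {x \<in> sp M n. p n x = 0} = N n)"

text \<open>Subobjects \<open>X'\<close> of \<open>X\<close> in \<^const>\<open>fgmod_cat\<close> with \<open>X/X'\<close> in \<open>C\<close>, and subobjects
  \<open>Y'\<close> of \<open>Y\<close> which lie in \<open>C\<close>.\<close>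

definition cosmall :: "'k::field hmod set \<Rightarrow> 'k hmod \<Rightarrow> (nat \<Rightarrow> 'k poly set) \<Rightarrow> bool" where
  "cosmall C X X' \<longleftrightarrow> submodule X' X \<and> restrict_mod X X' \<in> Ob fgmod_cat \<and> quotient_in C X X'"

definition small :: "'k::field hmod set \<Rightarrow> 'k hmod \<Rightarrow> (nat \<Rightarrow> 'k poly set) \<Rightarrow> bool" where
  "small C Y Y' \<longleftrightarrow> submodule Y' Y \<and> restrict_mod Y Y' \<in> C"

text \<open>Following Gabriel, the morphisms from \<open>X\<close> to \<open>Y\<close> in the Serre quotient by \<open>C\<close> are the
  elements of the colimit of \<open>Hom(X', Y/Y')\<close> over all \<open>X'\<close>, \<open>Y'\<close> as above. A homomorphism
  \<open>f\<close> from \<open>X'\<close> to \<open>Y/Y'\<close> is encoded as the family \<open>R\<close> of the sets of pairs \<open>(x, y)\<close> with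
  \<open>x \<in> X'\<close> and \<open>y\<close> in the coset \<open>f x\<close>. The \<open>R\<close> that arise are exactly the submodules
  of the direct sum of \<open>X\<close> and \<open>Y\<close> with \<open>Domain R = X'\<close> and \<open>R `` {0} = Y'\<close>.\<close>

type_synonym 'k roof = "nat \<Rightarrow> ('k poly \<times> 'k poly) set"

definition roofs :: "'k::field hmod set \<Rightarrow> 'k hmod \<Rightarrow> 'k hmod \<Rightarrow> 'k roof set" where
  "roofs C X Y = {R.
     (\<forall>n. R n \<subseteq> sp X n \<times> sp Y n \<and> (0, 0) \<in> R n \<and>
        (\<forall>(x, y)\<in>R n. \<forall>(x', y')\<in>R n. (x + x', y + y') \<in> R n) \<and>
        (\<forall>c. \<forall>(x, y)\<in>R n. (smult c x, smult c y) \<in> R n)) \<and>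
     (\<forall>n m. \<forall>\<phi>\<in>Mor hecke_cat n m. \<forall>(x, y)\<in>R n. (act X n m \<phi> x, act Y n m \<phi> y) \<in> R m) \<and>
     cosmall C X (\<lambda>n. Domain (R n)) \<and> small C Y (\<lambda>n. R n `` {0})}"

text \<open>Two homomorphisms are identified in the colimit iff they induce the same map from
  \<open>X''\<close> to \<open>Y/Y''\<close> for some smaller \<open>X''\<close> and larger \<open>Y''\<close>.\<close>

definition roof_rel :: "'k::field hmod set \<Rightarrow> 'k hmod \<Rightarrow> 'k hmod \<Rightarrow> ('k roof \<times> 'k roof) set" where
  "roof_rel C X Y = {(R, S). R \<in> roofs C X Y \<and> S \<in> roofs C X Y \<and>
     (\<exists>X'' Y''. cosmall C X X'' \<and> small C Y Y'' \<and>
        (\<forall>n. X'' n \<subseteq> Domain (R n) \<inter> Domain (S n) \<and> R n `` {0} \<union> S n `` {0} \<subseteq> Y'' n \<and>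
           (\<forall>x\<in>X'' n. \<forall>y\<in>R n `` {x}. \<forall>z\<in>S n `` {x}. y - z \<in> Y'' n)))}"

text \<open>Relational composition is Gabriel's composition: for homomorphisms \<open>f\<close> from \<open>X'\<close> to
  \<open>Y/Y'\<close> and \<open>g\<close> from \<open>Y''\<close> to \<open>Z/Z'\<close> it is the map from the preimage under \<open>f\<close> of
  \<open>(Y' + Y'')/Y'\<close>, through \<open>Y''/(Y' \<inter> Y'')\<close>, to \<open>Z/(Z' + g(Y' \<inter> Y''))\<close>.\<close>

definition serre_quotient ::
  "'k::field hmod set \<Rightarrow> ('k hmod, 'k roof set) category" where
  "serre_quotient C = \<lparr>
     Ob = Ob fgmod_cat,
     Mor = (\<lambda>X Y. roofs C X Y // roof_rel C X Y),
     Idn = (\<lambda>X. roof_rel C X X `` {\<lambda>n. Id_on (sp X n)}),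
     Cmp = (\<lambda>X Y Z \<Psi> \<Phi>. \<Union>S\<in>\<Psi>. \<Union>R\<in>\<Phi>. roof_rel C X Z `` {\<lambda>n. R n O S n})\<rparr>"


section \<open>The Gabriel-Krull filtration\<close>

primrec gk_filtration_aux :: "nat \<Rightarrow> 'k::field hmod set" where
  "gk_filtration_aux 0 = {X \<in> Ob fgmod_cat. finite_length fgmod_cat X}"
| "gk_filtration_aux (Suc d) =
     {X \<in> Ob fgmod_cat. finite_length (serre_quotient (gk_filtration_aux d)) X}"

text \<open>The filtration is indexed by the integers \<open>d \<ge> -1\<close>, starting at \<open>-1\<close> with the finite
  length objects.\<close>

definition gk_filtration :: "int \<Rightarrow> 'k::field hmod set" where
  "gk_filtration d = gk_filtration_aux (nat (d + 1))"

end

(* Call a chain of submodules "d-proper" if none of its steps lies in the d-th term of the filtration,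
   starting with the zero modules. The terms of the filtration are determined by the lattices of
   submodules: a module lies in the next term iff its d-proper chains have bounded length. This uses
   that finitely generated modules over the 0-Hecke category are noetherian (the order-preserving
   injections embed in it, and a Groebner basis argument with Dickson's lemma applies to these), and
   that boundedness of d-proper chains is inherited by subobjects, quotients and extensions because
   submodule lattices are modular; subobjects in the Serre quotient are compared with submodules by
   taking images of roofs.

   For the lower bound, let the 0-Hecke category act on D-tuples of positions, each generator pi_i
   moving position i to position i + 1. Positions only ever increase, so the tuples that are
   lexicographically at least t span a submodule. Fixing the coordinates one after the other, every
   coordinate contributes an infinite strictly decreasing chain, and the degree of the module
   contributes one more; hence this module is not in term D + 1. *)
theory Submission
  imports Defs "HOL-Library.List_Lexorder" "HOL-Library.Nat_Bijection"
begin

section \<open>The 0-Hecke category in terms of words\<close>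

text \<open>A subobject in a Serre quotient is a class of roofs and carries no canonical submodule:
  the range of a representing roof is determined only up to intervals of the dimension already
  divided out. Strict chains of subobjects thus give submodules that increase only up to such
  errors, and partial sums must turn them into genuine chains. The errors stay under control because
  \<open>kd\<close> passes to extensions.

  Noetherianity is what makes kernels and other submodules objects of \<open>fgmod_cat\<close>, so
  that morphisms can start from them. The reduction to order-preserving injections works because a
  generator applied after the insertion of a dummy strand is again an insertion, possibly preceded
  by a generator on fewer strands.

  The indices are shifted twice: \<open>kd\<close> at \<open>d + 1\<close> describes
  \<open>gk_filtration_aux d\<close>, which is the term \<open>d - 1\<close> in the integer
  indexing. Hence the tuples used against \<open>gk_filtration d\<close> have \<open>d + 1\<close>
  coordinates.\<close>

lemma equivclp_map:
  assumes "equivclp r x y" "\<And>a b. r a b \<Longrightarrow> equivclp s (f a) (f b)"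
  shows "equivclp s (f x) (f y)"
  using assms(1)
proof (induction rule: equivclp_induct)
  case base
  then show ?case by simp
next
  case (step y z)
  then show ?case using assms(2) equivclp_sym equivclp_trans by metis
qed

lemma equivclp_invariant:
  assumes "equivclp r x y" "\<And>a b. r a b \<Longrightarrow> f a = f b"
  shows "f x = f y"
  using assms(1) by (induction rule: equivclp_induct) (auto simp: assms(2))

lemma words_append [simp]: "u @ v \<in> words n \<longleftrightarrow> u \<in> words n \<and> v \<in> words n"
  by (auto simp: words_def)

lemma words_Nil [simp]: "[] \<in> words n"
  by (auto simp: words_def)

lemma words_Cons [simp]: "i # w \<in> words n \<longleftrightarrow> 1 \<le> i \<and> i < n \<and> w \<in> words n"
  by (auto simp: words_def)

lemma words_mono: "w \<in> words n \<Longrightarrow> n \<le> m \<Longrightarrow> w \<in> words m"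
  by (fastforce simp: words_def)

lemma words_upt: "1 \<le> a \<Longrightarrow> b \<le> n \<Longrightarrow> [a..<b] \<in> words n"
  by (auto simp: words_def)

lemma hecke_step_append:
  assumes "hecke_step n u v" "p \<in> words n" "q \<in> words n"
  shows "hecke_step n (p @ u @ q) (p @ v @ q)"
  using assms(1)
proof cases
  case (idem a b i)
  then show ?thesis using hecke_step.idem[of "p @ a" n "b @ q" i] assms by simp
next
  case (braid a b i)
  then show ?thesis using hecke_step.braid[of "p @ a" n "b @ q" i] assms by simp
next
  case (comm a b i j)
  then show ?thesis using hecke_step.comm[of "p @ a" n "b @ q" i j] assms by simp
qed

lemma hecke_step_mono:
  assumes "hecke_step n u v" "n \<le> m"
  shows "hecke_step m u v"
  using assms(1)
proof cases
  case (idem a b i)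
  then show ?thesis using hecke_step.idem[of a m b i] assms words_mono by auto
next
  case (braid a b i)
  then show ?thesis using hecke_step.braid[of a m b i] assms words_mono by auto
next
  case (comm a b i j)
  then show ?thesis using hecke_step.comm[of a m b i j] assms words_mono by auto
qed

definition heq :: "nat \<Rightarrow> nat list \<Rightarrow> nat list \<Rightarrow> bool" where
  "heq n = equivclp (hecke_step n)"

lemma heq_refl [simp]: "heq n u u"
  by (simp add: heq_def)

lemma heq_sym: "heq n u v \<Longrightarrow> heq n v u"
  by (simp add: heq_def equivclp_sym)

lemma heq_trans [trans]: "heq n u v \<Longrightarrow> heq n v w \<Longrightarrow> heq n u w"
  unfolding heq_def by (rule equivclp_trans)

lemma hecke_step_heq: "hecke_step n u v \<Longrightarrow> heq n u v"
  unfolding heq_def by (rule r_into_equivclp)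

lemma heq_append_both:
  "heq n u v \<Longrightarrow> p \<in> words n \<Longrightarrow> q \<in> words n \<Longrightarrow> heq n (p @ u @ q) (p @ v @ q)"
  unfolding heq_def
  by (rule equivclp_map[where f = "\<lambda>u. p @ u @ q" and r = "hecke_step n"])
    (auto intro!: r_into_equivclp hecke_step_append)

lemma heq_append:
  assumes "heq n u v" "heq n p q" "u \<in> words n" "q \<in> words n"
  shows "heq n (u @ p) (v @ q)"
proof -
  have "heq n (u @ p @ []) (u @ q @ [])" using assms by (intro heq_append_both) auto
  moreover have "heq n ([] @ u @ q) ([] @ v @ q)" using assms by (intro heq_append_both) auto
  ultimately show ?thesis using heq_trans[of n "u @ p" "u @ q" "v @ q"] by simp
qed

lemma heq_mono: "heq n u v \<Longrightarrow> n \<le> m \<Longrightarrow> heq m u v"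
  unfolding heq_def
  by (rule equivclp_map[where f = "\<lambda>u. u" and r = "hecke_step n"])
    (auto intro!: r_into_equivclp intro: hecke_step_mono)

section \<open>Morphisms as classes of words\<close>

definition hcls :: "nat \<Rightarrow> nat list \<Rightarrow> hmon" where
  "hcls m w = hecke_rel m `` {w}"

lemma hcls_eq: "w \<in> words m \<Longrightarrow> hcls m w = {v \<in> words m. heq m w v}"
  by (auto simp: hcls_def hecke_rel_def heq_def)

lemma equiv_equivclp_on: "equiv A {(u, v). u \<in> A \<and> v \<in> A \<and> equivclp r u v}"
proof (rule equivI)
  show "trans {(u, v). u \<in> A \<and> v \<in> A \<and> equivclp r u v}"
    unfolding trans_def using equivclp_trans by fastforce
qed (auto simp: refl_on_def sym_def equivclp_sym)

lemma equiv_hecke_rel: "equiv (words m) (hecke_rel m)"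
  unfolding hecke_rel_def by (rule equiv_equivclp_on)

lemma hcls_eqI: "u \<in> words m \<Longrightarrow> v \<in> words m \<Longrightarrow> heq m u v \<Longrightarrow> hcls m u = hcls m v"
  unfolding hcls_def
  by (rule equiv_class_eq[OF equiv_hecke_rel]) (auto simp: hecke_rel_def heq_def)

lemma hmonoid_eq: "hmonoid m = hcls m ` words m"
  by (auto simp: hmonoid_def hcls_def quotient_def)

lemma hmult_hcls:
  assumes "u \<in> words m" "v \<in> words m"
  shows "hmult m (hcls m u) (hcls m v) = hcls m (u @ v)"
proof -
  have "hcls m (u' @ v') = hcls m (u @ v)" if "u' \<in> hcls m u" "v' \<in> hcls m v" for u' v'
    using that assms by (intro hcls_eqI heq_append) (auto simp: hcls_eq heq_sym)
  moreover have "u \<in> hcls m u" "v \<in> hcls m v" using assms by (auto simp: hcls_eq)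
  ultimately show ?thesis unfolding hmult_def hcls_def[symmetric] by blast
qed

lemma hincl_hcls:
  assumes "u \<in> words n" "n \<le> m"
  shows "hincl m (hcls n u) = hcls m u"
proof -
  have "hcls m u' = hcls m u" if "u' \<in> hcls n u" for u'
  proof -
    have "u' \<in> words n" "heq n u' u" using that assms by (auto simp: hcls_eq intro: heq_sym)
    then show ?thesis using assms words_mono heq_mono by (intro hcls_eqI) blast+
  qed
  moreover have "u \<in> hcls n u" using assms by (auto simp: hcls_eq)
  ultimately show ?thesis unfolding hincl_def hcls_def[symmetric] by blast
qed

lemma equiv_dummy_rel: "equiv (hmonoid m) (dummy_rel n m)"
  unfolding dummy_rel_def by (rule equiv_equivclp_on)

definition cls :: "nat \<Rightarrow> nat \<Rightarrow> nat list \<Rightarrow> hmor" where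
  "cls n m w = dummy_rel n m `` {hcls m w}"

lemma Mor_eq: "Mor hecke_cat n m = (if n \<le> m then cls n m ` words m else {})"
  by (auto simp: hecke_cat_def cls_def hmonoid_eq quotient_def)

lemma cls_Mor [intro]: "n \<le> m \<Longrightarrow> w \<in> words m \<Longrightarrow> cls n m w \<in> Mor hecke_cat n m"
  by (auto simp: Mor_eq)

lemma Mor_cases:
  assumes "\<phi> \<in> Mor hecke_cat n m"
  obtains w where "n \<le> m" "w \<in> words m" "\<phi> = cls n m w"
  using assms by (auto simp: Mor_eq split: if_splits)

lemma Idn_eq: "Idn hecke_cat n = cls n n []"
  by (simp add: hecke_cat_def cls_def hcls_def hone_def)

lemma cls_heq: "u \<in> words m \<Longrightarrow> v \<in> words m \<Longrightarrow> heq m u v \<Longrightarrow> cls n m u = cls n m v"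
  unfolding cls_def using hcls_eqI[of u m v] by simp

lemma dummy_step_hcls:
  "w \<in> words m \<Longrightarrow> n + 1 \<le> j \<Longrightarrow> j < m \<Longrightarrow> dummy_step n m (hcls m w) (hcls m (w @ [j]))"
proof -
  assume a: "w \<in> words m" "n + 1 \<le> j" "j < m"
  have "dummy_step n m (hcls m w) (hmult m (hcls m w) (hgen m j))"
    using a by (intro dummy_step.intros) (auto simp: hmonoid_eq)
  moreover have "hmult m (hcls m w) (hgen m j) = hcls m (w @ [j])"
    using a hmult_hcls[of w m "[j]"] by (simp add: hcls_def hgen_def)
  ultimately show ?thesis by simp
qed

lemma dummy_stepE:
  assumes "dummy_step n m x y"
  obtains w j where "w \<in> words m" "n + 1 \<le> j" "j < m" "x = hcls m w" "y = hcls m (w @ [j])"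
  using assms
proof cases
  case (1 j)
  then obtain w where w: "w \<in> words m" "x = hcls m w" by (auto simp: hmonoid_eq)
  moreover have "hmult m (hcls m w) (hgen m j) = hcls m (w @ [j])"
    using 1 w hmult_hcls[of w m "[j]"] by (simp add: hcls_def hgen_def)
  ultimately show thesis using 1 that[of w j] by simp
qed

lemma cls_dummy:
  assumes "w \<in> words m" "n + 1 \<le> j" "j < m"
  shows "cls n m (w @ [j]) = cls n m w"
  unfolding cls_def
proof (rule equiv_class_eq[OF equiv_dummy_rel, symmetric])
  have "equivclp (dummy_step n m) (hcls m w) (hcls m (w @ [j]))"
    using dummy_step_hcls assms by (simp add: r_into_equivclp)
  then show "(hcls m w, hcls m (w @ [j])) \<in> dummy_rel n m"
    using assms by (auto simp: dummy_rel_def hmonoid_eq)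
qed

lemma cls_mult_right:
  assumes "equivclp (dummy_step n m) x x'" "x \<in> hmonoid m" "m \<le> l" "v \<in> words l"
  shows "dummy_rel n l `` {hmult l (hcls l v) (hincl l x)} =
         dummy_rel n l `` {hmult l (hcls l v) (hincl l x')}"
proof (rule equivclp_invariant[OF assms(1), where f = "\<lambda>x. dummy_rel n l `` {hmult l (hcls l v) (hincl l x)}"])
  fix a b assume "dummy_step n m a b"
  then obtain w j where w: "w \<in> words m" "n + 1 \<le> j" "j < m" "a = hcls m w" "b = hcls m (w @ [j])"
    by (rule dummy_stepE)
  have "cls n l (v @ w @ [j]) = cls n l (v @ w)"
    using cls_dummy[of "v @ w" l n j] w assms words_mono[of w m l] by simp
  then show "dummy_rel n l `` {hmult l (hcls l v) (hincl l a)} =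
             dummy_rel n l `` {hmult l (hcls l v) (hincl l b)}"
    using w assms words_mono[of w m l] hincl_hcls[of "w @ [j]" m l]
    by (simp add: hincl_hcls hmult_hcls cls_def)
qed

lemma heq_commute_words:
  assumes "1 \<le> j" "j < l" "\<forall>i\<in>set u. i + 1 < j \<or> j + 1 < i" "u \<in> words l"
  shows "heq l (j # u) (u @ [j])"
  using assms(3,4)
proof (induction u)
  case Nil
  then show ?case by simp
next
  case (Cons i u)
  have "hecke_step l ([] @ [j, i] @ u) ([] @ [i, j] @ u)"
    using Cons assms by (intro hecke_step.comm) auto
  then have "heq l (j # i # u) (i # j # u)" by (auto dest: hecke_step_heq)
  moreover have "heq l ([i] @ (j # u) @ []) ([i] @ (u @ [j]) @ [])"
    using Cons by (intro heq_append_both) auto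
  ultimately show ?case using heq_trans[of l "j # i # u" "i # j # u" "i # u @ [j]"] by simp
qed

text \<open>A dummy letter of the outer morphism is at least \<open>m + 1\<close> and hence commutes
  with all letters of \<open>u\<close>, which are below \<open>m\<close>. Moved to the right end it
  is a dummy letter for \<open>n\<close> as well, because \<open>n \<le> m\<close>.\<close>

lemma cls_mult_left:
  assumes "equivclp (dummy_step m l) y y'" "m \<le> l" "u \<in> words m" "n \<le> m"
  shows "dummy_rel n l `` {hmult l y (hcls l u)} = dummy_rel n l `` {hmult l y' (hcls l u)}"
proof (rule equivclp_invariant[OF assms(1), where f = "\<lambda>x. dummy_rel n l `` {hmult l x (hcls l u)}"])
  fix a b assume "dummy_step m l a b"
  then obtain w j where w: "w \<in> words l" "m + 1 \<le> j" "j < l" "a = hcls l w" "b = hcls l (w @ [j])"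
    by (rule dummy_stepE)
  have u: "u \<in> words l" using assms words_mono by blast
  have "\<forall>i\<in>set u. i + 1 < j \<or> j + 1 < i" using assms(3) w by (auto simp: words_def)
  then have "heq l (j # u) (u @ [j])" using w u by (intro heq_commute_words) auto
  then have "heq l (w @ (j # u)) (w @ (u @ [j]))"
    using w u by (intro heq_append) auto
  then have "cls n l (w @ [j] @ u) = cls n l ((w @ u) @ [j])"
    using w u by (intro cls_heq) auto
  also have "\<dots> = cls n l (w @ u)" using w u assms by (intro cls_dummy) auto
  finally show "dummy_rel n l `` {hmult l a (hcls l u)} = dummy_rel n l `` {hmult l b (hcls l u)}"
    using w u by (simp add: hmult_hcls cls_def)
qed

text \<open>With composition reduced to concatenation, functoriality becomes a statement about
  words.\<close>

lemma Cmp_cls: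
  assumes "n \<le> m" "m \<le> l" "u \<in> words m" "v \<in> words l"
  shows "Cmp hecke_cat n m l (cls m l v) (cls n m u) = cls n l (v @ u)"
proof -
  have "dummy_rel n l `` {hmult l y (hincl l x)} = cls n l (v @ u)"
    if "y \<in> cls m l v" "x \<in> cls n m u" for y x
  proof -
    from that have y: "y \<in> hmonoid l" "equivclp (dummy_step m l) y (hcls l v)"
      and x: "x \<in> hmonoid m" "equivclp (dummy_step n m) x (hcls m u)"
      by (auto simp: cls_def dummy_rel_def equivclp_sym)
    obtain v' where v': "v' \<in> words l" "y = hcls l v'" using y by (auto simp: hmonoid_eq)
    have "dummy_rel n l `` {hmult l y (hincl l x)} =
          dummy_rel n l `` {hmult l y (hincl l (hcls m u))}"
      unfolding v'(2) by (rule cls_mult_right) (use x v' assms in auto)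
    also have "\<dots> = dummy_rel n l `` {hmult l y (hcls l u)}"
      using assms by (simp add: hincl_hcls)
    also have "\<dots> = dummy_rel n l `` {hmult l (hcls l v) (hcls l u)}"
      by (rule cls_mult_left) (use y assms in auto)
    also have "\<dots> = cls n l (v @ u)"
      using assms words_mono by (simp add: hmult_hcls cls_def)
    finally show ?thesis .
  qed
  moreover have "hcls l v \<in> cls m l v" "hcls m u \<in> cls n m u"
    using assms by (auto simp: cls_def dummy_rel_def hmonoid_eq)
  ultimately show ?thesis by (auto simp: hecke_cat_def)
qed

text \<open>The word \<open>[a..<b]\<close> multiplies the consecutive generators from
  \<open>a\<close> to \<open>b - 1\<close>; for permutations this is a cycle. A generator on its
  left lengthens it, is absorbed, passes through with index lowered by one, or commutes with it;
  only the passage needs the braid relation. The same four cases govern strand insertion and the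
  coset argument for finite closures.\<close>

lemma heq_Cons_upt:
  assumes "1 \<le> a" "b \<le> n" "1 \<le> i" "i < b"
  shows "i + 1 = a \<Longrightarrow> i # [a..<b] = [i..<b]"
    and "i = a \<Longrightarrow> heq n (i # [a..<b]) [a..<b]"
    and "a < i \<Longrightarrow> heq n (i # [a..<b]) ([a..<b] @ [i - 1])"
    and "i + 1 < a \<Longrightarrow> heq n (i # [a..<b]) ([a..<b] @ [i])"
proof -
  show "i # [a..<b] = [i..<b]" if "i + 1 = a"
    using that assms by (simp add: upt_conv_Cons)
  show "heq n (i # [a..<b]) [a..<b]" if "i = a"
    using that assms hecke_step.idem[of "[]" n "[Suc a..<b]" i, THEN hecke_step_heq]
    by (simp add: upt_conv_Cons words_upt)
  show "heq n (i # [a..<b]) ([a..<b] @ [i])" if "i + 1 < a"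
    using that assms by (intro heq_commute_words words_upt) auto
  show "heq n (i # [a..<b]) ([a..<b] @ [i - 1])" if ai: "a < i"
  proof -
    obtain h where h: "i = Suc h" using ai by (cases i) auto
    have split: "[a..<b] = [a..<h] @ [h, Suc h] @ [Suc (Suc h)..<b]"
    proof -
      have "[a..<b] = [a..<h] @ [h..<b]"
        using ai h assms upt_add_eq_append[of a h "b - h"] by simp
      then show ?thesis using h assms by (simp add: upt_conv_Cons)
    qed
    have w: "[a..<h] \<in> words n" "[Suc (Suc h)..<b] \<in> words n" "h \<in> {1..<n}" "Suc h \<in> {1..<n}"
      using assms h ai by (auto intro: words_upt)
    \<comment> \<open>The letter \<open>Suc h\<close> commutes with everything before
      \<open>h\<close>, meets \<open>h, Suc h\<close> in a braid, and the \<open>h\<close> that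
      comes out on the right commutes with the rest.\<close>
    have "heq n ((Suc h # [a..<h]) @ ([h, Suc h] @ [Suc (Suc h)..<b]))
            (([a..<h] @ [Suc h]) @ ([h, Suc h] @ [Suc (Suc h)..<b]))"
      using w by (intro heq_append heq_commute_words) auto
    also have "heq n \<dots> ([a..<h] @ [h, Suc h, h] @ [Suc (Suc h)..<b])"
      using hecke_step.braid[of "[a..<h]" n "[Suc (Suc h)..<b]" h] w
      by (auto dest!: hecke_step_heq intro: heq_sym)
    also have "heq n \<dots> (([a..<h] @ [h, Suc h]) @ ([Suc (Suc h)..<b] @ [h]))"
    proof -
      have "heq n (h # [Suc (Suc h)..<b]) ([Suc (Suc h)..<b] @ [h])"
        using w by (intro heq_commute_words) auto
      then have "heq n (([a..<h] @ [h, Suc h]) @ (h # [Suc (Suc h)..<b])) (([a..<h] @ [h, Suc h]) @ ([Suc (Suc h)..<b] @ [h]))"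
        using w by (intro heq_append) auto
      then show ?thesis by simp
    qed
    finally show ?thesis unfolding split h by simp
  qed
qed

text \<open>Each letter of the left factor passes through \<open>[a..<b]\<close> with its index
  lowered by one. On strands this is the rule for interchanging two insertions.\<close>

lemma heq_upt_upt:
  assumes "1 \<le> a" "a \<le> p" "p \<le> c" "c < b" "b \<le> n"
  shows "heq n ([Suc p..<Suc c] @ [a..<b]) ([a..<b] @ [p..<c])"
  using assms(3,4)
proof (induction c rule: dec_induct)
  case base
  then show ?case by simp
next
  case (step c)
  have w: "[Suc p..<Suc c] \<in> words n" "[a..<b] \<in> words n" "[p..<c] \<in> words n" "[c] \<in> words n"
    using assms step by (auto intro: words_upt)
  have "heq n ([Suc p..<Suc c] @ (Suc c # [a..<b])) ([Suc p..<Suc c] @ ([a..<b] @ [c]))"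
    using heq_Cons_upt(3)[of a b n "Suc c"] assms step w by (intro heq_append) auto
  also have "heq n \<dots> (([a..<b] @ [p..<c]) @ [c])"
    using heq_append[of n "[Suc p..<Suc c] @ [a..<b]" "[a..<b] @ [p..<c]" "[c]" "[c]"] step w by simp
  finally show ?case using step assms by simp
qed

section \<open>Krull dimension of intervals in modular lattices\<close>

text \<open>\<open>kd P d a b\<close>, for elements \<open>a \<le> b\<close> of the poset of all \<open>x\<close> with \<open>P x\<close>, is the lattice version
  of Gabriel-Krull dimension: \<open>kd P 0 a b\<close> says that the interval is trivial, and \<open>kd P (d + 1) a b\<close> that there is
  a bound on the lengths of the chains in it no step of which satisfies \<open>kd P d\<close>. For the lattice of
  submodules of \<open>M\<close>, \<open>kd P (d + 1) a b\<close> will mean that \<open>b/a\<close> belongs to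
  \<open>gk_filtration_aux d\<close>. Chains are indexed by finite sets of numbers, so that passing to a
  subchain is restricting to a subset.\<close>

definition nonrel_chain :: "('a::order \<Rightarrow> bool) \<Rightarrow> ('a \<Rightarrow> 'a \<Rightarrow> bool) \<Rightarrow> 'a \<Rightarrow> 'a \<Rightarrow> nat set \<Rightarrow> (nat \<Rightarrow> 'a) \<Rightarrow> bool"
  where "nonrel_chain P r a b I x \<longleftrightarrow> finite I \<and> (\<forall>i\<in>I. P (x i) \<and> a \<le> x i \<and> x i \<le> b) \<and>
     (\<forall>i\<in>I. \<forall>j\<in>I. i < j \<longrightarrow> x i \<le> x j \<and> \<not> r (x i) (x j))"

primrec kd :: "('a::order \<Rightarrow> bool) \<Rightarrow> nat \<Rightarrow> 'a \<Rightarrow> 'a \<Rightarrow> bool" where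
  "kd P 0 a b \<longleftrightarrow> b \<le> a"
| "kd P (Suc d) a b \<longleftrightarrow> (\<exists>L. \<forall>I x. nonrel_chain P (kd P d) a b I x \<longrightarrow> card I \<le> L)"

lemma kd_SucI:
  assumes "\<And>(I::nat set) x. finite I \<Longrightarrow> \<forall>i\<in>I. P (x i) \<and> a \<le> x i \<and> x i \<le> b \<Longrightarrow>
     \<forall>i\<in>I. \<forall>j\<in>I. i < j \<longrightarrow> x i \<le> x j \<and> \<not> kd P d (x i) (x j) \<Longrightarrow> card I \<le> L"
  shows "kd P (Suc d) a b"
  unfolding kd.simps nonrel_chain_def
proof (rule exI[of _ L], intro allI impI)
  fix I :: "nat set" and x
  assume "finite I \<and> (\<forall>i\<in>I. P (x i) \<and> a \<le> x i \<and> x i \<le> b) \<and>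
     (\<forall>i\<in>I. \<forall>j\<in>I. i < j \<longrightarrow> x i \<le> x j \<and> \<not> kd P d (x i) (x j))"
  then show "card I \<le> L" using assms[of I x] by blast
qed

lemma kd_SucE:
  assumes "kd P (Suc d) a b"
  obtains L where "\<forall>I x. nonrel_chain P (kd P d) a b I x \<longrightarrow> card I \<le> L"
  using assms unfolding kd.simps by (rule exE)

lemma chain_card_le:
  fixes I :: "nat set"
  assumes "\<forall>I x. nonrel_chain P r a b I x \<longrightarrow> card I \<le> L"
    and "finite I" "\<forall>i\<in>I. P (x i) \<and> a \<le> x i \<and> x i \<le> b"
    and "\<forall>i\<in>I. \<forall>j\<in>I. i < j \<longrightarrow> x i \<le> x j \<and> \<not> r (x i) (x j)"
  shows "card I \<le> L"
proof -
  have "nonrel_chain P r a b I x" unfolding nonrel_chain_def using assms(2-4) by blast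
  then show ?thesis using assms(1) by blast
qed

lemma kd_mono:
  assumes "kd P d a b" "a \<le> a'" "b' \<le> b"
  shows "kd P d a' b'"
proof (cases d)
  case 0
  then show ?thesis using assms by (auto intro: order_trans)
next
  case (Suc d)
  obtain L where L: "\<forall>I x. nonrel_chain P (kd P d) a b I x \<longrightarrow> card I \<le> L"
    using assms(1)[unfolded Suc] by (rule kd_SucE)
  show ?thesis unfolding Suc
  proof (rule kd_SucI)
    fix I :: "nat set" and x
    assume "finite I" and x: "\<forall>i\<in>I. P (x i) \<and> a' \<le> x i \<and> x i \<le> b'"
     "\<forall>i\<in>I. \<forall>j\<in>I. i < j \<longrightarrow> x i \<le> x j \<and> \<not> kd P d (x i) (x j)"
    moreover have "\<forall>i\<in>I. P (x i) \<and> a \<le> x i \<and> x i \<le> b"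
      using x(1) assms(2,3) by (meson order_trans)
    ultimately show "card I \<le> L" using chain_card_le[OF L, of I x] x(2) by blast
  qed
qed

lemma kd_refl: "kd P d a a"
proof (induction d)
  case (Suc d)
  show ?case
  proof (rule kd_SucI)
    fix I :: "nat set" and x
    assume I: "finite I" "\<forall>i\<in>I. P (x i) \<and> a \<le> x i \<and> x i \<le> a"
      "\<forall>i\<in>I. \<forall>j\<in>I. i < j \<longrightarrow> x i \<le> x j \<and> \<not> kd P d (x i) (x j)"
    have x: "x i = a" if "i \<in> I" for i using I(2) that by force
    have "\<not> i < j" if "i \<in> I" "j \<in> I" for i j
      using I(3) that Suc x[OF that(1)] x[OF that(2)] by force
    then have "\<forall>i\<in>I. \<forall>j\<in>I. i = j" by (meson linorder_neqE_nat)
    then show "card I \<le> 1" using I(1) by (simp add: card_le_Suc0_iff_eq)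
  qed
qed simp

text \<open>A strictly monotone map sends chains whose steps avoid \<open>kd P d\<close> to chains
  of the same kind, by induction on \<open>d\<close> for the subintervals. Order has to be reflected
  on comparable pairs only, and this is what modularity yields for meeting or joining with a fixed
  element.\<close>

lemma kd_embed:
  assumes "kd P' d (f a) (f b)"
    and "\<And>x. P x \<Longrightarrow> a \<le> x \<Longrightarrow> x \<le> b \<Longrightarrow> P' (f x)"
    and "\<And>x y. P x \<Longrightarrow> P y \<Longrightarrow> a \<le> x \<Longrightarrow> x \<le> y \<Longrightarrow> y \<le> b \<Longrightarrow> f x \<le> f y"
    and "\<And>x y. P x \<Longrightarrow> P y \<Longrightarrow> a \<le> x \<Longrightarrow> x \<le> y \<Longrightarrow> y \<le> b \<Longrightarrow> f y \<le> f x \<Longrightarrow> y \<le> x"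
    and "P a" "P b" "a \<le> b"
  shows "kd P d a b"
  using assms
proof (induction d arbitrary: a b)
  case 0
  have "b \<le> a"
    by (rule "0.prems"(4)) (use "0.prems"(1,5-7) in simp_all)
  then show ?case by simp
next
  case (Suc d)
  obtain L where L: "\<forall>I x. nonrel_chain P' (kd P' d) (f a) (f b) I x \<longrightarrow> card I \<le> L"
    using Suc.prems(1) by (rule kd_SucE)
  have "card I \<le> L" if I: "finite I" "\<forall>i\<in>I. P (x i) \<and> a \<le> x i \<and> x i \<le> b"
    "\<forall>i\<in>I. \<forall>j\<in>I. i < j \<longrightarrow> x i \<le> x j \<and> \<not> kd P d (x i) (x j)" for I :: "nat set" and x
  proof (rule chain_card_le[OF L I(1), where x = "f \<circ> x"])
    show "\<forall>i\<in>I. P' ((f \<circ> x) i) \<and> f a \<le> (f \<circ> x) i \<and> (f \<circ> x) i \<le> f b"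
    proof
      fix i assume "i \<in> I"
      then have x: "P (x i)" "a \<le> x i" "x i \<le> b" using I(2) by auto
      show "P' ((f \<circ> x) i) \<and> f a \<le> (f \<circ> x) i \<and> (f \<circ> x) i \<le> f b"
        using Suc.prems(2)[OF x] Suc.prems(3)[OF \<open>P a\<close> x(1) order_refl x(2,3)]
          Suc.prems(3)[OF x(1) \<open>P b\<close> x(2,3) order_refl] by simp
    qed
    show "\<forall>i\<in>I. \<forall>j\<in>I. i < j \<longrightarrow> (f \<circ> x) i \<le> (f \<circ> x) j \<and> \<not> kd P' d ((f \<circ> x) i) ((f \<circ> x) j)"
    proof (intro ballI impI conjI notI)
      fix i j assume ij: "i \<in> I" "j \<in> I" "i < j"
      then have x: "P (x i)" "P (x j)" "a \<le> x i" "x i \<le> x j" "x j \<le> b" "\<not> kd P d (x i) (x j)"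
        using I by auto
      then show "(f \<circ> x) i \<le> (f \<circ> x) j" using Suc.prems(3) by simp
      assume k: "kd P' d ((f \<circ> x) i) ((f \<circ> x) j)"
      have "kd P d (x i) (x j)"
      proof (rule Suc.IH)
        show "kd P' d (f (x i)) (f (x j))" using k by simp
        show "P' (f y)" if "P y" "x i \<le> y" "y \<le> x j" for y
          using that x Suc.prems(2) by (meson order_trans)
        show "f y \<le> f z" if "P y" "P z" "x i \<le> y" "y \<le> z" "z \<le> x j" for y z
          using that x Suc.prems(3) by (meson order_trans)
        show "z \<le> y" if "P y" "P z" "x i \<le> y" "y \<le> z" "z \<le> x j" "f z \<le> f y" for y z
          using that x Suc.prems(4) by (meson order_trans)
      qed (use x in auto)
      then show False using x by simp
    qed
  qed
  then show ?case by (rule kd_SucI)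
qed

text \<open>The join is a parameter because the order is that of families of sets, whose own
  supremum is a union and not a submodule, whereas meets are intersections. Of the modular law only
  the inequality that can fail in a lattice is assumed.\<close>

locale modular_lattice =
  fixes P :: "'a::semilattice_inf \<Rightarrow> bool" and J :: "'a \<Rightarrow> 'a \<Rightarrow> 'a"
  assumes P_inf: "P a \<Longrightarrow> P b \<Longrightarrow> P (inf a b)"
    and P_J: "P a \<Longrightarrow> P b \<Longrightarrow> P (J a b)"
    and J_ge1: "P a \<Longrightarrow> P b \<Longrightarrow> a \<le> J a b"
    and J_ge2: "P a \<Longrightarrow> P b \<Longrightarrow> b \<le> J a b"
    and J_least: "P a \<Longrightarrow> P b \<Longrightarrow> P c \<Longrightarrow> a \<le> c \<Longrightarrow> b \<le> c \<Longrightarrow> J a b \<le> c"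
    and modular: "P a \<Longrightarrow> P b \<Longrightarrow> P c \<Longrightarrow> a \<le> c \<Longrightarrow> inf (J a b) c \<le> J a (inf b c)"
begin

lemma J_mono: "P a \<Longrightarrow> P b \<Longrightarrow> P a' \<Longrightarrow> P b' \<Longrightarrow> a \<le> a' \<Longrightarrow> b \<le> b' \<Longrightarrow> J a b \<le> J a' b'"
  by (meson J_ge1 J_ge2 J_least P_J order_trans)

text \<open>One half of the second isomorphism theorem: meeting with \<open>a\<close> embeds the
  interval from \<open>b\<close> to \<open>J a b\<close> into the one from \<open>inf a b\<close> to
  \<open>a\<close>, by the modular law.\<close>

lemma kd_inf_imp_join:
  assumes "P a" "P b" "kd P d (inf a b) a"
  shows "kd P d b (J a b)"
proof (rule kd_embed[where f = "\<lambda>x. inf a x" and P' = P])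
  show "kd P d (inf a b) (inf a (J a b))" by (rule kd_mono[OF assms(3)]) auto
  show "b \<le> J a b" using assms J_ge2 by auto
  show "y \<le> x" if "P x" "P y" "b \<le> x" "x \<le> y" "y \<le> J a b" "inf a y \<le> inf a x" for x y
  proof -
    have "J a b \<le> J b a" using assms by (intro J_least P_J J_ge1 J_ge2)
    then have "y \<le> inf (J b a) y" using that(5) by auto
    also have "\<dots> \<le> J b (inf a y)" using that assms by (intro modular) auto
    also have "\<dots> \<le> x" using that assms by (intro J_least P_inf) (auto intro: le_infI2)
    finally show ?thesis .
  qed
qed (use assms in \<open>auto intro: P_inf P_J le_infI2\<close>)

text \<open>The other half: joining with \<open>b\<close> embeds the intervals in the opposite
  direction.\<close>

lemma kd_join_imp_inf:
  assumes "P a" "P b" "kd P d b (J a b)"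
  shows "kd P d (inf a b) a"
proof (rule kd_embed[where f = "\<lambda>x. J x b" and P' = P])
  show "kd P d (J (inf a b) b) (J a b)"
    by (rule kd_mono[OF assms(3)]) (use assms in \<open>auto intro!: J_ge2 P_inf\<close>)
  show "J x b \<le> J y b" if "P x" "P y" "inf a b \<le> x" "x \<le> y" "y \<le> a" for x y
    using that assms by (intro J_mono) auto
  show "y \<le> x" if "P x" "P y" "inf a b \<le> x" "x \<le> y" "y \<le> a" "J y b \<le> J x b" for x y
  proof -
    have "y \<le> inf (J x b) a" using that assms J_ge1[of y b] by auto
    also have "\<dots> \<le> J x (inf b a)" using that assms by (intro modular) auto
    also have "\<dots> \<le> x" using that assms by (intro J_least P_inf) (auto simp: inf_commute)
    finally show ?thesis .
  qed
qed (use assms in \<open>auto intro: P_inf P_J\<close>)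

text \<open>In module terms, the quotient of \<open>inf v w\<close> by \<open>inf u w\<close> embeds
  into that of \<open>v\<close> by \<open>u\<close>.\<close>

lemma kd_inf:
  assumes "P u" "P v" "P w" "u \<le> v" "kd P d u v"
  shows "kd P d (inf u w) (inf v w)"
proof -
  have "kd P d u (J (inf v w) u)"
    using assms by (intro kd_mono[OF assms(5)]) (auto intro!: J_least P_inf)
  then have "kd P d (inf (inf v w) u) (inf v w)"
    using assms by (intro kd_join_imp_inf) (auto intro: P_inf)
  moreover have "inf (inf v w) u = inf u w" using assms
    by (metis inf.absorb_iff2 inf.left_commute inf_commute)
  ultimately show ?thesis by simp
qed

text \<open>In module terms, the quotient of \<open>J v w\<close> by \<open>J u w\<close> is an
  image of that of \<open>v\<close> by \<open>u\<close>.\<close>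

lemma kd_join:
  assumes "P u" "P v" "P w" "u \<le> v" "kd P d u v"
  shows "kd P d (J u w) (J v w)"
proof -
  have "kd P d (inf v (J u w)) v"
    using assms by (intro kd_mono[OF assms(5)]) (auto intro!: J_ge1)
  then have "kd P d (J u w) (J v (J u w))"
    using assms by (intro kd_inf_imp_join) (auto intro: P_J)
  then show ?thesis
    by (rule kd_mono) (use assms in \<open>auto intro!: J_mono P_J J_ge2\<close>)
qed

text \<open>The element \<open>z = J x (inf y b)\<close> splits the interval: the part below
  \<open>z\<close> is controlled by the meets with \<open>b\<close>, the part above by the joins.
  Transitivity is a hypothesis since the lemma is applied inside the induction that proves it, where
  it is available for \<open>d\<close> only.\<close>

lemma kd_step:
  assumes "P b" "P x" "P y" "x \<le> y"
    and below: "kd P d (inf x b) (inf y b)" and above: "kd P d (J x b) (J y b)"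
    and trans: "\<And>u v w. P u \<Longrightarrow> P v \<Longrightarrow> P w \<Longrightarrow> u \<le> v \<Longrightarrow> v \<le> w \<Longrightarrow> kd P d u v \<Longrightarrow> kd P d v w \<Longrightarrow> kd P d u w"
  shows "kd P d x y"
proof -
  define z where "z = J x (inf y b)"
  have z: "P z" "x \<le> z" "z \<le> y"
    unfolding z_def using assms by (auto intro!: P_J P_inf J_ge1 J_least)
  have "kd P d (inf (inf y b) x) (inf y b)"
  proof (rule kd_mono[OF below])
    show "inf x b \<le> inf (inf y b) x" using assms by (simp add: le_infI1)
  qed auto
  then have "kd P d x (J (inf y b) x)" using assms by (intro kd_inf_imp_join P_inf) auto
  then have 1: "kd P d x z" unfolding z_def
    by (rule kd_mono) (use assms in \<open>auto intro!: J_least P_inf P_J intro: J_ge1 J_ge2\<close>)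
  have "x \<le> J y b" using assms(4) J_ge1[of y b] assms(1,3) by auto
  then have "kd P d (J x b) (J y (J x b))"
    by (intro kd_mono[OF above]) (use assms in \<open>auto intro!: J_least P_inf P_J J_mono intro: J_ge1 J_ge2\<close>)
  then have "kd P d (inf y (J x b)) y"
    using assms by (intro kd_join_imp_inf P_J) auto
  moreover have "inf y (J x b) \<le> z"
    unfolding z_def using modular[of x b y] assms by (simp add: inf_commute)
  ultimately have "kd P d z y" by (rule kd_mono) simp
  then show ?thesis by (rule trans[OF \<open>P x\<close> z(1) \<open>P y\<close> z(2,3) 1])
qed

text \<open>Closure under extensions. A step of a chain from \<open>a\<close> to \<open>c\<close>
  that avoids \<open>kd P d\<close> must still do so after meeting with \<open>b\<close> or after
  joining with \<open>b\<close>, so the bounds for the two parts add up.\<close>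

lemma kd_trans:
  assumes "P a" "P b" "P c" "a \<le> b" "b \<le> c" "kd P d a b" "kd P d b c"
  shows "kd P d a c"
  using assms
proof (induction d arbitrary: a b c)
  case 0
  then show ?case by auto
next
  case (Suc d)
  obtain L where L: "\<forall>I x. nonrel_chain P (kd P d) a b I x \<longrightarrow> card I \<le> L"
    using Suc.prems(6) by (rule kd_SucE)
  obtain L' where L': "\<forall>I x. nonrel_chain P (kd P d) b c I x \<longrightarrow> card I \<le> L'"
    using Suc.prems(7) by (rule kd_SucE)
  \<comment> \<open>The extra one accounts for the last index of the chain, which starts no
    step.\<close>
  have "card I \<le> L + (L' + 1)" if I: "finite I" "\<forall>i\<in>I. P (x i) \<and> a \<le> x i \<and> x i \<le> c"
    "\<forall>i\<in>I. \<forall>j\<in>I. i < j \<longrightarrow> x i \<le> x j \<and> \<not> kd P d (x i) (x j)" for I :: "nat set" and x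
  proof -
    \<comment> \<open>Only steps to the next index in \<open>I\<close> are classified. A longer step
      contains such a step, so by \<open>kd_mono\<close> it avoids \<open>kd P d\<close> as
      well.\<close>
    define nxt where "nxt i = Min {j\<in>I. i < j}" for i
    have nxt: "nxt i \<in> I" "i < nxt i" "nxt i \<le> j" if "j \<in> I" "i < j" for i j
    proof -
      have *: "finite {j\<in>I. i < j}" "j \<in> {j\<in>I. i < j}" using that I(1) by auto
      then have "nxt i \<in> {j\<in>I. i < j}" unfolding nxt_def by (intro Min_in) auto
      then show "nxt i \<in> I" "i < nxt i" by auto
      show "nxt i \<le> j" unfolding nxt_def using * by (rule Min_le)
    qed
    define A where "A = {i\<in>I. (\<exists>j\<in>I. i < j) \<and> \<not> kd P d (inf (x i) b) (inf (x (nxt i)) b)}"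
    define B where "B = {i\<in>I. (\<exists>j\<in>I. i < j) \<and> \<not> kd P d (J (x i) b) (J (x (nxt i)) b)}"
    have sub: "A \<subseteq> I" "B \<subseteq> I" by (auto simp: A_def B_def)
    then have fin: "finite A" "finite B" using I(1) finite_subset by auto
    have x_mono: "x i \<le> x j" if "i \<in> I" "j \<in> I" "i \<le> j" for i j
      using that I(3) by (cases "i = j") auto
    have AB: "i \<in> A \<union> B" if "i \<in> I" "j \<in> I" "i < j" for i j
    proof (rule ccontr)
      assume "i \<notin> A \<union> B"
      then have k: "kd P d (inf (x i) b) (inf (x (nxt i)) b)" "kd P d (J (x i) b) (J (x (nxt i)) b)"
        using that by (auto simp: A_def B_def)
      have n: "nxt i \<in> I" "i < nxt i" using nxt that by auto
      have x: "P (x i)" "P (x (nxt i))" "x i \<le> x (nxt i)"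
        using I(2,3) that(1) n by blast+
      have "kd P d (x i) (x (nxt i))"
        by (rule kd_step[OF \<open>P b\<close> x k Suc.IH])
      then show False using I(3) that(1) n by blast
    qed
    have "I \<subseteq> A \<union> (B \<union> {Max I})"
    proof
      fix i assume i: "i \<in> I"
      then have "Max I \<in> I" "i \<le> Max I" using Max_in[OF I(1)] Max_ge[OF I(1)] by blast+
      then show "i \<in> A \<union> (B \<union> {Max I})" using AB[OF i, of "Max I"] by (cases "i = Max I") auto
    qed
    then have "card I \<le> card (A \<union> (B \<union> {Max I}))" using fin by (intro card_mono) auto
    also have "\<dots> \<le> card A + (card B + 1)"
      using card_Un_le[of A "B \<union> {Max I}"] card_Un_le[of B "{Max I}"] by simp
    also have "card A \<le> L"
    proof (rule chain_card_le[OF L fin(1), where x = "\<lambda>i. inf (x i) b"])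
      show "\<forall>i\<in>A. P (inf (x i) b) \<and> a \<le> inf (x i) b \<and> inf (x i) b \<le> b"
        using sub I(2) \<open>P b\<close> \<open>a \<le> b\<close> by (auto intro!: P_inf)
      show "\<forall>i\<in>A. \<forall>j\<in>A. i < j \<longrightarrow> inf (x i) b \<le> inf (x j) b \<and> \<not> kd P d (inf (x i) b) (inf (x j) b)"
      proof (intro ballI impI conjI notI)
        fix i j assume ij: "i \<in> A" "j \<in> A" "i < j"
        then have "x i \<le> x j" using sub x_mono[of i j] by auto
        then show "inf (x i) b \<le> inf (x j) b" by (rule inf_mono) simp
        assume k: "kd P d (inf (x i) b) (inf (x j) b)"
        have "x (nxt i) \<le> x j" using ij sub nxt[of j i] x_mono[of "nxt i" j] by blast
        then have "inf (x (nxt i)) b \<le> inf (x j) b" by (rule inf_mono) simp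
        with k have "kd P d (inf (x i) b) (inf (x (nxt i)) b)"
          using kd_mono by blast
        then show False using ij(1) unfolding A_def by blast
      qed
    qed
    also have "card B \<le> L'"
    proof (rule chain_card_le[OF L' fin(2), where x = "\<lambda>i. J (x i) b"])
      show "\<forall>i\<in>B. P (J (x i) b) \<and> b \<le> J (x i) b \<and> J (x i) b \<le> c"
        using sub I(2) \<open>P b\<close> \<open>P c\<close> \<open>b \<le> c\<close> by (auto intro!: P_J J_ge2 J_least)
      show "\<forall>i\<in>B. \<forall>j\<in>B. i < j \<longrightarrow> J (x i) b \<le> J (x j) b \<and> \<not> kd P d (J (x i) b) (J (x j) b)"
      proof (intro ballI impI conjI notI)
        fix i j assume ij: "i \<in> B" "j \<in> B" "i < j"
        then have x: "P (x i)" "P (x j)" "x i \<le> x j" using I(2) x_mono[of i j] sub by auto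
        then show "J (x i) b \<le> J (x j) b" using \<open>P b\<close> by (intro J_mono) auto
        assume k: "kd P d (J (x i) b) (J (x j) b)"
        have "x (nxt i) \<le> x j" "P (x (nxt i))" using ij sub nxt[of j i] x_mono[of "nxt i" j] I(2) by blast+
        then have "kd P d (J (x i) b) (J (x (nxt i)) b)"
          using x \<open>P b\<close> by (intro kd_mono[OF k]) (auto intro!: J_mono)
        then show False using ij(1) unfolding B_def by blast
      qed
    qed
    finally show ?thesis by simp
  qed
  then show ?case by (rule kd_SucI)
qed

text \<open>\<open>kd P d (inf a b) a\<close> reads as containment of \<open>a\<close> in
  \<open>b\<close> up to dimension \<open>d\<close>. This preorder takes the place of inclusion when
  subobjects of a Serre quotient are compared.\<close>

lemma kd_le_trans:
  assumes P: "P a" "P b" "P c" and k: "kd P d (inf a b) a" "kd P d (inf b c) b"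
  shows "kd P d (inf a c) a"
proof -
  have "kd P d (inf (inf b c) a) (inf b a)"
    by (rule kd_inf[OF P_inf[OF P(2,3)] P(2,1) inf_le1 k(2)])
  moreover have "kd P d (inf b a) a" using k(1) by (simp add: inf_commute)
  ultimately have "kd P d (inf (inf b c) a) a"
    by (intro kd_trans[OF P_inf[OF P_inf[OF P(2,3)] P(1)] P_inf[OF P(2,1)] P(1)])
      (auto intro: le_infI1)
  then show ?thesis by (rule kd_mono) (auto simp: le_infI1 le_infI2)
qed

text \<open>By the isomorphism theorem the claim concerns \<open>J (J a b) c\<close> over
  \<open>c\<close>, and from \<open>c\<close> this is covered by two consecutive intervals
  satisfying \<open>kd P d\<close>, with \<open>J a c\<close> in between.\<close>

lemma kd_le_join:
  assumes P: "P a" "P b" "P c" and k: "kd P d (inf a c) a" "kd P d (inf b c) b"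
  shows "kd P d (inf (J a b) c) (J a b)"
proof -
  have ac: "kd P d c (J a c)" and bc: "kd P d c (J b c)"
    using assms kd_inf_imp_join by auto
  have PJ: "P (J a c)" "P (J b c)" "P (J (J b c) a)" "P (J a b)"
    using P P_J by auto
  have "kd P d (J c a) (J (J b c) a)"
    by (rule kd_join[OF P(3) PJ(2) P(1) J_ge2[OF P(2,3)] bc])
  moreover have ca: "J c a \<le> J a c" by (rule J_least[OF P(3,1) PJ(1) J_ge2[OF P(1,3)] J_ge1[OF P(1,3)]])
  ultimately have 1: "kd P d (J a c) (J (J b c) a)" by (rule kd_mono) simp
  have le: "b \<le> J b c" "c \<le> J b c" "J b c \<le> J (J b c) a" "a \<le> J (J b c) a" "c \<le> J a c"
    using P PJ J_ge1 J_ge2 by auto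
  have "J a c \<le> J (J b c) a"
    using J_least[OF P(1,3) PJ(3)] le(2-4) by (meson order_trans)
  then have 2: "kd P d c (J (J b c) a)"
    by (rule kd_trans[OF P(3) PJ(1,3) le(5) _ ac 1])
  have "J a b \<le> J (J b c) a"
    using J_least[OF P(1,2) PJ(3)] le(1,3,4) by (meson order_trans)
  then have "J (J a b) c \<le> J (J b c) a"
    using J_least[OF PJ(4) P(3) PJ(3)] le(2,3) by (meson order_trans)
  with 2 have "kd P d c (J (J a b) c)" by (rule kd_mono[OF _ order_refl])
  then show ?thesis by (rule kd_join_imp_inf[OF PJ(4) P(3)])
qed

end

section \<open>Modules and additive relations\<close>

interpretation poly_vs: vector_space "smult :: 'k::field \<Rightarrow> 'k poly \<Rightarrow> 'k poly"
  by unfold_locales (auto simp: smult_add_right smult_add_left)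

lemma subspace_iff:
  "subspace V \<longleftrightarrow> 0 \<in> V \<and> (\<forall>x\<in>V. \<forall>y\<in>V. x + y \<in> V) \<and> (\<forall>c. \<forall>x\<in>V. smult c x \<in> V)"
  unfolding poly_vs.subspace_def by blast

lemma linear_mapD:
  assumes "linear_map V W f" "x \<in> V"
  shows "f x \<in> W" "y \<in> V \<Longrightarrow> f (x + y) = f x + f y" "f (smult c x) = smult c (f x)"
  using assms by (auto simp: linear_map_def)

lemma linear_map_0:
  assumes "linear_map V W f" "0 \<in> V"
  shows "f 0 = 0"
  using linear_mapD(3)[OF assms, of 0] by simp

lemma linear_map_diff:
  assumes "linear_map V W f" "subspace V" "x \<in> V" "y \<in> V"
  shows "f (x - y) = f x - f y"
proof -
  have "smult (-1) y \<in> V" using assms(2,4) by (rule poly_vs.subspace_scale)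
  then show ?thesis
    using linear_mapD(2)[OF assms(1,3), of "smult (-1) y"] linear_mapD(3)[OF assms(1,4), of "-1"]
    by simp
qed

lemma hmoduleD:
  assumes "hmodule M"
  shows "subspace (sp M n)"
    and "\<phi> \<in> Mor hecke_cat n m \<Longrightarrow> linear_map (sp M n) (sp M m) (act M n m \<phi>)"
    and "x \<in> sp M n \<Longrightarrow> act M n n (Idn hecke_cat n) x = x"
    and "\<phi> \<in> Mor hecke_cat n m \<Longrightarrow> \<psi> \<in> Mor hecke_cat m l \<Longrightarrow> x \<in> sp M n \<Longrightarrow>
      act M n l (Cmp hecke_cat n m l \<psi> \<phi>) x = act M m l \<psi> (act M n m \<phi> x)"
  using assms by (simp_all add: hmodule_def)

lemma hmodule_0: "hmodule M \<Longrightarrow> 0 \<in> sp M n"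
  using hmoduleD(1)[of M n] by (rule poly_vs.subspace_0)

lemma submoduleD:
  assumes "submodule N M"
  shows "subspace (N n)" "N n \<subseteq> sp M n" "\<phi> \<in> Mor hecke_cat n m \<Longrightarrow> x \<in> N n \<Longrightarrow> act M n m \<phi> x \<in> N m"
    "N \<le> sp M"
  using assms unfolding submodule_def le_fun_def by blast+

lemma submoduleI:
  assumes "\<And>n. 0 \<in> N n" "\<And>n x y. x \<in> N n \<Longrightarrow> y \<in> N n \<Longrightarrow> x + y \<in> N n"
    "\<And>n c x. x \<in> N n \<Longrightarrow> smult c x \<in> N n" "\<And>n x. x \<in> N n \<Longrightarrow> x \<in> sp M n"
    "\<And>n m \<phi> x. \<phi> \<in> Mor hecke_cat n m \<Longrightarrow> x \<in> N n \<Longrightarrow> act M n m \<phi> x \<in> N m"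
  shows "submodule N M"
  using assms by (auto simp: submodule_def subspace_iff)

lemma submoduleE:
  assumes "submodule N M"
  shows "0 \<in> N n" "x \<in> N n \<Longrightarrow> y \<in> N n \<Longrightarrow> x + y \<in> N n" "x \<in> N n \<Longrightarrow> smult c x \<in> N n"
    "x \<in> N n \<Longrightarrow> y \<in> N n \<Longrightarrow> x - y \<in> N n" "x \<in> N n \<Longrightarrow> x \<in> sp M n"
  using submoduleD(1)[OF assms, of n] submoduleD(2)[OF assms, of n]
  by (auto simp: poly_vs.subspace_0 poly_vs.subspace_add poly_vs.subspace_diff poly_vs.subspace_scale)

section \<open>The lattice of submodules\<close>

type_synonym 'k fam = "nat \<Rightarrow> 'k poly set"

abbreviation zero_sub :: "'k::field fam" where
  "zero_sub \<equiv> \<lambda>n. {0}"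

lemma submodule_sp: "hmodule M \<Longrightarrow> submodule (sp M) M"
  using hmoduleD(1,2) by (blast intro: linear_mapD(1) submoduleI poly_vs.subspace_0
    poly_vs.subspace_add poly_vs.subspace_scale)

lemma submodule_zero: "hmodule M \<Longrightarrow> submodule zero_sub M"
  by (rule submoduleI) (auto simp: hmodule_0 linear_map_0[OF hmoduleD(2)])

lemma zero_sub_le: "submodule N M \<Longrightarrow> zero_sub \<le> N"
  using submoduleE(1) by (fastforce simp: le_fun_def)

definition sub_sum :: "'k::field fam \<Rightarrow> 'k fam \<Rightarrow> 'k fam" where
  "sub_sum N N' n = {x + y | x y. x \<in> N n \<and> y \<in> N' n}"

lemma submodule_inf: "submodule N M \<Longrightarrow> submodule N' M \<Longrightarrow> submodule (inf N N') M"
  by (rule submoduleI) (auto simp: submoduleE submoduleD)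

lemma submodule_sum:
  assumes M: "hmodule M" and N: "submodule N M" "submodule N' M"
  shows "submodule (sub_sum N N') M"
proof (rule submoduleI)
  show "0 \<in> sub_sum N N' n" for n
    using submoduleE(1)[OF N(1), of n] submoduleE(1)[OF N(2), of n] unfolding sub_sum_def by force
  show "x + y \<in> sub_sum N N' n" if "x \<in> sub_sum N N' n" "y \<in> sub_sum N N' n" for n x y
  proof -
    from that obtain a b c d where "x = a + b" "y = c + d" "a \<in> N n" "b \<in> N' n" "c \<in> N n" "d \<in> N' n"
      by (auto simp: sub_sum_def)
    moreover from this have "a + c \<in> N n" "b + d \<in> N' n"
      using submoduleE(2)[OF N(1)] submoduleE(2)[OF N(2)] by auto
    moreover have "(a + b) + (c + d) = (a + c) + (b + d)" by simp
    ultimately show ?thesis unfolding sub_sum_def by blast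
  qed
  show "smult c x \<in> sub_sum N N' n" if "x \<in> sub_sum N N' n" for n c x
    using that submoduleE(3)[OF N(1)] submoduleE(3)[OF N(2)]
    by (fastforce simp: sub_sum_def smult_add_right)
  show "x \<in> sp M n" if "x \<in> sub_sum N N' n" for n x
    using that submoduleE(5)[OF N(1)] submoduleE(5)[OF N(2)] submoduleE(2)[OF submodule_sp[OF M]]
    by (auto simp: sub_sum_def)
  show "act M n m \<phi> x \<in> sub_sum N N' m" if \<phi>: "\<phi> \<in> Mor hecke_cat n m" and "x \<in> sub_sum N N' n" for n m \<phi> x
  proof -
    from that obtain a b where ab: "x = a + b" "a \<in> N n" "b \<in> N' n" by (auto simp: sub_sum_def)
    then have "act M n m \<phi> x = act M n m \<phi> a + act M n m \<phi> b"
      using linear_mapD(2)[OF hmoduleD(2)[OF M \<phi>]] submoduleE(5)[OF N(1)] submoduleE(5)[OF N(2)] by auto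
    then show ?thesis using ab submoduleD(3)[OF N(1) \<phi>] submoduleD(3)[OF N(2) \<phi>]
      by (auto simp: sub_sum_def)
  qed
qed

lemma submodule_lattice:
  assumes M: "hmodule M"
  shows "modular_lattice (\<lambda>N. submodule N M) sub_sum"
proof
  fix A B C assume A: "submodule A M" and B: "submodule B M"
  show "submodule (inf A B) M" "submodule (sub_sum A B) M"
    using A B M submodule_inf submodule_sum by auto
  show "A \<le> sub_sum A B"
    using submoduleE(1)[OF B] by (force simp: le_fun_def sub_sum_def)
  show "B \<le> sub_sum A B"
    using submoduleE(1)[OF A] by (force simp: le_fun_def sub_sum_def)
  assume C: "submodule C M"
  show "sub_sum A B \<le> C" if "A \<le> C" "B \<le> C"
    using that submoduleE(2)[OF C] unfolding le_fun_def sub_sum_def by blast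
  show "inf (sub_sum A B) C \<le> sub_sum A (inf B C)" if "A \<le> C"
  proof (intro le_funI subsetI)
    fix n x assume "x \<in> inf (sub_sum A B) C n"
    then obtain a b where ab: "x = a + b" "a \<in> A n" "b \<in> B n" "x \<in> C n" by (auto simp: sub_sum_def)
    then have "x - a \<in> C n" using that submoduleE(4)[OF C, of x n a] by (auto simp: le_fun_def)
    then show "x \<in> sub_sum A (inf B C) n" using ab by (auto simp: sub_sum_def)
  qed
qed

section \<open>Additive relations, covering homomorphisms, their converses and roofs alike\<close>

definition arel :: "'k::field hmod \<Rightarrow> 'k hmod \<Rightarrow> 'k roof \<Rightarrow> bool" where
  "arel X Y R \<longleftrightarrow>
     (\<forall>n. R n \<subseteq> sp X n \<times> sp Y n \<and> (0, 0) \<in> R n \<and>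
        (\<forall>(x, y)\<in>R n. \<forall>(x', y')\<in>R n. (x + x', y + y') \<in> R n) \<and>
        (\<forall>c. \<forall>(x, y)\<in>R n. (smult c x, smult c y) \<in> R n)) \<and>
     (\<forall>n m. \<forall>\<phi>\<in>Mor hecke_cat n m. \<forall>(x, y)\<in>R n. (act X n m \<phi> x, act Y n m \<phi> y) \<in> R m)"

lemma arelD:
  assumes "arel X Y R"
  shows "(x, y) \<in> R n \<Longrightarrow> x \<in> sp X n" "(x, y) \<in> R n \<Longrightarrow> y \<in> sp Y n" "(0, 0) \<in> R n"
    "(x, y) \<in> R n \<Longrightarrow> (x', y') \<in> R n \<Longrightarrow> (x + x', y + y') \<in> R n"
    "(x, y) \<in> R n \<Longrightarrow> (smult c x, smult c y) \<in> R n"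
    "\<phi> \<in> Mor hecke_cat n m \<Longrightarrow> (x, y) \<in> R n \<Longrightarrow> (act X n m \<phi> x, act Y n m \<phi> y) \<in> R m"
  using assms unfolding arel_def by blast+

lemma arel_diff:
  assumes "arel X Y R" "(x, y) \<in> R n" "(x', y') \<in> R n"
  shows "(x - x', y - y') \<in> R n"
  using arelD(4)[OF assms(1,2) arelD(5)[OF assms(1,3), of "-1"]] by simp

lemma arelI:
  assumes "\<And>n x y. (x, y) \<in> R n \<Longrightarrow> x \<in> sp X n \<and> y \<in> sp Y n" "\<And>n. (0, 0) \<in> R n"
    "\<And>n x y x' y'. (x, y) \<in> R n \<Longrightarrow> (x', y') \<in> R n \<Longrightarrow> (x + x', y + y') \<in> R n"
    "\<And>n c x y. (x, y) \<in> R n \<Longrightarrow> (smult c x, smult c y) \<in> R n"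
    "\<And>n m \<phi> x y. \<phi> \<in> Mor hecke_cat n m \<Longrightarrow> (x, y) \<in> R n \<Longrightarrow> (act X n m \<phi> x, act Y n m \<phi> y) \<in> R m"
  shows "arel X Y R"
  unfolding arel_def
proof (intro conjI allI ballI)
  show "R n \<subseteq> sp X n \<times> sp Y n" for n using assms(1) by auto
  show "(0, 0) \<in> R n" for n by (rule assms(2))
  show "case p of (x, y) \<Rightarrow> \<forall>(x', y')\<in>R n. (x + x', y + y') \<in> R n" if "p \<in> R n" for n p
    using assms(3) that by auto
  show "case p of (x, y) \<Rightarrow> (smult c x, smult c y) \<in> R n" if "p \<in> R n" for n c p
    using assms(4) that by auto
  show "case p of (x, y) \<Rightarrow> (act X n m \<phi> x, act Y n m \<phi> y) \<in> R m"
    if "\<phi> \<in> Mor hecke_cat n m" "p \<in> R n" for n m \<phi> p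
    using assms(5) that by auto
qed

definition rconv :: "'k::field roof \<Rightarrow> 'k roof" where
  "rconv R = (\<lambda>n. (R n)\<inverse>)"

definition rimg :: "'k::field roof \<Rightarrow> 'k fam \<Rightarrow> 'k fam" where
  "rimg R N = (\<lambda>n. R n `` N n)"

lemma arel_rconv: "arel X Y R \<Longrightarrow> arel Y X (rconv R)"
  by (rule arelI) (auto simp: rconv_def dest: arelD)

lemma arel_comp:
  assumes R: "arel X Y R" and S: "arel Y Z S"
  shows "arel X Z (\<lambda>n. R n O S n)"
proof (rule arelI)
  fix n x z assume "(x, z) \<in> R n O S n"
  then obtain y where y: "(x, y) \<in> R n" "(y, z) \<in> S n" by auto
  show "x \<in> sp X n \<and> z \<in> sp Z n" using y arelD(1)[OF R] arelD(2)[OF S] by auto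
  show "(smult c x, smult c z) \<in> R n O S n" for c
    using arelD(5)[OF R y(1)] arelD(5)[OF S y(2)] by auto
  show "(act X n m \<phi> x, act Z n m \<phi> z) \<in> R m O S m" if "\<phi> \<in> Mor hecke_cat n m" for m \<phi>
    using arelD(6)[OF R that y(1)] arelD(6)[OF S that y(2)] by auto
  fix x' z' assume "(x', z') \<in> R n O S n"
  then obtain y' where y': "(x', y') \<in> R n" "(y', z') \<in> S n" by auto
  show "(x + x', z + z') \<in> R n O S n"
    using arelD(4)[OF R y(1) y'(1)] arelD(4)[OF S y(2) y'(2)] by auto
qed (use arelD(3)[OF R] arelD(3)[OF S] in auto)

lemma submodule_rimg:
  assumes R: "arel X Y R" and N: "submodule N X"
  shows "submodule (rimg R N) Y"
proof (rule submoduleI)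
  show "0 \<in> rimg R N n" for n
    using arelD(3)[OF R] submoduleE(1)[OF N] by (auto simp: rimg_def)
  fix n y assume "y \<in> rimg R N n"
  then obtain x where x: "x \<in> N n" "(x, y) \<in> R n" by (auto simp: rimg_def)
  show "y \<in> sp Y n" using arelD(2)[OF R x(2)] .
  show "smult c y \<in> rimg R N n" for c
    using arelD(5)[OF R x(2)] submoduleE(3)[OF N x(1)] by (auto simp: rimg_def)
  show "act Y n m \<phi> y \<in> rimg R N m" if "\<phi> \<in> Mor hecke_cat n m" for m \<phi>
    using arelD(6)[OF R that x(2)] submoduleD(3)[OF N that x(1)] by (auto simp: rimg_def)
  fix y' assume "y' \<in> rimg R N n"
  then obtain x' where x': "x' \<in> N n" "(x', y') \<in> R n" by (auto simp: rimg_def)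
  show "y + y' \<in> rimg R N n"
    using arelD(4)[OF R x(2) x'(2)] submoduleE(2)[OF N x(1) x'(1)] by (auto simp: rimg_def)
qed

lemma rimg_mono: "N \<le> N' \<Longrightarrow> rimg R N \<le> rimg R N'"
  by (auto simp: rimg_def le_fun_def)

abbreviation mkd :: "'k::field hmod \<Rightarrow> nat \<Rightarrow> 'k fam \<Rightarrow> 'k fam \<Rightarrow> bool" where
  "mkd M \<equiv> kd (\<lambda>N. submodule N M)"

text \<open>Sending \<open>N\<close> to the part of \<open>V\<close> related to it by \<open>R\<close> embeds the interval from
  \<open>R[U]\<close> to \<open>R[V]\<close> into the lattice of submodules between (the domain parts of) \<open>U\<close> and \<open>V\<close>.\<close>

lemma arel_kd:
  assumes X: "hmodule X" and Y: "hmodule Y" and R: "arel X Y R"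
    and U: "submodule U X" and V: "submodule V X" and UV: "U \<le> V" and k: "mkd X d U V"
  shows "mkd Y d (rimg R U) (rimg R V)"
proof -
  interpret modular_lattice "\<lambda>N. submodule N X" sub_sum by (rule submodule_lattice[OF X])
  define D where "D = rimg (rconv R) (sp Y)"
  have D: "submodule D X"
    unfolding D_def by (rule submodule_rimg[OF arel_rconv[OF R] submodule_sp[OF Y]])
  \<comment> \<open>Only the part of \<open>U\<close> in the domain of \<open>R\<close> comes back
    under the converse relation, so the interval is first cut down to \<open>D\<close>.\<close>
  have "mkd X d (inf U D) (inf V D)" by (rule kd_inf[OF U V D UV k])
  then have 1: "mkd X d (inf (rimg (rconv R) (rimg R U)) V) (inf (rimg (rconv R) (rimg R V)) V)"
  proof (rule kd_mono)
    show "inf U D \<le> inf (rimg (rconv R) (rimg R U)) V"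
      using UV by (force simp: le_fun_def D_def rimg_def rconv_def)
    show "inf (rimg (rconv R) (rimg R V)) V \<le> inf V D"
      using arelD(2)[OF R] by (force simp: le_fun_def D_def rimg_def rconv_def)
  qed
  show ?thesis
  proof (rule kd_embed[where f = "\<lambda>N. inf (rimg (rconv R) N) V", OF 1])
    show "submodule (inf (rimg (rconv R) N) V) X" if "submodule N Y" for N
      by (intro submodule_inf submodule_rimg[OF arel_rconv[OF R]] that V)
    show "inf (rimg (rconv R) N) V \<le> inf (rimg (rconv R) N') V" if "N \<le> N'" for N N'
      using rimg_mono[OF that] by (meson inf_mono order_refl)
    fix N N' assume N: "submodule N Y" "submodule N' Y" and le: "rimg R U \<le> N" "N \<le> N'" "N' \<le> rimg R V"
      and f: "inf (rimg (rconv R) N') V \<le> inf (rimg (rconv R) N) V"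
    show "N' \<le> N"
    proof (intro le_funI subsetI)
      fix n y assume y: "y \<in> N' n"
      then obtain v where v: "v \<in> V n" "(v, y) \<in> R n" using le(3) by (fastforce simp: le_fun_def rimg_def)
      then have "v \<in> inf (rimg (rconv R) N) V n"
        using y f by (fastforce simp: le_fun_def rimg_def rconv_def)
      then obtain z where z: "z \<in> N n" "(v, z) \<in> R n" by (auto simp: rimg_def rconv_def)
      \<comment> \<open>Both \<open>y\<close> and \<open>z\<close> are related to \<open>v\<close>,
        so they differ by an element of the image of zero, which lies in the image of
        \<open>U\<close> and hence in \<open>N\<close>.\<close>
      have "(0, y - z) \<in> R n" using arel_diff[OF R v(2) z(2)] by simp
      then have "y - z \<in> N n"
        using le(1) submoduleE(1)[OF U, of n] by (fastforce simp: le_fun_def rimg_def)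
      then show "y \<in> N n" using submoduleE(2)[OF N(1) _ z(1)] by fastforce
    qed
  qed (use U V UV in \<open>auto intro: submodule_rimg[OF R] rimg_mono\<close>)
qed

section \<open>Finitely generated modules are noetherian\<close>

definition wact :: "'k::field hmod \<Rightarrow> nat \<Rightarrow> nat \<Rightarrow> nat list \<Rightarrow> 'k poly \<Rightarrow> 'k poly" where
  "wact M n m w = act M n m (cls n m w)"

lemma wact_linear: "hmodule M \<Longrightarrow> n \<le> m \<Longrightarrow> w \<in> words m \<Longrightarrow> linear_map (sp M n) (sp M m) (wact M n m w)"
  unfolding wact_def by (intro hmoduleD(2) cls_Mor)

lemma wact_in: "hmodule M \<Longrightarrow> n \<le> m \<Longrightarrow> w \<in> words m \<Longrightarrow> x \<in> sp M n \<Longrightarrow> wact M n m w x \<in> sp M m"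
  by (rule linear_mapD(1)[OF wact_linear])

lemma wact_Nil: "hmodule M \<Longrightarrow> x \<in> sp M n \<Longrightarrow> wact M n n [] x = x"
  unfolding wact_def by (metis Idn_eq hmoduleD(3))

lemma wact_wact:
  assumes "hmodule M" "n \<le> m" "m \<le> l" "u \<in> words m" "v \<in> words l" "x \<in> sp M n"
  shows "wact M m l v (wact M n m u x) = wact M n l (v @ u) x"
  using hmoduleD(4)[OF assms(1) cls_Mor cls_Mor assms(6), of m u l v] assms
  by (simp add: wact_def Cmp_cls)

lemma wact_heq: "heq m u v \<Longrightarrow> u \<in> words m \<Longrightarrow> v \<in> words m \<Longrightarrow> wact M n m u = wact M n m v"
  using cls_heq[of u m v n] by (simp add: wact_def)

lemma wact_dummy: "w \<in> words m \<Longrightarrow> n < j \<Longrightarrow> j < m \<Longrightarrow> wact M n m (w @ [j]) = wact M n m w"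
  using cls_dummy[of w m n j] by (simp add: wact_def)

text \<open>Every morphism is a composite of the morphisms from \<open>[n]\<close> to
  \<open>[n + 1]\<close> given by the empty word and of single generators, so invariance can be
  checked on these.\<close>

lemma wact_invariant:
  assumes M: "hmodule M"
    and U: "\<And>n. U n \<subseteq> sp M n"
    and append: "\<And>n x. x \<in> U n \<Longrightarrow> wact M n (Suc n) [] x \<in> U (Suc n)"
    and gen: "\<And>n i x. x \<in> U n \<Longrightarrow> 1 \<le> i \<Longrightarrow> i < n \<Longrightarrow> wact M n n [i] x \<in> U n"
    and x: "x \<in> U n" and nm: "n \<le> m" and w: "w \<in> words m"
  shows "wact M n m w x \<in> U m"
proof -
  have x': "x \<in> sp M n" using x U by auto
  have 0: "wact M n m [] x \<in> U m"
    using nm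
  proof (induction rule: dec_induct)
    case base
    then show ?case using x wact_Nil[OF M x'] by simp
  next
    case (step m)
    then have "wact M n (Suc m) [] x = wact M m (Suc m) [] (wact M n m [] x)"
      using wact_wact[OF M, of n m "Suc m" "[]" "[]" x] x' by auto
    then show ?case using append step by simp
  qed
  show ?thesis using w
  proof (induction w)
    case Nil
    then show ?case using 0 by simp
  next
    case (Cons i w)
    then have "wact M n m (i # w) x = wact M m m [i] (wact M n m w x)"
      using wact_wact[OF M nm, of m w "[i]" x] x' by auto
    then show ?case using gen Cons by simp
  qed
qed

text \<open>\<open>ins M m p\<close> is the action of the morphism from \<open>[m]\<close> to \<open>[m + 1]\<close> that inserts a
  dummy strand behind the \<open>p\<close>-th strand. These generate the action of the order-preserving injections.\<close>

definition ins :: "'k::field hmod \<Rightarrow> nat \<Rightarrow> nat \<Rightarrow> 'k poly \<Rightarrow> 'k poly" where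
  "ins M m p = wact M m (Suc m) [Suc p..<Suc m]"

lemma ins_linear: "hmodule M \<Longrightarrow> linear_map (sp M m) (sp M (Suc m)) (ins M m p)"
  unfolding ins_def by (intro wact_linear words_upt) auto

lemma ins_in: "hmodule M \<Longrightarrow> x \<in> sp M m \<Longrightarrow> ins M m p x \<in> sp M (Suc m)"
  by (rule linear_mapD(1)[OF ins_linear])

lemma ins_submodule: "submodule N M \<Longrightarrow> x \<in> N m \<Longrightarrow> ins M m p x \<in> N (Suc m)"
  unfolding ins_def wact_def by (rule submoduleD(3)) (auto intro!: cls_Mor words_upt)

text \<open>The cosimplicial identity for two insertions of dummy strands.\<close>

lemma ins_ins:
  assumes M: "hmodule M" and x: "x \<in> sp M m" and qp: "q < p" "p \<le> Suc m"
  shows "ins M (Suc m) p (ins M m q x) = ins M (Suc m) q (ins M m (p - 1) x)"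
proof -
  have w: "[Suc p..<Suc (Suc m)] \<in> words (Suc (Suc m))" "[Suc q..<Suc m] \<in> words (Suc (Suc m))"
    "[Suc q..<Suc m] \<in> words (Suc m)" "[p..<Suc m] \<in> words (Suc m)"
    "[Suc q..<Suc (Suc m)] \<in> words (Suc (Suc m))" "[p..<Suc m] \<in> words (Suc (Suc m))"
    using qp by (auto intro!: words_upt)
  have "ins M (Suc m) q (ins M m (p - 1) x) = wact M m (Suc (Suc m)) ([Suc q..<Suc (Suc m)] @ [p..<Suc m]) x"
    unfolding ins_def using w qp x by (subst wact_wact[OF M]) auto
  also have "heq (Suc (Suc m)) ([Suc p..<Suc (Suc m)] @ [Suc q..<Suc (Suc m)]) ([Suc q..<Suc (Suc m)] @ [p..<Suc m])"
    using qp by (intro heq_upt_upt) auto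
  then have "wact M m (Suc (Suc m)) ([Suc q..<Suc (Suc m)] @ [p..<Suc m]) x =
    wact M m (Suc (Suc m)) (([Suc p..<Suc (Suc m)] @ [Suc q..<Suc m]) @ [Suc m]) x"
    using w qp by (subst wact_heq[OF heq_sym]) auto
  \<comment> \<open>The letter \<open>Suc m\<close> crosses only the two dummy strands of a morphism
    from \<open>[m]\<close> to \<open>[m + 2]\<close>.\<close>
  also have "\<dots> = wact M m (Suc (Suc m)) ([Suc p..<Suc (Suc m)] @ [Suc q..<Suc m]) x"
    using w by (subst wact_dummy) auto
  also have "\<dots> = ins M (Suc m) p (ins M m q x)"
    unfolding ins_def using w x by (subst wact_wact[OF M]) auto
  finally show ?thesis by simp
qed

text \<open>A generator applied after an insertion shifts the place of the insertion, disappears, or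
  can be applied before it. Hence a generating set closed under the generators of its own degrees
  spans the module through insertions alone.\<close>

lemma gen_ins:
  assumes M: "hmodule M" and x: "x \<in> sp M m" and p: "p \<le> m" and i: "1 \<le> i" "i < Suc m"
  shows "i = p \<Longrightarrow> wact M (Suc m) (Suc m) [i] (ins M m p x) = ins M m (p - 1) x"
    and "i = Suc p \<Longrightarrow> wact M (Suc m) (Suc m) [i] (ins M m p x) = ins M m p x"
    and "Suc p < i \<Longrightarrow> wact M (Suc m) (Suc m) [i] (ins M m p x) = ins M m p (wact M m m [i - 1] x)"
    and "i < p \<Longrightarrow> wact M (Suc m) (Suc m) [i] (ins M m p x) = ins M m p (wact M m m [i] x)"
proof -
  have w: "[Suc p..<Suc m] \<in> words (Suc m)" by (auto intro: words_upt)
  have eq: "wact M (Suc m) (Suc m) [i] (ins M m p x) = wact M m (Suc m) (i # [Suc p..<Suc m]) x"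
    unfolding ins_def using w x i by (subst wact_wact[OF M]) auto
  have eq': "ins M m p (wact M m m [h] x) = wact M m (Suc m) ([Suc p..<Suc m] @ [h]) x"
    if "1 \<le> h" "h < m" for h
    unfolding ins_def using w x i that by (subst wact_wact[OF M]) auto
  note h = heq_Cons_upt[of "Suc p" "Suc m" "Suc m" i]
  show "wact M (Suc m) (Suc m) [i] (ins M m p x) = ins M m (p - 1) x" if "i = p"
    unfolding eq using h(1) i that by (simp add: ins_def del: upt_Suc)
  show "wact M (Suc m) (Suc m) [i] (ins M m p x) = ins M m p x" if "i = Suc p"
    unfolding eq using wact_heq[OF h(2), of M m] i w that by (simp add: ins_def del: upt_Suc)
  show "wact M (Suc m) (Suc m) [i] (ins M m p x) = ins M m p (wact M m m [i - 1] x)" if "Suc p < i"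
  proof -
    have "1 \<le> i - 1" "i - 1 < m" "i - 1 < Suc m" using that i by auto
    then show ?thesis
      using wact_heq[OF h(3), of M m] i w that eq eq'[of "i - 1"] by (simp del: upt_Suc)
  qed
  show "wact M (Suc m) (Suc m) [i] (ins M m p x) = ins M m p (wact M m m [i] x)" if "i < p"
    using wact_heq[OF h(4), of M m] i w p that eq eq'[of i] by (simp del: upt_Suc)
qed

section \<open>Iterated insertions and lists of gaps\<close>

primrec insn :: "'k::field hmod \<Rightarrow> nat \<Rightarrow> nat \<Rightarrow> nat \<Rightarrow> 'k poly \<Rightarrow> 'k poly" where
  "insn M m p 0 x = x"
| "insn M m p (Suc k) x = ins M (m + k) p (insn M m p k x)"

lemma insn_in: "hmodule M \<Longrightarrow> x \<in> sp M m \<Longrightarrow> insn M m p k x \<in> sp M (m + k)"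
  by (induction k) (auto intro: ins_in)

text \<open>Dummy strands are interchangeable: by \<open>ins_ins\<close> an insertion inside a gap
  or at its right end can be moved to its left end.\<close>

lemma ins_insn_absorb:
  assumes M: "hmodule M" and x: "x \<in> sp M m" and "j \<le> p" "p \<le> j + g" "j \<le> m"
  shows "ins M (m + g) p (insn M m j g x) = insn M m j (Suc g) x"
  using assms(3-5)
proof (induction g arbitrary: p)
  case 0
  then show ?case by simp
next
  case (Suc g)
  show ?case
  proof (cases "p = j")
    case False
    have "ins M (Suc (m + g)) p (ins M (m + g) j (insn M m j g x)) =
      ins M (Suc (m + g)) j (ins M (m + g) (p - 1) (insn M m j g x))"
      using Suc False by (intro ins_ins[OF M insn_in[OF M x]]) auto
    also have "ins M (m + g) (p - 1) (insn M m j g x) = insn M m j (Suc g) x"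
      using Suc.prems False by (intro Suc.IH) auto
    finally show ?thesis by simp
  qed simp
qed

lemma ins_insn_pass:
  assumes M: "hmodule M" and x: "x \<in> sp M m" and "j + g < p" "p \<le> m + g"
  shows "ins M (m + g) p (insn M m j g x) = insn M (Suc m) j g (ins M m (p - g) x)"
  using assms(3,4)
proof (induction g arbitrary: p)
  case 0
  then show ?case by simp
next
  case (Suc g)
  have "ins M (Suc (m + g)) p (ins M (m + g) j (insn M m j g x)) =
    ins M (Suc (m + g)) j (ins M (m + g) (p - 1) (insn M m j g x))"
    using Suc.prems by (intro ins_ins[OF M insn_in[OF M x]]) auto
  also have "ins M (m + g) (p - 1) (insn M m j g x) = insn M (Suc m) j g (ins M m (p - 1 - g) x)"
    using Suc.prems by (intro Suc.IH) auto
  finally show ?case by simp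
qed

text \<open>The element \<open>gap_elt M n x 0 [g\<^sub>0, \<dots>, g\<^sub>n]\<close> is the image of \<open>x \<in> M\<^sub>n\<close> under the
  order-preserving injection that leaves \<open>g\<^sub>0\<close> positions free before the first strand, \<open>g\<^sub>1\<close> after the
  first strand, and so on.\<close>

primrec gap_elt :: "'k::field hmod \<Rightarrow> nat \<Rightarrow> 'k poly \<Rightarrow> nat \<Rightarrow> nat list \<Rightarrow> 'k poly" where
  "gap_elt M n x j [] = x"
| "gap_elt M n x j (g # gs) = insn M (n + sum_list gs) j g (gap_elt M n x (Suc j) gs)"

lemma gap_elt_in: "hmodule M \<Longrightarrow> x \<in> sp M n \<Longrightarrow> gap_elt M n x j gs \<in> sp M (n + sum_list gs)"
proof (induction gs arbitrary: j)
  case (Cons g gs)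
  then show ?case using insn_in[of M "gap_elt M n x (Suc j) gs" "n + sum_list gs" j g]
    by (simp add: ac_simps)
qed simp

text \<open>\<open>r\<close> counts free places and strands from the left; a position beyond the gap
  \<open>g\<close> is passed on as \<open>r - g - 1\<close>, which discounts the gap and the strand
  behind it.\<close>

primrec bump :: "nat \<Rightarrow> nat list \<Rightarrow> nat list" where
  "bump r [] = []"
| "bump r (g # gs) = (if r \<le> g then Suc g # gs else g # bump (r - g - 1) gs)"

lemma length_bump [simp]: "length (bump r gs) = length gs"
  by (induction gs arbitrary: r) auto

lemma sum_list_bump: "r < sum_list gs + length gs \<Longrightarrow> sum_list (bump r gs) = Suc (sum_list gs)"
proof (induction gs arbitrary: r)
  case (Cons g gs)
  then show ?case using Cons.IH[of "r - g - 1"] by auto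
qed simp

text \<open>This makes the lexicographic order a monomial order for insertions. If \<open>r\<close>
  lies beyond the smaller of two gaps but not beyond the larger one, only the larger gap grows, so
  strictness survives.\<close>

lemma bump_less: "as < bs \<Longrightarrow> length as = length bs \<Longrightarrow> bump r as < bump r (bs :: nat list)"
proof (induction as arbitrary: bs r)
  case (Cons a as)
  then obtain b bs' where "bs = b # bs'" by (cases bs) auto
  then show ?case using Cons by auto
qed simp

text \<open>Each single gap can be widened by an insertion. Divisibility of gap lists is therefore
  the componentwise order, to which Dickson's lemma applies.\<close>

lemma bump_at:
  "t < length gs \<Longrightarrow> \<exists>r. r < sum_list gs + length gs \<and> bump r gs = gs[t := Suc (gs ! t)]"
proof (induction gs arbitrary: t)
  case (Cons g gs)
  show ?case
  proof (cases t)
    case 0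
    then show ?thesis by (intro exI[of _ 0]) auto
  next
    case (Suc t')
    then obtain r where "r < sum_list gs + length gs" "bump r gs = gs[t' := Suc (gs ! t')]"
      using Cons by auto
    then show ?thesis using Suc by (intro exI[of _ "Suc (g + r)"]) auto
  qed
qed simp

text \<open>Here \<open>j\<close> is the number of strands to the left of the first listed gap. The
  new strand is absorbed by that gap or passes it and goes on to the next one.\<close>

lemma ins_gap_elt:
  assumes M: "hmodule M" and x: "x \<in> sp M n"
    and "length gs + j = Suc n" "j \<le> p" "p \<le> n + sum_list gs"
  shows "ins M (n + sum_list gs) p (gap_elt M n x j gs) = gap_elt M n x j (bump (p - j) gs)"
  using assms(3-5)
proof (induction gs arbitrary: j p)
  case Nil
  then show ?case by simp
next
  case (Cons g gs)
  let ?y = "gap_elt M n x (Suc j) gs" and ?m = "n + sum_list gs"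
  have y: "?y \<in> sp M ?m" by (rule gap_elt_in[OF M x])
  have m: "n + sum_list (g # gs) = ?m + g" by simp
  show ?case
  proof (cases "p - j \<le> g")
    case True
    then show ?thesis unfolding m
      using Cons.prems ins_insn_absorb[OF M y, of j p g] by simp
  next
    case False
    have "ins M (?m + g) p (insn M ?m j g ?y) = insn M (Suc ?m) j g (ins M ?m (p - g) ?y)"
      using Cons.prems False by (intro ins_insn_pass[OF M y]) auto
    also have "ins M ?m (p - g) ?y = gap_elt M n x (Suc j) (bump (p - g - Suc j) gs)"
      using Cons.prems False by (intro Cons.IH) auto
    also have "p - g - Suc j = p - j - g - 1" by simp
    also have "Suc ?m = n + sum_list (bump (p - j - g - 1) gs)"
      using Cons.prems False by (subst sum_list_bump) auto
    finally show ?thesis unfolding m using False by simp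
  qed
qed

text \<open>By induction there is a finite \<open>G\<close> whose tails bound all tails from below.
  An element whose head exceeds all heads of \<open>G\<close> lies above some member of
  \<open>G\<close>; each of the finitely many smaller heads falls under the induction hypothesis
  again.\<close>

lemma dickson:
  fixes A :: "nat list set"
  assumes "\<And>a. a \<in> A \<Longrightarrow> length a = n"
  shows "\<exists>F. finite F \<and> F \<subseteq> A \<and> (\<forall>a\<in>A. \<exists>f\<in>F. list_all2 (\<le>) f a)"
  using assms
proof (induction n arbitrary: A)
  case 0
  then have "A \<subseteq> {[]}" by auto
  then show ?case by (intro exI[of _ A]) (auto intro: finite_subset)
next
  case (Suc n)
  have "\<exists>F. finite F \<and> F \<subseteq> tl ` A \<and> (\<forall>a\<in>tl ` A. \<exists>f\<in>F. list_all2 (\<le>) f a)"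
    using Suc.prems by (intro Suc.IH) auto
  then obtain F where F: "finite F \<and> F \<subseteq> tl ` A \<and> (\<forall>a\<in>tl ` A. \<exists>f\<in>F. list_all2 (\<le>) f a)" ..
  obtain G where G: "G \<subseteq> A" "finite G" "F = tl ` G"
    using finite_subset_image[of F tl A] F by blast
  define c where "c = Suc (Max (insert 0 (hd ` G)))"
  have "\<forall>i. \<exists>F. finite F \<and> F \<subseteq> {b. i # b \<in> A} \<and> (\<forall>a\<in>{b. i # b \<in> A}. \<exists>f\<in>F. list_all2 (\<le>) f a)"
    using Suc.prems by (intro allI Suc.IH) fastforce
  from choice[OF this] obtain H where *: "\<forall>i. finite (H i) \<and> H i \<subseteq> {b. i # b \<in> A} \<and>
    (\<forall>a\<in>{b. i # b \<in> A}. \<exists>f\<in>H i. list_all2 (\<le>) f a)" ..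
  have H: "finite (H i)" "H i \<subseteq> {b. i # b \<in> A}" for i
    using spec[OF *, of i] by blast+
  have H': "\<exists>f\<in>H i. list_all2 (\<le>) f a" if "i # a \<in> A" for i a
    by (rule bspec[OF spec[OF *, of i, THEN conjunct2, THEN conjunct2]]) (use that in simp)
  show ?case
  proof (intro exI[of _ "G \<union> (\<Union>i<c. (#) i ` H i)"] conjI ballI)
    show "finite (G \<union> (\<Union>i<c. (#) i ` H i))" using G H by auto
    show "G \<union> (\<Union>i<c. (#) i ` H i) \<subseteq> A" using G H by auto
    fix a assume a: "a \<in> A"
    then obtain i b where ib: "a = i # b" using Suc.prems[of a] by (cases a) auto
    show "\<exists>f\<in>G \<union> (\<Union>i<c. (#) i ` H i). list_all2 (\<le>) f a"
    proof (cases "i < c")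
      case True
      obtain f where "f \<in> H i" "list_all2 (\<le>) f b" using H'[of i b] a ib by auto
      then show ?thesis using True ib by (intro bexI[of _ "i # f"]) auto
    next
      case False
      obtain g where g: "g \<in> G" "list_all2 (\<le>) (tl g) b" using F a G ib by force
      have "hd g \<le> Max (insert 0 (hd ` G))" using g G by (intro Max_ge) auto
      then have "hd g \<le> i" using False by (simp add: c_def)
      moreover have "g = hd g # tl g" using G g Suc.prems[of g] by (cases g) auto
      ultimately have "list_all2 (\<le>) g a" using g ib by (metis list_all2_Cons)
      then show ?thesis using g by auto
    qed
  qed
qed

lemma finite_gen_closed:
  assumes M: "hmodule M" and x: "x \<in> sp M n"
  shows "\<exists>F. finite F \<and> x \<in> F \<and> F \<subseteq> sp M n \<and> (\<forall>y\<in>F. \<forall>i. 1 \<le> i \<and> i < n \<longrightarrow> wact M n n [i] y \<in> F)"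
proof -
  have "\<exists>F. finite F \<and> x \<in> F \<and> F \<subseteq> sp M n \<and> (\<forall>y\<in>F. \<forall>i. 1 \<le> i \<and> i < k \<longrightarrow> wact M n n [i] y \<in> F)"
    if "k \<le> n" for k
    using that
  proof (induction k)
    case 0
    then show ?case using x by (intro exI[of _ "{x}"]) auto
  next
    case (Suc k)
    then obtain F where F: "finite F" "x \<in> F" "F \<subseteq> sp M n"
      "\<And>y i. y \<in> F \<Longrightarrow> 1 \<le> i \<Longrightarrow> i < k \<Longrightarrow> wact M n n [i] y \<in> F"
      by auto
    \<comment> \<open>The words \<open>[a..<Suc k]\<close> are the minimal coset representatives of
      the symmetric group on \<open>k\<close> letters in the one on \<open>k + 1\<close> letters;
      \<open>a = Suc k\<close> gives the empty word.\<close>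
    define G where "G = (\<Union>a\<in>{1..Suc k}. wact M n n [a..<Suc k] ` F)"
    have w: "[a..<Suc k] \<in> words n" if "1 \<le> a" for a
      using that Suc by (intro words_upt) auto
    have GI: "wact M n n [a..<Suc k] y \<in> G" if "1 \<le> a" "a \<le> Suc k" "y \<in> F" for a y
      using that by (auto simp: G_def)
    show ?case
    proof (intro exI[of _ G] conjI ballI allI impI)
      show "finite G" using F by (auto simp: G_def)
      show "x \<in> G" using GI[of "Suc k" x] F wact_Nil[OF M x] by simp
      show "G \<subseteq> sp M n" unfolding G_def using F(3) w wact_in[OF M, of n n] by fastforce
      fix z i assume "z \<in> G" and i: "1 \<le> i \<and> i < Suc k"
      then obtain a y where a: "1 \<le> a" "a \<le> Suc k" "y \<in> F" "z = wact M n n [a..<Suc k] y"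
        by (auto simp: G_def)
      have y: "y \<in> sp M n" using a F by auto
      have eq: "wact M n n [i] z = wact M n n (i # [a..<Suc k]) y"
        unfolding a(4) using w[OF a(1)] y i Suc by (subst wact_wact[OF M]) auto
      have eq': "wact M n n [a..<Suc k] (wact M n n [h] y) = wact M n n ([a..<Suc k] @ [h]) y"
        if "1 \<le> h" "h < n" for h
        using w[OF a(1)] y that by (subst wact_wact[OF M]) auto
      note h = heq_Cons_upt[of a "Suc k" n i]
      consider "i + 1 = a" | "i = a" | "a < i" | "i + 1 < a" by linarith
      then show "wact M n n [i] z \<in> G"
      proof cases
        case 1
        then show ?thesis unfolding eq using h(1) a i Suc GI by (simp del: upt_Suc)
      next
        case 2
        then show ?thesis unfolding eq using wact_heq[OF h(2), of M n] a i Suc w[OF a(1)] GI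
          by (simp del: upt_Suc)
      next
        case 3
        then have "wact M n n [i - 1] y \<in> F" "1 \<le> i - 1" "i - 1 < n" using F(4) a i Suc by auto
        then show ?thesis unfolding eq
          using wact_heq[OF h(3), of M n] a i Suc w[OF a(1)] GI 3 eq'[of "i - 1", symmetric]
          by (simp del: upt_Suc)
      next
        case 4
        then have "wact M n n [i] y \<in> F" using F(4) a i by auto
        then show ?thesis unfolding eq
          using wact_heq[OF h(4), of M n] a i Suc w[OF a(1)] GI 4 eq'[of i, symmetric]
          by (simp del: upt_Suc)
      qed
    qed
  qed
  then show ?thesis by blast
qed

lemma linear_map_span:
  assumes f: "linear_map V W f" and V: "subspace V" "S \<subseteq> V" and x: "x \<in> poly_vs.span S"
  shows "f x \<in> poly_vs.span (f ` S)"
proof -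
  have "poly_vs.span S \<subseteq> V" using V by (simp add: poly_vs.span_minimal)
  from x have "x \<in> V \<and> f x \<in> poly_vs.span (f ` S)"
  proof (induction rule: poly_vs.span_induct_alt)
    case base
    then show ?case using V f by (simp add: linear_map_0 poly_vs.subspace_0 poly_vs.span_zero)
  next
    case (step c x y)
    have x: "x \<in> V" "smult c x \<in> V" using step V by (auto intro: poly_vs.subspace_scale)
    then have "f (smult c x + y) = smult c (f x) + f y"
      using step linear_mapD[OF f] by simp
    then show ?case using step x V
      by (auto intro: poly_vs.subspace_add poly_vs.span_add poly_vs.span_scale poly_vs.span_base)
  qed
  then show ?thesis by simp
qed

text \<open>Finitely many generators, closed under the action of the 0-Hecke monoids, so that they also
  generate the module over the category of order-preserving injections.\<close>

locale gen_module =
  fixes M :: "'k::field hmod" and gens :: "(nat \<times> 'k poly) list"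
  assumes M: "hmodule M"
    and gens_in: "(n, x) \<in> set gens \<Longrightarrow> x \<in> sp M n"
    and gens_closed: "(n, x) \<in> set gens \<Longrightarrow> 1 \<le> i \<Longrightarrow> i < n \<Longrightarrow> (n, wact M n n [i] x) \<in> set gens"
    and gens_gen: "submodule N M \<Longrightarrow> (\<And>n x. (n, x) \<in> set gens \<Longrightarrow> x \<in> N n) \<Longrightarrow> N = sp M"
begin

text \<open>A label consists of the index of a generator, say of degree \<open>n\<close>, and the
  \<open>n + 1\<close> gaps of an order-preserving injection. As lists, labels are compared by the
  index first and then lexicographically by the gaps.\<close>

definition label :: "nat \<Rightarrow> nat list \<Rightarrow> bool" where
  "label m l \<longleftrightarrow> (\<exists>k gs. l = k # gs \<and> k < length gens \<and> length gs = Suc (fst (gens ! k)) \<and>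
     m = fst (gens ! k) + sum_list gs)"

definition val :: "nat list \<Rightarrow> 'k poly" where
  "val l = gap_elt M (fst (gens ! hd l)) (snd (gens ! hd l)) 0 (tl l)"

lemma val_in: "label m l \<Longrightarrow> val l \<in> sp M m"
  using gens_in by (auto simp: label_def val_def intro!: gap_elt_in[OF M])

lemma ins_val:
  assumes "label m l" "p \<le> m"
  shows "ins M m p (val l) = val (hd l # bump p (tl l))" "label (Suc m) (hd l # bump p (tl l))"
proof -
  obtain k gs where l: "l = k # gs" "k < length gens" "length gs = Suc (fst (gens ! k))"
     "m = fst (gens ! k) + sum_list gs" using assms by (auto simp: label_def)
  have "snd (gens ! k) \<in> sp M (fst (gens ! k))" using l gens_in by simp
  then show "ins M m p (val l) = val (hd l # bump p (tl l))"
    using ins_gap_elt[OF M, of "snd (gens ! k)" "fst (gens ! k)" gs 0 p] l assms by (simp add: val_def)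
  show "label (Suc m) (hd l # bump p (tl l))"
    using l assms by (auto simp: label_def sum_list_bump)
qed

lemma finite_labels: "finite {l. label m l}"
proof -
  have "{l. label m l} \<subseteq> (\<Union>k<length gens. (#) k ` {gs. set gs \<subseteq> {..m} \<and> length gs = Suc (fst (gens ! k))})"
  proof
    fix l assume "l \<in> {l. label m l}"
    then obtain k gs where l: "l = k # gs" "k < length gens" "length gs = Suc (fst (gens ! k))"
     "m = fst (gens ! k) + sum_list gs" by (auto simp: label_def)
    have "set gs \<subseteq> {..m}" using member_le_sum_list[of _ gs] l(4) by fastforce
    then show "l \<in> (\<Union>k<length gens. (#) k ` {gs. set gs \<subseteq> {..m} \<and> length gs = Suc (fst (gens ! k))})"
      using l by auto
  qed
  then show ?thesis by (rule finite_subset) (auto intro: finite_lists_length_eq)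
qed

inductive reach :: "nat \<Rightarrow> 'k poly \<Rightarrow> bool" where
  base: "(n, x) \<in> set gens \<Longrightarrow> reach n x"
| step: "reach m y \<Longrightarrow> p \<le> m \<Longrightarrow> reach (Suc m) (ins M m p y)"

lemma reach_in: "reach m y \<Longrightarrow> y \<in> sp M m"
  by (induction rule: reach.induct) (auto intro: gens_in ins_in[OF M])

text \<open>By \<open>gen_ins\<close> a generator of the monoid is moved down through the insertions
  until it is absorbed or arrives at an element of \<open>gens\<close>, where closure
  applies.\<close>

lemma reach_gen: "reach m y \<Longrightarrow> 1 \<le> i \<Longrightarrow> i < m \<Longrightarrow> reach m (wact M m m [i] y)"
proof (induction arbitrary: i rule: reach.induct)
  case (base n x)
  then show ?case using gens_closed by (intro reach.base) auto
next
  case (step m y p)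
  note g = gen_ins[OF M reach_in[OF step.hyps(1)] step.hyps(2) step.prems]
  consider "i = p" | "i = Suc p" | "Suc p < i" | "i < p" by linarith
  then show ?case
  proof cases
    case 1
    then show ?thesis using g(1) reach.step[OF step.hyps(1), of "p - 1"] step.hyps(2) by simp
  next
    case 2
    then show ?thesis using g(2) reach.step[OF step.hyps] by simp
  next
    case 3
    then have "reach m (wact M m m [i - 1] y)" using step.prems by (intro step.IH) auto
    then show ?thesis using g(3) 3 reach.step[of m _ p] step.hyps(2) by simp
  next
    case 4
    then have "reach m (wact M m m [i] y)" using step by (intro step.IH) auto
    then show ?thesis using g(4) 4 reach.step[of m _ p] step.hyps(2) by simp
  qed
qed

lemma gap_elt_replicate: "gap_elt M n x j (replicate k 0) = x"
  by (induction k arbitrary: j) auto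

lemma reach_val: "reach m y \<Longrightarrow> \<exists>l. label m l \<and> y = val l"
proof (induction rule: reach.induct)
  case (base n x)
  then obtain k where k: "k < length gens" "gens ! k = (n, x)" by (auto simp: in_set_conv_nth)
  show ?case
    by (intro exI[of _ "k # replicate (Suc n) 0"])
      (use k in \<open>simp add: label_def val_def gap_elt_replicate sum_list_replicate del: replicate_Suc\<close>)
next
  case (step m y p)
  then show ?case using ins_val by metis
qed

lemma span_reach: "poly_vs.span {y. reach m y} = sp M m"
proof -
  define U where "U m = poly_vs.span {y. reach m y}" for m
  have U: "U m \<subseteq> sp M m" for m
    unfolding U_def using hmoduleD(1)[OF M] reach_in by (intro poly_vs.span_minimal) auto
  have app: "wact M m (Suc m) [] y \<in> U (Suc m)" if "y \<in> U m" for m y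
  proof -
    have "wact M m (Suc m) [] y \<in> poly_vs.span (wact M m (Suc m) [] ` {y. reach m y})"
      using that reach_in unfolding U_def
      by (intro linear_map_span[OF wact_linear[OF M] hmoduleD(1)[OF M]]) auto
    \<comment> \<open>The empty word acts as the insertion behind the last strand, at
      \<open>p = m\<close>.\<close>
    moreover have "wact M m (Suc m) [] ` {y. reach m y} \<subseteq> {y. reach (Suc m) y}"
      using reach.step[of m _ m] by (auto simp: ins_def)
    ultimately show ?thesis unfolding U_def using poly_vs.span_mono by blast
  qed
  have gen: "wact M m m [i] y \<in> U m" if "y \<in> U m" "1 \<le> i" "i < m" for m y i
  proof -
    have "wact M m m [i] y \<in> poly_vs.span (wact M m m [i] ` {y. reach m y})"
      using that reach_in unfolding U_def
      by (intro linear_map_span[OF wact_linear[OF M] hmoduleD(1)[OF M]]) auto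
    moreover have "wact M m m [i] ` {y. reach m y} \<subseteq> {y. reach m y}"
      using reach_gen that by auto
    ultimately show ?thesis unfolding U_def using poly_vs.span_mono by blast
  qed
  have act: "act M n m \<phi> y \<in> U m" if \<phi>: "\<phi> \<in> Mor hecke_cat n m" and y: "y \<in> U n" for n m \<phi> y
  proof -
    obtain w where "n \<le> m" "w \<in> words m" "\<phi> = cls n m w" using Mor_cases[OF \<phi>] .
    then show ?thesis using wact_invariant[OF M U app gen y] by (simp add: wact_def)
  qed
  have "submodule U M"
    using U act by (intro submoduleI) (auto simp: U_def poly_vs.span_zero poly_vs.span_add poly_vs.span_scale)
  moreover have "x \<in> U n" if "(n, x) \<in> set gens" for n x
    unfolding U_def using that reach.base by (auto intro: poly_vs.span_base)
  ultimately have "U = sp M" by (rule gens_gen)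
  then show ?thesis by (auto simp: U_def fun_eq_iff)
qed

lemma span_val: "poly_vs.span (val ` {l. label m l}) = sp M m"
proof
  show "poly_vs.span (val ` {l. label m l}) \<subseteq> sp M m"
    using hmoduleD(1)[OF M] val_in by (intro poly_vs.span_minimal) auto
  show "sp M m \<subseteq> poly_vs.span (val ` {l. label m l})"
    unfolding span_reach[symmetric] using reach_val by (intro poly_vs.span_mono) auto
qed

text \<open>The labels of the leading terms of the elements of \<open>N\<close>, in the sense of Groebner bases. The
  elements \<open>val l\<close> may be linearly dependent: \<open>l\<close> leads an element that can be written with \<open>val l\<close>
  as its leading term.\<close>

definition below :: "nat \<Rightarrow> nat list \<Rightarrow> 'k poly set" where
  "below m l = poly_vs.span (val ` {l'. label m l' \<and> l' < l})"

definition leads :: "'k fam \<Rightarrow> nat \<Rightarrow> nat list \<Rightarrow> bool" where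
  "leads N m l \<longleftrightarrow> label m l \<and> (\<exists>y\<in>N m. y - val l \<in> below m l)"

lemma label_unique: "label m l \<Longrightarrow> label m' l \<Longrightarrow> m = m'"
  by (auto simp: label_def)

text \<open>Insertion is linear and by \<open>bump_less\<close> keeps the strict order of labels, so
  it carries leading terms to leading terms.\<close>

lemma leads_bump:
  assumes N: "submodule N M" and l: "leads N m l" and p: "p \<le> m"
  shows "leads N (Suc m) (hd l # bump p (tl l))"
proof -
  obtain y where y: "y \<in> N m" "y - val l \<in> below m l" and lab: "label m l"
    using l by (auto simp: leads_def)
  have "ins M m p (y - val l) \<in> poly_vs.span (ins M m p ` val ` {l'. label m l' \<and> l' < l})"
    using y(2) val_in unfolding below_def
    by (intro linear_map_span[OF ins_linear[OF M] hmoduleD(1)[OF M]]) auto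
  also have "\<dots> \<subseteq> below (Suc m) (hd l # bump p (tl l))"
    unfolding below_def
  proof (intro poly_vs.span_mono subsetI)
    fix z assume "z \<in> ins M m p ` val ` {l'. label m l' \<and> l' < l}"
    then obtain l' where l': "label m l'" "l' < l" "z = ins M m p (val l')" by auto
    have "hd l' # bump p (tl l') < hd l # bump p (tl l)"
      using l'(1,2) lab by (auto simp: label_def intro: bump_less)
    then show "z \<in> val ` {l'. label (Suc m) l' \<and> l' < hd l # bump p (tl l)}"
      using ins_val[OF l'(1) p] l'(3) by auto
  qed
  also have "ins M m p (y - val l) = ins M m p y - val (hd l # bump p (tl l))"
    using linear_map_diff[OF ins_linear[OF M] hmoduleD(1)[OF M], of y m "val l" p]
      submoduleE(5)[OF N y(1)] val_in[OF lab] ins_val(1)[OF lab p] by simp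
  finally show ?thesis
    using ins_submodule[OF N y(1)] ins_val(2)[OF lab p] by (auto simp: leads_def)
qed

text \<open>The gap list is raised to the larger one by one insertion at a time, with induction on
  the total deficit.\<close>

lemma leads_mono:
  assumes N: "submodule N M" and "leads N m (k # gs)" "list_all2 (\<le>) gs gs'" "label m' (k # gs')"
  shows "leads N m' (k # gs')"
  using assms(2-4)
proof (induction "sum_list gs' - sum_list gs" arbitrary: gs m rule: less_induct)
  case less
  show ?case
  proof (cases "gs = gs'")
    case True
    then show ?thesis using less.prems label_unique by (metis leads_def)
  next
    case False
    have len: "length gs = length gs'" using less.prems by (simp add: list_all2_lengthD)
    then obtain t where t: "t < length gs" "gs ! t \<noteq> gs' ! t" using False nth_equalityI by blast
    then have lt: "gs ! t < gs' ! t" using list_all2_nthD[OF less.prems(2)] by fastforce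
    obtain r where r: "r < sum_list gs + length gs" "bump r gs = gs[t := Suc (gs ! t)]"
      using bump_at[OF t(1)] by auto
    have lab: "length gs = Suc (fst (gens ! k))" "m = fst (gens ! k) + sum_list gs"
      using less.prems(1) by (auto simp: leads_def label_def)
    have "leads N (Suc m) (k # bump r gs)"
      using leads_bump[OF N less.prems(1), of r] r lab by simp
    moreover have le: "list_all2 (\<le>) (bump r gs) gs'"
      using less.prems(2) lt len t(1) unfolding r(2)
      by (auto simp: list_all2_conv_all_nth nth_list_update)
    moreover have "sum_list (bump r gs) = Suc (sum_list gs)" by (rule sum_list_bump[OF r(1)])
    moreover have "sum_list (bump r gs) \<le> sum_list gs'"
      using le by (induction rule: list_all2_induct) auto
    ultimately show ?thesis using less.prems(3) by (intro less.hyps[of "bump r gs" "Suc m"]) auto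
  qed
qed

text \<open>Groebner reduction as an induction on a down-closed set \<open>T\<close> of labels. The
  largest label is cancelled by an element of \<open>N'\<close> with the same leading label, or
  dropped if its coefficient is zero. Linear dependence of the \<open>val l\<close> does no harm,
  since an expression is only required to exist.\<close>

lemma reduce:
  assumes N: "submodule N M" and N': "submodule N' M" "N' \<le> N"
    and leads: "\<And>m l. leads N m l \<Longrightarrow> leads N' m l"
    and T: "finite T" "\<And>l. l \<in> T \<Longrightarrow> label m l" "\<And>l l'. l \<in> T \<Longrightarrow> label m l' \<Longrightarrow> l' < l \<Longrightarrow> l' \<in> T"
    and x: "x \<in> N m" "x \<in> poly_vs.span (val ` T)"
  shows "x \<in> N' m"
  using T x
proof (induction "card T" arbitrary: T x)
  case 0
  then show ?case using submoduleE(1)[OF N'(1)] by simp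
next
  case (Suc c)
  then have ne: "T \<noteq> {}" by auto
  define a where "a = Max T"
  have a: "a \<in> T" "\<And>l. l \<in> T \<Longrightarrow> l \<le> a" using Suc.prems(1) ne by (auto simp: a_def)
  define T' where "T' = T - {a}"
  have "T' = {l. label m l \<and> l < a}"
  proof (intro equalityI subsetI)
    show "l \<in> {l. label m l \<and> l < a}" if "l \<in> T'" for l
      using that a(2)[of l] Suc.prems(2)[of l] by (auto simp: T'_def)
    show "l \<in> T'" if "l \<in> {l. label m l \<and> l < a}" for l
      using that Suc.prems(3)[OF a(1), of l] by (auto simp: T'_def)
  qed
  moreover have "card T' = c" "finite T'"
    using Suc.prems(1) Suc.hyps(2) a(1) by (simp_all add: T'_def)
  ultimately have T': "T' = {l. label m l \<and> l < a}" "card T' = c" "finite T'" .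
  have smaller: "z \<in> N' m" if "z \<in> N m" "z \<in> poly_vs.span (val ` T')" for z
    by (rule Suc.hyps(1)[of T']) (use that T' in auto)
  have "val ` T = insert (val a) (val ` T')" using a by (auto simp: T'_def)
  then obtain k where k: "x - smult k (val a) \<in> poly_vs.span (val ` T')"
    using Suc.prems(5) by (auto simp: poly_vs.span_breakdown_eq)
  show ?case
  proof (cases "k = 0")
    case True
    then show ?thesis using smaller[of x] k Suc.prems by simp
  next
    case False
    have "smult (inverse k) x - val a = smult (inverse k) (x - smult k (val a))"
      using False by (simp add: smult_diff_right)
    then have "smult (inverse k) x - val a \<in> below m a"
      using k T' poly_vs.span_scale by (simp add: below_def)
    then have "leads N m a"
      using submoduleE(3)[OF N Suc.prems(4)] Suc.prems(2) a by (auto simp: leads_def)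
    then obtain y where y: "y \<in> N' m" "y - val a \<in> poly_vs.span (val ` T')"
      using leads T' by (auto simp: leads_def below_def)
    have "x - smult k y = (x - smult k (val a)) - smult k (y - val a)"
      by (simp add: smult_diff_right)
    then have "x - smult k y \<in> poly_vs.span (val ` T')"
      by (simp only:) (intro poly_vs.span_diff poly_vs.span_scale k y)
    moreover have "smult k y \<in> N' m" "smult k y \<in> N m"
      using submoduleE(3)[OF N'(1) y(1)] N'(2) by (auto simp: le_fun_def)
    ultimately have "x - smult k y \<in> N' m"
      using submoduleE(4)[OF N Suc.prems(4)] by (intro smaller) auto
    then show ?thesis using submoduleE(2)[OF N'(1) _ \<open>smult k y \<in> N' m\<close>] by fastforce
  qed
qed

text \<open>For each generator index Dickson's lemma leaves finitely many minimal leading gap lists.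
  A submodule of \<open>N\<close> containing lifts of these has all leading labels of
  \<open>N\<close>, so \<open>reduce\<close> applies.\<close>

lemma submodule_fin_gen:
  assumes N: "submodule N M"
  shows "\<exists>S. finite S \<and> S \<subseteq> (SIGMA n:UNIV. N n) \<and>
    (\<forall>N'. submodule N' M \<and> N' \<le> N \<and> (\<forall>(n, x)\<in>S. x \<in> N' n) \<longrightarrow> N' = N)"
proof -
  define A where "A k = {gs. \<exists>m. leads N m (k # gs)}" for k
  have "\<forall>k. \<exists>F. finite F \<and> F \<subseteq> A k \<and> (\<forall>a\<in>A k. \<exists>f\<in>F. list_all2 (\<le>) f a)"
    by (intro allI dickson[where n = "Suc (fst (gens ! _))"]) (auto simp: A_def leads_def label_def)
  from choice[OF this] obtain F where F: "\<forall>k. finite (F k) \<and> F k \<subseteq> A k \<and>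
    (\<forall>a\<in>A k. \<exists>f\<in>F k. list_all2 (\<le>) f a)" ..
  define B where "B = (\<Union>k<length gens. (#) k ` F k)"
  have "\<forall>l\<in>B. \<exists>m y. label m l \<and> y \<in> N m \<and> y - val l \<in> below m l"
    using F by (fastforce simp: B_def A_def leads_def)
  then obtain dg lift where lift: "\<And>l. l \<in> B \<Longrightarrow> label (dg l) l \<and> lift l \<in> N (dg l) \<and> lift l - val l \<in> below (dg l) l"
    by metis
  show ?thesis
  proof (intro exI[of _ "(\<lambda>l. (dg l, lift l)) ` B"] conjI allI impI)
    show "finite ((\<lambda>l. (dg l, lift l)) ` B)" using F by (auto simp: B_def)
    show "(\<lambda>l. (dg l, lift l)) ` B \<subseteq> (SIGMA n:UNIV. N n)" using lift by auto
    fix N' assume "submodule N' M \<and> N' \<le> N \<and> (\<forall>(n, x)\<in>(\<lambda>l. (dg l, lift l)) ` B. x \<in> N' n)"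
    then have N': "submodule N' M" "N' \<le> N" and B: "\<And>l. l \<in> B \<Longrightarrow> lift l \<in> N' (dg l)" by auto
    have leads: "leads N' m l" if l: "leads N m l" for m l
    proof -
      obtain k gs where k: "l = k # gs" "k < length gens" using l by (auto simp: leads_def label_def)
      then have "gs \<in> A k" using l by (auto simp: A_def)
      then obtain f where f: "f \<in> F k" "list_all2 (\<le>) f gs" using F by blast
      then have "k # f \<in> B" using k by (auto simp: B_def)
      then have "leads N' (dg (k # f)) (k # f)" using lift B by (auto simp: leads_def)
      then show ?thesis using leads_mono[OF N'(1) _ f(2)] l k by (auto simp: leads_def)
    qed
    have "x \<in> N' m" if "x \<in> N m" for m x
      by (rule reduce[OF N N' leads finite_labels[of m], of m])
        (use that span_val[of m] submoduleE(5)[OF N] in auto)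
    then show "N' = N" using N'(2) by (auto simp: le_fun_def fun_eq_iff)
  qed
qed

end

lemma submodule_restrict: "submodule N' (restrict_mod M N) \<longleftrightarrow> submodule N' M \<and> N' \<le> N"
  if "submodule N M" for N M
  using that by (fastforce simp: submodule_def restrict_mod_def le_fun_def)

theorem hmodule_noetherian:
  assumes M: "hmodule M" "fin_gen M" and N: "submodule N M"
  shows "fin_gen (restrict_mod M N)"
proof -
  obtain S where "finite S \<and> S \<subseteq> (SIGMA n:UNIV. sp M n) \<and>
     (\<forall>N. submodule N M \<and> (\<forall>(n, x)\<in>S. x \<in> N n) \<longrightarrow> N = sp M)"
    using M(2) unfolding fin_gen_def ..
  then have S: "finite S" "\<And>n x. (n, x) \<in> S \<Longrightarrow> x \<in> sp M n"
    and S_gen: "\<And>N. submodule N M \<Longrightarrow> \<forall>(n, x)\<in>S. x \<in> N n \<Longrightarrow> N = sp M"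
    by auto
  define closed where "closed n x F \<longleftrightarrow> finite F \<and> x \<in> F \<and> F \<subseteq> sp M n \<and>
      (\<forall>y\<in>F. \<forall>i. 1 \<le> i \<and> i < n \<longrightarrow> wact M n n [i] y \<in> F)" for n x F
  have "\<forall>s\<in>S. \<exists>F. closed (fst s) (snd s) F"
    unfolding closed_def by (intro ballI finite_gen_closed[OF M(1)] S(2)) simp
  from bchoice[OF this] obtain F where F: "\<forall>s\<in>S. closed (fst s) (snd s) (F s)" ..
  have F': "finite (F (n, x))" "x \<in> F (n, x)" "F (n, x) \<subseteq> sp M n"
    "y \<in> F (n, x) \<Longrightarrow> 1 \<le> i \<Longrightarrow> i < n \<Longrightarrow> wact M n n [i] y \<in> F (n, x)" if "(n, x) \<in> S" for n x y i
    using bspec[OF F that] by (simp_all add: closed_def)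
  \<comment> \<open>Each generator is replaced by its finite closure under the 0-Hecke monoid of its
    own degree.\<close>
  have "finite (SIGMA n:UNIV. \<Union>x\<in>{x. (n, x) \<in> S}. F (n, x))"
  proof (rule finite_subset)
    show "(SIGMA n:UNIV. \<Union>x\<in>{x. (n, x) \<in> S}. F (n, x)) \<subseteq> (\<Union>s\<in>S. Pair (fst s) ` F s)" by force
    show "finite (\<Union>s\<in>S. Pair (fst s) ` F s)" using F'(1) S(1) by fastforce
  qed
  then obtain gens where gens: "set gens = (SIGMA n:UNIV. \<Union>x\<in>{x. (n, x) \<in> S}. F (n, x))"
    using finite_list by blast
  interpret gen_module M gens
  proof
    show "x \<in> sp M n" if "(n, x) \<in> set gens" for n x using that F'(3) gens by auto
    show "(n, wact M n n [i] x) \<in> set gens" if x: "(n, x) \<in> set gens" and i: "1 \<le> i" "i < n" for n x i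
    proof -
      obtain z where "(n, z) \<in> S" "x \<in> F (n, z)" using x unfolding gens by auto
      then show ?thesis using F'(4)[of n z x i] i gens by auto
    qed
    show "N = sp M" if N: "submodule N M" and g: "\<And>n x. (n, x) \<in> set gens \<Longrightarrow> x \<in> N n" for N
    proof (rule S_gen[OF N])
      have "x \<in> N n" if "(n, x) \<in> S" for n x
        using that F'(2)[OF that] by (intro g) (auto simp: gens)
      then show "\<forall>(n, x)\<in>S. x \<in> N n" by auto
    qed
  qed (rule M(1))
  obtain T where "finite T \<and> T \<subseteq> (SIGMA n:UNIV. N n) \<and>
    (\<forall>N'. submodule N' M \<and> N' \<le> N \<and> (\<forall>(n, x)\<in>T. x \<in> N' n) \<longrightarrow> N' = N)"
    using submodule_fin_gen[OF N] ..
  then show ?thesis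
    unfolding fin_gen_def submodule_restrict[OF N]
    by (intro exI[of _ T]) (simp add: restrict_mod_def)
qed

section \<open>Restrictions and quotients\<close>

lemma restrict_mod_simps: "sp (restrict_mod M N) = N" "act (restrict_mod M N) = act M"
  by (simp_all add: restrict_mod_def)

lemma hmodule_restrict:
  assumes M: "hmodule M" and N: "submodule N M"
  shows "hmodule (restrict_mod M N)"
  unfolding hmodule_def restrict_mod_simps
proof (intro conjI allI ballI)
  show "subspace (N n)" for n by (rule submoduleD(1)[OF N])
  show "linear_map (N n) (N m) (act M n m \<phi>)" if "\<phi> \<in> Mor hecke_cat n m" for n m \<phi>
    using linear_mapD(2,3)[OF hmoduleD(2)[OF M that]] submoduleD(3)[OF N that] submoduleE(5)[OF N]
    by (auto simp: linear_map_def)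
  show "act M n n (Idn hecke_cat n) x = x" if "x \<in> N n" for n x
    using hmoduleD(3)[OF M submoduleE(5)[OF N that]] .
  show "act M n l (Cmp hecke_cat n m l \<psi> \<phi>) x = act M m l \<psi> (act M n m \<phi> x)"
    if "\<phi> \<in> Mor hecke_cat n m" "\<psi> \<in> Mor hecke_cat m l" "x \<in> N n" for n m l \<phi> \<psi> x
    using hmoduleD(4)[OF M that(1,2) submoduleE(5)[OF N that(3)]] .
qed

abbreviation (input) fgmods :: "'k::field hmod set" where
  "fgmods \<equiv> Ob fgmod_cat"

lemma Ob_fgmod: "M \<in> fgmods \<longleftrightarrow> hmodule M \<and> fin_gen M"
  by (simp add: fgmod_cat_def)

lemma ObD: "M \<in> fgmods \<Longrightarrow> hmodule M"
  by (simp add: Ob_fgmod)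

text \<open>This is how noetherianity enters: every submodule is an object, so that
  \<open>small\<close> and \<open>cosmall\<close> become conditions on submodule lattices.\<close>

lemma restrict_Ob: "M \<in> fgmods \<Longrightarrow> submodule N M \<Longrightarrow> restrict_mod M N \<in> fgmods"
  by (simp add: Ob_fgmod hmodule_restrict hmodule_noetherian)

lemma mkd_restrict:
  assumes N: "submodule N M" and "submodule U M" "submodule V M" "U \<le> V" "V \<le> N"
  shows "mkd (restrict_mod M N) d U V \<longleftrightarrow> mkd M d U V"
proof
  assume "mkd (restrict_mod M N) d U V"
  then show "mkd M d U V"
    by (rule kd_embed[where f = "\<lambda>x. x"]) (use assms in \<open>auto simp: submodule_restrict[OF N]\<close>)
next
  assume "mkd M d U V"
  then show "mkd (restrict_mod M N) d U V"
    by (rule kd_embed[where f = "\<lambda>x. x"]) (use assms in \<open>auto simp: submodule_restrict[OF N]\<close>)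
qed

section \<open>Quotient modules\<close>

interpretation poly_pair: vector_space_pair "smult :: 'k::field \<Rightarrow> 'k poly \<Rightarrow> 'k poly" "smult :: 'k \<Rightarrow> 'k poly \<Rightarrow> 'k poly"
  by unfold_locales

text \<open>Quotients have to be realised inside the ambient space. Subtracting a linear retraction
  \<open>g\<close> onto \<open>N\<close> gives a projection with kernel \<open>N\<close>, and its
  image is a copy of the quotient.\<close>

lemma quotient_projection:
  assumes "subspace V" "subspace N" "N \<subseteq> V"
  shows "\<exists>p. linear_map V V p \<and> (\<forall>x\<in>V. p x = 0 \<longleftrightarrow> x \<in> N) \<and> (\<forall>x\<in>V. x - p x \<in> N)"
proof -
  have "\<exists>g. g ` UNIV \<subseteq> N \<and> Vector_Spaces.linear smult smult g \<and> (\<forall>v\<in>N. g (id v) = v)"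
    by (rule poly_pair.linear_exists_left_inverse_on[OF poly_vs.linear_id assms(2)]) simp
  then obtain g where g: "\<And>x. g x \<in> N" "Vector_Spaces.linear smult smult g" "\<And>v. v \<in> N \<Longrightarrow> g v = v"
    by auto
  interpret g: Vector_Spaces.linear smult smult g by (rule g(2))
  show ?thesis
  proof (intro exI[of _ "\<lambda>x. x - g x"] conjI ballI)
    have "x - g x \<in> V" if "x \<in> V" for x
      using that g(1)[of x] assms by (blast intro: poly_vs.subspace_diff)
    then show "linear_map V V (\<lambda>x. x - g x)"
      by (auto simp: linear_map_def g.add g.scale smult_diff_right)
    show "x - g x = 0 \<longleftrightarrow> x \<in> N" for x using g(1,3)[of x] by auto
    show "x - (x - g x) \<in> N" for x using g(1) by simp
  qed
qed

definition hgraph :: "'k::field hmod \<Rightarrow> 'k hmodmor \<Rightarrow> 'k roof" where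
  "hgraph M p = (\<lambda>n. {(x, p n x) | x. x \<in> sp M n})"

lemma mod_homsD:
  assumes "f \<in> mod_homs M N"
  shows "f n \<in> extensional (sp M n)" "linear_map (sp M n) (sp N n) (f n)"
    "\<phi> \<in> Mor hecke_cat n m \<Longrightarrow> x \<in> sp M n \<Longrightarrow> f m (act M n m \<phi> x) = act N n m \<phi> (f n x)"
  using assms by (auto simp: mod_homs_def)

lemma arel_hgraph:
  assumes M: "hmodule M" and p: "p \<in> mod_homs M Q"
  shows "arel M Q (hgraph M p)"
proof (rule arelI)
  note lin = linear_mapD[OF mod_homsD(2)[OF p]]
  show "(0, 0) \<in> hgraph M p n" for n
    using linear_map_0[OF mod_homsD(2)[OF p] hmodule_0[OF M], of n] hmodule_0[OF M, of n]
    by (auto simp: hgraph_def)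
  fix n x y assume "(x, y) \<in> hgraph M p n"
  then have x: "x \<in> sp M n" "y = p n x" by (auto simp: hgraph_def)
  show "x \<in> sp M n \<and> y \<in> sp Q n" using x lin by auto
  show "(smult c x, smult c y) \<in> hgraph M p n" for c
    using x lin submoduleE(3)[OF submodule_sp[OF M]] by (auto simp: hgraph_def)
  show "(act M n m \<phi> x, act Q n m \<phi> y) \<in> hgraph M p m" if "\<phi> \<in> Mor hecke_cat n m" for m \<phi>
    using x mod_homsD(3)[OF p that x(1)] linear_mapD(1)[OF hmoduleD(2)[OF M that] x(1)]
    by (auto simp: hgraph_def)
  fix x' y' assume "(x', y') \<in> hgraph M p n"
  then have "x' \<in> sp M n" "y' = p n x'" by (auto simp: hgraph_def)
  then show "(x + x', y + y') \<in> hgraph M p n"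
    using x lin submoduleE(2)[OF submodule_sp[OF M]] by (auto simp: hgraph_def)
qed

lemma fin_gen_image:
  assumes M: "hmodule M" "fin_gen M" and Q: "hmodule Q" and p: "p \<in> mod_homs M Q"
    and surj: "\<And>n. p n ` sp M n = sp Q n"
  shows "fin_gen Q"
proof -
  obtain S where S: "finite S \<and> S \<subseteq> (SIGMA n:UNIV. sp M n) \<and>
     (\<forall>N. submodule N M \<and> (\<forall>(n, x)\<in>S. x \<in> N n) \<longrightarrow> N = sp M)"
    using M(2) unfolding fin_gen_def ..
  show ?thesis unfolding fin_gen_def
  proof (intro exI[of _ "(\<lambda>(n, x). (n, p n x)) ` S"] conjI allI impI)
    show "finite ((\<lambda>(n, x). (n, p n x)) ` S)" using S by simp
    show "(\<lambda>(n, x). (n, p n x)) ` S \<subseteq> (SIGMA n:UNIV. sp Q n)" using S surj by auto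
    fix N assume N: "submodule N Q \<and> (\<forall>(n, x)\<in>(\<lambda>(n, x). (n, p n x)) ` S. x \<in> N n)"
    define N' where "N' = rimg (rconv (hgraph M p)) N"
    have N'_iff: "x \<in> N' n \<longleftrightarrow> x \<in> sp M n \<and> p n x \<in> N n" for n x
      by (auto simp: N'_def rimg_def rconv_def hgraph_def)
    have "submodule N' M"
      unfolding N'_def using N by (intro submodule_rimg[OF arel_rconv[OF arel_hgraph[OF M(1) p]]]) auto
    moreover have "\<forall>(n, x)\<in>S. x \<in> N' n" using S N by (auto simp: N'_iff)
    ultimately have "N' = sp M" using S by blast
    then have "p n x \<in> N n" if "x \<in> sp M n" for n x using that N'_iff[of x n] by simp
    then have "sp Q n \<subseteq> N n" for n unfolding surj[symmetric] by blast
    then show "N = sp Q" using N by (auto simp: submodule_def fun_eq_iff)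
  qed
qed

lemma quotient_exists:
  assumes M: "hmodule M" and N: "submodule N M"
  shows "\<exists>Q p. hmodule Q \<and> p \<in> mod_homs M Q \<and> (\<forall>n. p n ` sp M n = sp Q n \<and> {x \<in> sp M n. p n x = 0} = N n)"
proof -
  have "\<forall>n. \<exists>p. linear_map (sp M n) (sp M n) p \<and> (\<forall>x\<in>sp M n. p x = 0 \<longleftrightarrow> x \<in> N n) \<and> (\<forall>x\<in>sp M n. x - p x \<in> N n)"
    by (intro allI quotient_projection hmoduleD(1)[OF M] submoduleD[OF N])
  from choice[OF this] obtain p where "\<forall>n. linear_map (sp M n) (sp M n) (p n) \<and>
    (\<forall>x\<in>sp M n. p n x = 0 \<longleftrightarrow> x \<in> N n) \<and> (\<forall>x\<in>sp M n. x - p n x \<in> N n)" ..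
  then have lin: "linear_map (sp M n) (sp M n) (p n)"
    and ker: "x \<in> sp M n \<Longrightarrow> p n x = 0 \<longleftrightarrow> x \<in> N n"
    and diff: "x \<in> sp M n \<Longrightarrow> x - p n x \<in> N n" for n x by auto
  note pD = linear_mapD[OF lin]
  have eq: "p n x = p n y" if "x \<in> sp M n" "y \<in> sp M n" "x - y \<in> N n" for n x y
    using linear_map_diff[OF lin hmoduleD(1)[OF M] that(1,2)] ker[of "x - y" n] that submoduleE(5)[OF N]
    by auto
  have pp: "p n (p n x) = p n x" if "x \<in> sp M n" for n x
    using eq[OF that pD(1)[OF that] diff[OF that]] by simp
  have act_in: "act M n m \<phi> x \<in> sp M m" if "\<phi> \<in> Mor hecke_cat n m" "x \<in> sp M n" for n m \<phi> x
    using linear_mapD(1)[OF hmoduleD(2)[OF M that(1)] that(2)] .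
  have p_act: "p m (act M n m \<phi> (p n x)) = p m (act M n m \<phi> x)"
    if \<phi>: "\<phi> \<in> Mor hecke_cat n m" and x: "x \<in> sp M n" for n m \<phi> x
  proof (rule eq[symmetric])
    show "act M n m \<phi> x \<in> sp M m" "act M n m \<phi> (p n x) \<in> sp M m" using act_in[OF \<phi>] x pD(1) by auto
    show "act M n m \<phi> x - act M n m \<phi> (p n x) \<in> N m"
      using linear_map_diff[OF hmoduleD(2)[OF M \<phi>] hmoduleD(1)[OF M] x pD(1)[OF x]]
        submoduleD(3)[OF N \<phi> diff[OF x]] by simp
  qed
  \<comment> \<open>The action of \<open>M\<close> followed by the projection; \<open>p_act\<close>
    makes this functorial.\<close>
  define Q where "Q = \<lparr>sp = \<lambda>n. p n ` sp M n, act = \<lambda>n m \<phi> x. p m (act M n m \<phi> x)\<rparr>"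
  have Q [simp]: "sp Q n = p n ` sp M n" "act Q n m \<phi> x = p m (act M n m \<phi> x)" for n m \<phi> x
    by (simp_all add: Q_def)
  note M_add = submoduleE(2)[OF submodule_sp[OF M]] and M_smult = submoduleE(3)[OF submodule_sp[OF M]]
  have "hmodule Q"
    unfolding hmodule_def
  proof (intro conjI allI ballI)
    show "subspace (sp Q n)" for n
      unfolding subspace_iff Q
    proof (intro conjI ballI allI)
      show "0 \<in> p n ` sp M n" using linear_map_0[OF lin] hmodule_0[OF M] by (metis imageI)
      show "x + y \<in> p n ` sp M n" if xy: "x \<in> p n ` sp M n" "y \<in> p n ` sp M n" for x y
      proof -
        obtain a b where "a \<in> sp M n" "b \<in> sp M n" "x = p n a" "y = p n b" using xy by auto
        then show ?thesis using pD(2)[of a n b] M_add[of a n b] by (metis imageI)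
      qed
      show "smult c x \<in> p n ` sp M n" if x: "x \<in> p n ` sp M n" for c x
      proof -
        obtain a where "a \<in> sp M n" "x = p n a" using x by auto
        then show ?thesis using pD(3)[of a n c] M_smult[of a n c] by (metis imageI)
      qed
    qed
    show "linear_map (sp Q n) (sp Q m) (act Q n m \<phi>)" if \<phi>: "\<phi> \<in> Mor hecke_cat n m" for n m \<phi>
      using linear_mapD[OF hmoduleD(2)[OF M \<phi>]] pD act_in[OF \<phi>] by (auto simp: linear_map_def)
    show "act Q n n (Idn hecke_cat n) x = x" if "x \<in> sp Q n" for n x
      using that pp pD(1) hmoduleD(3)[OF M] by auto
    show "act Q n l (Cmp hecke_cat n m l \<psi> \<phi>) x = act Q m l \<psi> (act Q n m \<phi> x)"
      if "\<phi> \<in> Mor hecke_cat n m" "\<psi> \<in> Mor hecke_cat m l" "x \<in> sp Q n" for n m l \<phi> \<psi> x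
      using that hmoduleD(4)[OF M that(1,2)] p_act[OF that(2) act_in[OF that(1)]] pD(1) by auto
  qed
  moreover have "(\<lambda>n. restrict (p n) (sp M n)) \<in> mod_homs M Q"
    unfolding mod_homs_def
  proof (intro CollectI conjI allI ballI)
    show "linear_map (sp M n) (sp Q n) (restrict (p n) (sp M n))" for n
      using pD M_add M_smult by (auto simp: linear_map_def)
    show "restrict (p m) (sp M m) (act M n m \<phi> x) = act Q n m \<phi> (restrict (p n) (sp M n) x)"
      if "\<phi> \<in> Mor hecke_cat n m" "x \<in> sp M n" for n m \<phi> x
      using that act_in p_act by simp
  qed simp
  ultimately show ?thesis
    using ker submoduleE(5)[OF N]
    by (intro exI[of _ Q] exI[of _ "\<lambda>n. restrict (p n) (sp M n)"]) auto
qed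

text \<open>The two directions are \<open>arel_kd\<close> for the graph of \<open>p\<close> and for
  its converse.\<close>

lemma quotient_kd:
  assumes M: "hmodule M" and Q: "hmodule Q" and p: "p \<in> mod_homs M Q"
    and surj: "\<And>n. p n ` sp M n = sp Q n" and ker: "\<And>n. {x \<in> sp M n. p n x = 0} = N n"
  shows "mkd Q d zero_sub (sp Q) \<longleftrightarrow> mkd M d N (sp M)"
proof -
  note G = arel_hgraph[OF M p]
  have N: "rimg (rconv (hgraph M p)) zero_sub = N" "rimg (rconv (hgraph M p)) (sp Q) = sp M"
    "rimg (hgraph M p) N = zero_sub" "rimg (hgraph M p) (sp M) = sp Q"
  proof -
    show "rimg (rconv (hgraph M p)) zero_sub = N"
      unfolding fun_eq_iff ker[symmetric] by (auto simp: rimg_def rconv_def hgraph_def)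
    show "rimg (rconv (hgraph M p)) (sp Q) = sp M" "rimg (hgraph M p) (sp M) = sp Q"
      unfolding fun_eq_iff surj[symmetric] by (auto simp: rimg_def rconv_def hgraph_def)
    have "0 \<in> N n" for n
      using ker[of n] linear_map_0[OF mod_homsD(2)[OF p] hmodule_0[OF M]] hmodule_0[OF M] by auto
    then have "rimg (hgraph M p) N n = {0}" for n
      using ker[of n] by (force simp: rimg_def hgraph_def)
    then show "rimg (hgraph M p) N = zero_sub" by auto
  qed
  have sub: "submodule N M" "N \<le> sp M"
    using submodule_rimg[OF arel_rconv[OF G] submodule_zero[OF Q]] N(1) submoduleD(4) by auto
  show ?thesis
    using arel_kd[OF M Q G sub(1) submodule_sp[OF M] sub(2), of d]
      arel_kd[OF Q M arel_rconv[OF G] submodule_zero[OF Q] submodule_sp[OF Q] zero_sub_le[OF submodule_sp[OF Q]], of d]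
    unfolding N by blast
qed

section \<open>Finite length in terms of chains of submodules\<close>

text \<open>The category \<open>K\<close> is arbitrary so that the lemma serves for
  \<open>fgmod_cat\<close> with \<open>d = 0\<close> and for Serre quotients with larger
  \<open>d\<close>. A chain avoiding \<open>mkd X d\<close> becomes a strict chain of
  subobjects.\<close>

lemma finite_length_imp_kd:
  assumes X: "hmodule X" and fl: "finite_length K X'"
    and s: "\<And>N. submodule N X \<Longrightarrow> s N \<in> subobjects K X'"
    and mono: "\<And>N N'. submodule N X \<Longrightarrow> submodule N' X \<Longrightarrow> N \<le> N' \<Longrightarrow> sub_le K X' (s N) (s N')"
    and strict: "\<And>N N'. submodule N X \<Longrightarrow> submodule N' X \<Longrightarrow> N \<le> N' \<Longrightarrow>
      sub_le K X' (s N') (s N) \<Longrightarrow> mkd X d N N'"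
  shows "mkd X (Suc d) zero_sub (sp X)"
proof -
  obtain L where L: "\<forall>ss. set ss \<subseteq> subobjects K X' \<and> sorted_wrt (sub_less K X') ss \<longrightarrow> length ss \<le> L"
    using fl unfolding finite_length_def ..
  show ?thesis
  proof (rule kd_SucI)
    fix I :: "nat set" and x
    assume I: "finite I" "\<forall>i\<in>I. submodule (x i) X \<and> zero_sub \<le> x i \<and> x i \<le> sp X"
      "\<forall>i\<in>I. \<forall>j\<in>I. i < j \<longrightarrow> x i \<le> x j \<and> \<not> mkd X d (x i) (x j)"
    define ss where "ss = map (\<lambda>i. s (x i)) (sorted_list_of_set I)"
    have "sorted_wrt (\<lambda>i j. sub_less K X' (s (x i)) (s (x j))) (sorted_list_of_set I)"
    proof (rule sorted_wrt_mono_rel)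
      show "sorted_wrt (<) (sorted_list_of_set I)" by (rule strict_sorted_list_of_set)
      show "sub_less K X' (s (x i)) (s (x j))"
        if "i \<in> set (sorted_list_of_set I)" "j \<in> set (sorted_list_of_set I)" "i < j" for i j
      proof -
        have ij: "i \<in> I" "j \<in> I" using that I(1) by auto
        then have "submodule (x i) X" "submodule (x j) X" "x i \<le> x j" "\<not> mkd X d (x i) (x j)"
          using I(2,3) that(3) by blast+
        then show ?thesis unfolding sub_less_def using mono strict by blast
      qed
    qed
    then have "sorted_wrt (sub_less K X') ss" by (simp add: ss_def sorted_wrt_map)
    moreover have "set ss \<subseteq> subobjects K X'" using I s by (auto simp: ss_def)
    ultimately have "length ss \<le> L" using L by blast
    then show "card I \<le> L" using I(1) by (simp add: ss_def)
  qed
qed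

text \<open>The submodules \<open>I s\<close> are monotone only up to \<open>mkd X d\<close>, so a
  strict chain of subobjects does not give a chain of submodules directly. The partial sums
  \<open>U\<close> form one, and each is contained, up to \<open>d\<close>, in the summand added
  last.\<close>

lemma kd_imp_finite_length:
  assumes X: "hmodule X" and kd: "mkd X (Suc d) zero_sub (sp X)"
    and I: "\<And>s. s \<in> subobjects K X' \<Longrightarrow> submodule (I s) X"
    and mono: "\<And>s t. s \<in> subobjects K X' \<Longrightarrow> t \<in> subobjects K X' \<Longrightarrow> sub_le K X' s t \<Longrightarrow>
      mkd X d (inf (I s) (I t)) (I s)"
    and reflect: "\<And>s t. s \<in> subobjects K X' \<Longrightarrow> t \<in> subobjects K X' \<Longrightarrow> mkd X d (inf (I t) (I s)) (I t) \<Longrightarrow>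
      sub_le K X' t s"
  shows "finite_length K X'"
proof -
  interpret modular_lattice "\<lambda>N. submodule N X" sub_sum by (rule submodule_lattice[OF X])
  obtain L where L: "\<forall>I x. nonrel_chain (\<lambda>N. submodule N X) (mkd X d) zero_sub (sp X) I x \<longrightarrow> card I \<le> L"
    using kd by (rule kd_SucE)
  show ?thesis unfolding finite_length_def
  proof (intro exI[of _ L] allI impI)
    fix ss assume ss: "set ss \<subseteq> subobjects K X' \<and> sorted_wrt (sub_less K X') ss"
    have sub: "ss ! i \<in> subobjects K X'" if "i < length ss" for i
      using ss that by auto
    have less: "sub_less K X' (ss ! i) (ss ! j)" if "i < j" "j < length ss" for i j
      using ss that sorted_wrt_nth_less by blast
    define S where "S i = I (ss ! i)" for i
    define U where "U = rec_nat (S 0) (\<lambda>i U. sub_sum U (S (Suc i)))"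
    have U: "U 0 = S 0" "U (Suc i) = sub_sum (U i) (S (Suc i))" for i by (simp_all add: U_def)
    have S: "submodule (S i) X" if "i < length ss" for i using I[OF sub[OF that]] by (simp add: S_def)
    have Usub: "submodule (U i) X" if "i < length ss" for i
      using that by (induction i) (auto simp: U intro: P_J S)
    have Umono: "U i \<le> U j" if "i \<le> j" "j < length ss" for i j
      using that
    proof (induction rule: dec_induct)
      case (step n)
      then show ?case using J_ge1[OF Usub[of n] S[of "Suc n"]] by (auto simp: U)
    qed simp
    have SU: "S i \<le> U i" if "i < length ss" for i
      using that J_ge2[OF Usub S] by (cases i) (auto simp: U)
    have US: "mkd X d (inf (U i) (S i)) (U i)" if "i < length ss" for i
      using that
    proof (induction i)
      case 0
      then show ?case using kd_refl by (simp add: U)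
    next
      case (Suc i)
      then have "mkd X d (inf (S i) (S (Suc i))) (S i)"
        unfolding S_def using less[of i "Suc i"] by (intro mono sub) (auto simp: sub_less_def)
      then have "mkd X d (inf (U i) (S (Suc i))) (U i)"
        using Suc by (intro kd_le_trans[OF Usub S S Suc.IH]) auto
      then show ?case unfolding U using Suc.prems kd_refl by (intro kd_le_join Usub S) auto
    qed
    have "card {..<length ss} \<le> L"
    proof (rule chain_card_le[OF L, where x = U])
      show "\<forall>i\<in>{..<length ss}. submodule (U i) X \<and> zero_sub \<le> U i \<and> U i \<le> sp X"
        using Usub zero_sub_le submoduleD(4) by blast
      show "\<forall>i\<in>{..<length ss}. \<forall>j\<in>{..<length ss}. i < j \<longrightarrow> U i \<le> U j \<and> \<not> mkd X d (U i) (U j)"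
      proof (intro ballI impI conjI notI)
        fix i j assume ij: "i \<in> {..<length ss}" "j \<in> {..<length ss}" "i < j"
        then have i: "i < length ss" and j: "j < length ss" by auto
        show "U i \<le> U j" using Umono ij by auto
        \<comment> \<open>If two partial sums agreed up to \<open>d\<close>, then \<open>S j\<close>
          would be contained up to \<open>d\<close> in \<open>U i\<close> and hence in
          \<open>S i\<close>, against strictness.\<close>
        assume "mkd X d (U i) (U j)"
        then have "mkd X d (inf (U i) (S j)) (inf (U j) (S j))"
          by (rule kd_inf[OF Usub[OF i] Usub[OF j] S[OF j] \<open>U i \<le> U j\<close>])
        moreover have "inf (U j) (S j) = S j" using SU[OF j] by (simp add: inf.absorb2)
        ultimately have "mkd X d (inf (S j) (U i)) (S j)" by (simp add: inf_commute)
        then have "mkd X d (inf (S j) (S i)) (S j)"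
          by (rule kd_le_trans[OF S[OF j] Usub[OF i] S[OF i] _ US[OF i]])
        then have "sub_le K X' (ss ! j) (ss ! i)"
          unfolding S_def by (intro reflect sub i j)
        then show False using less[OF ij(3) j] by (simp add: sub_less_def)
      qed
    qed simp
    then show "length ss \<le> L" by simp
  qed
qed

section \<open>Subobjects of finitely generated modules\<close>

definition incl :: "'k::field fam \<Rightarrow> 'k hmodmor" where
  "incl N n = restrict (\<lambda>x. x) (N n)"

lemma incl_hom:
  assumes M: "hmodule M" and N: "submodule N M" and N': "submodule N' M" and le: "N \<le> N'"
  shows "incl N \<in> mod_homs (restrict_mod M N) (restrict_mod M N')" "incl N \<in> mod_homs (restrict_mod M N) M"
  using submoduleE[OF N] submoduleD(3)[OF N] le
  by (auto simp: mod_homs_def incl_def restrict_mod_simps linear_map_def le_fun_def)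

lemma Mor_fgmod: "Mor fgmod_cat M N = mod_homs M N"
  and Cmp_fgmod: "Cmp fgmod_cat L M N g f = (\<lambda>n. compose (sp L n) (g n) (f n))"
  by (simp_all add: fgmod_cat_def)

lemma monic_fgmodI:
  assumes i: "i \<in> mod_homs Y X" and inj: "\<And>n. inj_on (i n) (sp Y n)"
  shows "monic fgmod_cat Y X i"
  unfolding monic_def Mor_fgmod Cmp_fgmod
proof (intro conjI ballI impI i)
  fix W g h assume g: "g \<in> mod_homs W Y" and h: "h \<in> mod_homs W Y"
    and eq: "(\<lambda>n. compose (sp W n) (i n) (g n)) = (\<lambda>n. compose (sp W n) (i n) (h n))"
  show "g = h"
  proof
    fix n show "g n = h n"
    proof (rule extensionalityI[OF mod_homsD(1)[OF g] mod_homsD(1)[OF h]])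
      fix x assume x: "x \<in> sp W n"
      then have "i n (g n x) = i n (h n x)" using fun_cong[OF fun_cong[OF eq, of n], of x] by (simp add: compose_def)
      then show "g n x = h n x"
        using inj_onD[OF inj] linear_mapD(1)[OF mod_homsD(2)[OF g] x] linear_mapD(1)[OF mod_homsD(2)[OF h] x]
        by blast
    qed
  qed
qed

lemma inj_on_linear:
  assumes "linear_map V W f" "subspace V" "\<And>x. x \<in> V \<Longrightarrow> f x = 0 \<Longrightarrow> x = 0"
  shows "inj_on f V"
proof (rule inj_onI)
  fix x y assume "x \<in> V" "y \<in> V" "f x = f y"
  then show "x = y"
    using linear_map_diff[OF assms(1,2), of x y] assms(3)[of "x - y"] poly_vs.subspace_diff[OF assms(2), of x y]
    by simp
qed

text \<open>On the kernel of a monomorphism the inclusion and the zero map have the same composite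
  with it, so they coincide; the kernel is an object by noetherianity.\<close>

lemma monic_fgmodD:
  assumes Y: "Y \<in> fgmods" and X: "hmodule X" and mon: "monic fgmod_cat Y X i"
  shows "i \<in> mod_homs Y X" "inj_on (i n) (sp Y n)"
proof -
  show i: "i \<in> mod_homs Y X" using mon by (simp add: monic_def Mor_fgmod)
  note G = arel_hgraph[OF ObD[OF Y] i]
  define N where "N = rimg (rconv (hgraph Y i)) zero_sub"
  have N_iff: "x \<in> N n \<longleftrightarrow> x \<in> sp Y n \<and> i n x = 0" for x n
    by (auto simp: N_def rimg_def rconv_def hgraph_def)
  have N: "submodule N Y"
    unfolding N_def by (rule submodule_rimg[OF arel_rconv[OF G] submodule_zero[OF X]])
  define z :: "'a hmodmor" where "z n = restrict (\<lambda>x. 0) (N n)" for n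
  have z: "z \<in> mod_homs (restrict_mod Y N) Y"
    unfolding mod_homs_def restrict_mod_simps
  proof (intro CollectI conjI allI ballI)
    show "linear_map (N n) (sp Y n) (z n)" for n
      using hmodule_0[OF ObD[OF Y]] submoduleE[OF N] by (auto simp: linear_map_def z_def)
    show "z m (act Y n m \<phi> x) = act Y n m \<phi> (z n x)" if "\<phi> \<in> Mor hecke_cat n m" "x \<in> N n" for n m \<phi> x
      using that submoduleD(3)[OF N] linear_map_0[OF hmoduleD(2)[OF ObD[OF Y]] hmodule_0[OF ObD[OF Y]]]
      by (simp add: z_def)
  qed (simp add: z_def)
  have "Cmp fgmod_cat (restrict_mod Y N) Y X i (incl N) = Cmp fgmod_cat (restrict_mod Y N) Y X i z"
    unfolding Cmp_fgmod restrict_mod_simps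
    using linear_map_0[OF mod_homsD(2)[OF i] hmodule_0[OF ObD[OF Y]]]
    by (auto simp: fun_eq_iff compose_def incl_def z_def N_iff)
  then have "incl N = z"
    using mon restrict_Ob[OF Y N] incl_hom(2)[OF ObD[OF Y] N N order_refl] z
    unfolding monic_def Mor_fgmod by blast
  then have eq: "incl N n x = z n x" for n x by simp
  have "x = 0" if "x \<in> N n" for x n
    using that eq[of n x] by (simp add: incl_def z_def)
  then show "inj_on (i n) (sp Y n)"
    by (intro inj_on_linear[OF mod_homsD(2)[OF i] hmoduleD(1)[OF ObD[OF Y]]]) (auto simp: N_iff)
qed

lemma finite_length_fgmod:
  assumes XO: "X \<in> fgmods"
  shows "finite_length fgmod_cat X \<longleftrightarrow> mkd X 1 zero_sub (sp X)"
proof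
  note X = ObD[OF XO]
  assume fl: "finite_length fgmod_cat X"
  have "mkd X (Suc 0) zero_sub (sp X)"
  proof (rule finite_length_imp_kd[OF X fl, where s = "\<lambda>N. (restrict_mod X N, incl N)"])
    fix N assume N: "submodule N X"
    show "(restrict_mod X N, incl N) \<in> subobjects fgmod_cat X"
      unfolding subobjects_def
      using restrict_Ob[OF XO N] monic_fgmodI[OF incl_hom(2)[OF X N N order_refl]]
      by (auto simp: incl_def restrict_mod_simps inj_on_def)
    fix N' assume N': "submodule N' X" and le: "N \<le> N'"
    show "sub_le fgmod_cat X (restrict_mod X N, incl N) (restrict_mod X N', incl N')"
      unfolding sub_le_def prod.case Mor_fgmod Cmp_fgmod restrict_mod_simps
      using le by (intro bexI[OF _ incl_hom(1)[OF X N N' le]])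
        (auto simp: fun_eq_iff compose_def incl_def le_fun_def)
    assume "sub_le fgmod_cat X (restrict_mod X N', incl N') (restrict_mod X N, incl N)"
    then obtain h where h: "h \<in> mod_homs (restrict_mod X N') (restrict_mod X N)"
      and eq: "incl N' = (\<lambda>n. compose (N' n) (incl N n) (h n))"
      unfolding sub_le_def prod.case Mor_fgmod Cmp_fgmod restrict_mod_simps by blast
    have "N' \<le> N"
    proof (intro le_funI subsetI)
      fix n x assume x: "x \<in> N' n"
      then have "h n x \<in> N n" using linear_mapD(1)[OF mod_homsD(2)[OF h]] by (simp add: restrict_mod_simps)
      then show "x \<in> N n" using fun_cong[OF fun_cong[OF eq, of n], of x] x by (simp add: compose_def incl_def)
    qed
    then show "mkd X 0 N N'" by simp
  qed
  then show "mkd X 1 zero_sub (sp X)" by (simp only: One_nat_def)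
next
  note X = ObD[OF XO]
  assume "mkd X 1 zero_sub (sp X)"
  then have kd: "mkd X (Suc 0) zero_sub (sp X)" by (simp only: One_nat_def)
  define img where "img s = rimg (hgraph (fst s) (snd s)) (sp (fst s))" for s :: "'a hmod \<times> 'a hmodmor"
  have img: "img (Y, i) = (\<lambda>n. i n ` sp Y n)" for Y i
    by (auto simp: img_def rimg_def hgraph_def fun_eq_iff)
  show "finite_length fgmod_cat X"
  proof (rule kd_imp_finite_length[OF X kd, where I = img])
    fix s assume s: "s \<in> subobjects fgmod_cat X"
    obtain Y i where Yi: "s = (Y, i)" by (cases s)
    then have Y: "Y \<in> fgmods" "monic fgmod_cat Y X i" using s by (auto simp: subobjects_def)
    note i = monic_fgmodD[OF Y(1) X Y(2)]
    show "submodule (img s) X"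
      unfolding img_def Yi fst_conv snd_conv by (rule submodule_rimg[OF arel_hgraph[OF ObD[OF Y(1)] i(1)] submodule_sp[OF ObD[OF Y(1)]]])
    fix t assume t: "t \<in> subobjects fgmod_cat X"
    obtain Z j where Zj: "t = (Z, j)" by (cases t)
    then have Z: "Z \<in> fgmods" "monic fgmod_cat Z X j" using t by (auto simp: subobjects_def)
    note j = monic_fgmodD[OF Z(1) X Z(2)]
    show "mkd X 0 (inf (img s) (img t)) (img s)" if le: "sub_le fgmod_cat X s t"
    proof -
      obtain h where h: "h \<in> mod_homs Y Z" and eq: "i = (\<lambda>n. compose (sp Y n) (j n) (h n))"
        using le unfolding sub_le_def Yi Zj prod.case Mor_fgmod Cmp_fgmod by blast
      have "i n x \<in> j n ` sp Z n" if "x \<in> sp Y n" for n x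
        using that fun_cong[OF fun_cong[OF eq, of n], of x] linear_mapD(1)[OF mod_homsD(2)[OF h] that]
        by (simp add: compose_def)
      then show ?thesis unfolding Yi Zj img by (auto simp: le_fun_def)
    qed
    assume "mkd X 0 (inf (img t) (img s)) (img t)"
    then have le: "j n ` sp Z n \<subseteq> i n ` sp Y n" for n
      unfolding Yi Zj img by (auto simp: le_fun_def)
    \<comment> \<open>Since the image of \<open>j\<close> lies in that of \<open>i\<close>,
      inverting \<open>i\<close> on its image factors \<open>j\<close> through \<open>i\<close>.
      Injectivity of \<open>i\<close> makes \<open>h\<close> a homomorphism.\<close>
    define h where "h n = restrict (\<lambda>z. inv_into (sp Y n) (i n) (j n z)) (sp Z n)" for n
    have h_in: "h n z \<in> sp Y n" and ih: "i n (h n z) = j n z" if "z \<in> sp Z n" for n z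
      using that le[of n] inv_into_into[of "j n z" "i n" "sp Y n"] f_inv_into_f[of "j n z" "i n" "sp Y n"]
      by (auto simp: h_def)
    note iD = linear_mapD[OF mod_homsD(2)[OF i(1)]] and jD = linear_mapD[OF mod_homsD(2)[OF j(1)]]
    note Z_cl = submoduleE(2,3)[OF submodule_sp[OF ObD[OF Z(1)]]] and Y_cl = submoduleE(2,3)[OF submodule_sp[OF ObD[OF Y(1)]]]
    have h: "h \<in> mod_homs Z Y"
      unfolding mod_homs_def
    proof (intro CollectI conjI allI ballI)
      show "h n \<in> extensional (sp Z n)" for n by (simp add: h_def)
      show "linear_map (sp Z n) (sp Y n) (h n)" for n
        unfolding linear_map_def
      proof (intro conjI ballI allI)
        show "h n ` sp Z n \<subseteq> sp Y n" using h_in by auto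
        show "h n (x + y) = h n x + h n y" if "x \<in> sp Z n" "y \<in> sp Z n" for x y
        proof (rule inj_onD[OF i(2)])
          show "i n (h n (x + y)) = i n (h n x + h n y)"
            using ih[OF Z_cl(1)[OF that]] ih[OF that(1)] ih[OF that(2)] jD(2)[OF that]
              iD(2)[OF h_in[OF that(1)] h_in[OF that(2)]] by simp
          show "h n (x + y) \<in> sp Y n" "h n x + h n y \<in> sp Y n"
            using h_in Z_cl(1) Y_cl(1) that by blast+
        qed
        show "h n (smult c x) = smult c (h n x)" if "x \<in> sp Z n" for c x
        proof (rule inj_onD[OF i(2)])
          show "i n (h n (smult c x)) = i n (smult c (h n x))"
            using ih[OF Z_cl(2)[OF that]] ih[OF that] jD(3)[OF that] iD(3)[OF h_in[OF that]] by simp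
          show "h n (smult c x) \<in> sp Y n" "smult c (h n x) \<in> sp Y n"
            using h_in Z_cl(2) Y_cl(2) that by blast+
        qed
      qed
      show "h m (act Z n m \<phi> x) = act Y n m \<phi> (h n x)" if \<phi>: "\<phi> \<in> Mor hecke_cat n m" and x: "x \<in> sp Z n" for n m \<phi> x
      proof (rule inj_onD[OF i(2), of m])
        have a: "act Z n m \<phi> x \<in> sp Z m" "act Y n m \<phi> (h n x) \<in> sp Y m"
          using linear_mapD(1)[OF hmoduleD(2)[OF ObD[OF Z(1)] \<phi>]] linear_mapD(1)[OF hmoduleD(2)[OF ObD[OF Y(1)] \<phi>]] x h_in
          by auto
        then show "h m (act Z n m \<phi> x) \<in> sp Y m" "act Y n m \<phi> (h n x) \<in> sp Y m" using h_in by auto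
        show "i m (h m (act Z n m \<phi> x)) = i m (act Y n m \<phi> (h n x))"
          using ih[OF a(1)] ih[OF x] mod_homsD(3)[OF i(1) \<phi> h_in[OF x]] mod_homsD(3)[OF j(1) \<phi> x] by simp
      qed
    qed
    have "j = (\<lambda>n. compose (sp Z n) (i n) (h n))"
    proof
      fix n show "j n = compose (sp Z n) (i n) (h n)"
        by (rule extensionalityI[OF mod_homsD(1)[OF j(1)]]) (auto simp: compose_def ih)
    qed
    then show "sub_le fgmod_cat X t s"
      unfolding sub_le_def Yi Zj prod.case Mor_fgmod Cmp_fgmod using h by blast
  qed
qed

section \<open>Serre quotients\<close>

text \<open>Together with \<open>kd_sum_small\<close> this makes the index system of Gabriel's
  colimit directed.\<close>

lemma kd_inf_cosmall:
  assumes X: "hmodule X" and A: "submodule A X" "mkd X d A (sp X)" and B: "submodule B X" "mkd X d B (sp X)"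
  shows "mkd X d (inf A B) (sp X)"
proof -
  interpret modular_lattice "\<lambda>N. submodule N X" sub_sum by (rule submodule_lattice[OF X])
  have "mkd X d (inf A B) (inf (sp X) B)"
    by (rule kd_inf[OF A(1) submodule_sp[OF X] B(1) submoduleD(4)[OF A(1)] A(2)])
  moreover have "inf (sp X) B = B" using submoduleD(4)[OF B(1)] by (rule inf.absorb2)
  ultimately show ?thesis
    using kd_trans[OF P_inf[OF A(1) B(1)] B(1) submodule_sp[OF X] inf_le2 submoduleD(4)[OF B(1)] _ B(2)] by simp
qed

lemma kd_sum_right:
  assumes X: "hmodule X" and A: "submodule A X" "mkd X d zero_sub A" and B: "submodule B X"
  shows "mkd X d B (sub_sum A B)"
proof -
  interpret modular_lattice "\<lambda>N. submodule N X" sub_sum by (rule submodule_lattice[OF X])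
  have "mkd X d (sub_sum zero_sub B) (sub_sum A B)"
    by (rule kd_join[OF submodule_zero[OF X] A(1) B zero_sub_le[OF A(1)] A(2)])
  then show ?thesis
    by (rule kd_mono[OF _ J_least[OF submodule_zero[OF X] B B zero_sub_le[OF B] order_refl] order_refl])
qed

lemma kd_sum_small:
  assumes X: "hmodule X" and A: "submodule A X" "mkd X d zero_sub A" and B: "submodule B X" "mkd X d zero_sub B"
  shows "mkd X d zero_sub (sub_sum A B)"
proof -
  interpret modular_lattice "\<lambda>N. submodule N X" sub_sum by (rule submodule_lattice[OF X])
  show ?thesis
    by (rule kd_trans[OF submodule_zero[OF X] B(1) P_J[OF A(1) B(1)] zero_sub_le[OF B(1)] J_ge2[OF A(1) B(1)]
      B(2) kd_sum_right[OF X A B(1)]])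
qed

section \<open>Roofs as additive relations\<close>

abbreviation rdom :: "'k::field roof \<Rightarrow> 'k fam" where
  "rdom R \<equiv> \<lambda>n. Domain (R n)"

abbreviation rran :: "'k::field roof \<Rightarrow> 'k fam" where
  "rran R \<equiv> \<lambda>n. Range (R n)"

abbreviation ramb :: "'k::field roof \<Rightarrow> 'k fam" where
  "ramb R \<equiv> \<lambda>n. R n `` {0}"

abbreviation rcomp :: "'k::field roof \<Rightarrow> 'k roof \<Rightarrow> 'k roof" where
  "rcomp R S \<equiv> \<lambda>n. R n O S n"

lemma rdom_eq: "arel X Y R \<Longrightarrow> rdom R = rimg (rconv R) (sp Y)"
  using arelD(2) by (fastforce simp: rimg_def rconv_def fun_eq_iff)

lemma rran_eq: "arel X Y R \<Longrightarrow> rran R = rimg R (sp X)"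
  using arelD(1) by (fastforce simp: rimg_def fun_eq_iff)

lemma ramb_eq: "ramb R = rimg R zero_sub"
  by (simp add: rimg_def)

lemma submodule_rdom: "hmodule Y \<Longrightarrow> arel X Y R \<Longrightarrow> submodule (rdom R) X"
  using submodule_rimg[OF arel_rconv submodule_sp, of X Y R] by (simp add: rdom_eq)

lemma submodule_rran: "hmodule X \<Longrightarrow> arel X Y R \<Longrightarrow> submodule (rran R) Y"
  using submodule_rimg[OF _ submodule_sp, of X Y R] by (simp add: rran_eq)

lemma submodule_ramb: "hmodule X \<Longrightarrow> arel X Y R \<Longrightarrow> submodule (ramb R) Y"
  unfolding ramb_eq by (intro submodule_rimg submodule_zero)

text \<open>The induction hypothesis on the filtration: the class divided out is described by
  submodule lattices, so that its closure properties come from \<open>kd\<close>.\<close>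

locale serre_class =
  fixes C :: "'k::field hmod set" and k :: nat
  assumes C: "C = {M \<in> fgmods. mkd M k zero_sub (sp M)}"
begin

lemma small_iff:
  assumes Y: "Y \<in> fgmods"
  shows "small C Y Y' \<longleftrightarrow> submodule Y' Y \<and> mkd Y k zero_sub Y'"
proof (cases "submodule Y' Y")
  case True
  then show ?thesis
    using restrict_Ob[OF Y True] mkd_restrict[OF True submodule_zero[OF ObD[OF Y]] True zero_sub_le[OF True] order_refl, of k]
    by (simp add: small_def C restrict_mod_simps)
qed (simp add: small_def)

text \<open>\<open>quotient_kd\<close> moves the lattice condition between \<open>X\<close> and a
  quotient. For the converse the quotient constructed above is finitely generated and so lies in
  \<open>C\<close>.\<close>

lemma cosmall_iff:
  assumes X: "X \<in> fgmods"
  shows "cosmall C X X' \<longleftrightarrow> submodule X' X \<and> mkd X k X' (sp X)"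
proof
  assume c: "cosmall C X X'"
  then have "quotient_in C X X'" by (simp add: cosmall_def)
  then obtain Q where "Q \<in> C" and "\<exists>p\<in>mod_homs X Q. \<forall>n. p n ` sp X n = sp Q n \<and> {x \<in> sp X n. p n x = 0} = X' n"
    unfolding quotient_in_def by (rule bexE)
  moreover from this(2) obtain p where p: "p \<in> mod_homs X Q"
    and *: "\<forall>n. p n ` sp X n = sp Q n \<and> {x \<in> sp X n. p n x = 0} = X' n" by (rule bexE)
  ultimately have Q: "hmodule Q" "mkd Q k zero_sub (sp Q)" by (auto simp: C ObD)
  have "mkd X k X' (sp X)"
    using quotient_kd[OF ObD[OF X] Q(1) p, of X' k] * Q(2) by simp
  then show "submodule X' X \<and> mkd X k X' (sp X)" using c by (simp add: cosmall_def)
next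
  assume a: "submodule X' X \<and> mkd X k X' (sp X)"
  then obtain Q p where *: "hmodule Q \<and> p \<in> mod_homs X Q \<and> (\<forall>n. p n ` sp X n = sp Q n \<and> {x \<in> sp X n. p n x = 0} = X' n)"
    using quotient_exists[OF ObD[OF X], of X'] by blast
  then have Q: "hmodule Q" "p \<in> mod_homs X Q"
    "\<And>n. p n ` sp X n = sp Q n" "\<And>n. {x \<in> sp X n. p n x = 0} = X' n"
    by auto
  have "fin_gen Q" using fin_gen_image[OF ObD[OF X] _ Q(1-3)] X by (simp add: Ob_fgmod)
  moreover have "mkd Q k zero_sub (sp Q)" using quotient_kd[OF ObD[OF X] Q, of k] a by simp
  ultimately have "Q \<in> C" using Q(1) by (simp add: C Ob_fgmod)
  then show "cosmall C X X'"
    unfolding cosmall_def quotient_in_def using a restrict_Ob[OF X, of X'] *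
    by (intro conjI bexI[of _ Q] bexI[of _ p]) auto
qed

lemma roofs_iff:
  assumes X: "X \<in> fgmods" and Y: "Y \<in> fgmods"
  shows "R \<in> roofs C X Y \<longleftrightarrow> arel X Y R \<and> mkd X k (rdom R) (sp X) \<and> mkd Y k zero_sub (ramb R)"
  unfolding roofs_def mem_Collect_eq cosmall_iff[OF X] small_iff[OF Y] arel_def[symmetric]
    conj_assoc[symmetric]
  using submodule_rdom[OF ObD[OF Y], of X R] submodule_ramb[OF ObD[OF X], of Y R]
  unfolding arel_def by blast

text \<open>That \<open>B\<close> contains both images of zero follows from \<open>diff\<close> at
  \<open>x = 0\<close>, by comparison with the pair \<open>(0, 0)\<close>.\<close>

lemma roof_relI:
  assumes X: "X \<in> fgmods" and Y: "Y \<in> fgmods"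
    and R: "R \<in> roofs C X Y" and S: "S \<in> roofs C X Y"
    and A: "submodule A X" "mkd X k A (sp X)" "A \<le> rdom R" "A \<le> rdom S"
    and B: "submodule B Y" "mkd Y k zero_sub B"
    and diff: "\<And>n x y z. x \<in> A n \<Longrightarrow> (x, y) \<in> R n \<Longrightarrow> (x, z) \<in> S n \<Longrightarrow> y - z \<in> B n"
  shows "(R, S) \<in> roof_rel C X Y"
proof -
  have "R n `` {0} \<subseteq> B n" "S n `` {0} \<subseteq> B n" for n
  proof -
    have 0: "0 \<in> A n" "(0, 0) \<in> R n" "(0, 0) \<in> S n"
      using submoduleE(1)[OF A(1)] R S arelD(3) by (auto simp: roofs_iff[OF X Y])
    show "R n `` {0} \<subseteq> B n" using diff[OF 0(1) _ 0(3)] by auto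
    have "- y \<in> B n" if "(0, y) \<in> S n" for y using diff[OF 0(1,2) that] by simp
    then show "S n `` {0} \<subseteq> B n" using submoduleE(3)[OF B(1), of _ n "-1"] by force
  qed
  moreover have "cosmall C X A" "small C Y B"
    using A B by (simp_all add: cosmall_iff[OF X] small_iff[OF Y])
  ultimately show ?thesis
    unfolding roof_rel_def mem_Collect_eq prod.case using R S A(3,4) diff
    by (intro conjI exI[of _ A] exI[of _ B]) (auto simp: le_fun_def)
qed

definition agree :: "'k hmod \<Rightarrow> 'k hmod \<Rightarrow> 'k roof \<Rightarrow> 'k roof \<Rightarrow> 'k fam \<Rightarrow> 'k fam \<Rightarrow> bool" where
  "agree X Y R S A B \<longleftrightarrow> submodule A X \<and> mkd X k A (sp X) \<and> A \<le> rdom R \<and> A \<le> rdom S \<and>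
    submodule B Y \<and> mkd Y k zero_sub B \<and>
    (\<forall>n. \<forall>x\<in>A n. \<forall>y\<in>R n `` {x}. \<forall>z\<in>S n `` {x}. y - z \<in> B n)"

lemma agreeD:
  assumes "agree X Y R S A B"
  shows "submodule A X" "mkd X k A (sp X)" "A \<le> rdom R" "A \<le> rdom S"
    "submodule B Y" "mkd Y k zero_sub B"
    "x \<in> A n \<Longrightarrow> (x, y) \<in> R n \<Longrightarrow> (x, z) \<in> S n \<Longrightarrow> y - z \<in> B n"
  using assms unfolding agree_def by blast+

lemma roof_relE:
  assumes X: "X \<in> fgmods" and Y: "Y \<in> fgmods" and "(R, S) \<in> roof_rel C X Y"
  obtains A B where "R \<in> roofs C X Y" "S \<in> roofs C X Y" "agree X Y R S A B"
proof -
  from assms(3) obtain A B where RS: "R \<in> roofs C X Y" "S \<in> roofs C X Y" and "cosmall C X A" "small C Y B"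
    and *: "\<forall>n. A n \<subseteq> Domain (R n) \<inter> Domain (S n) \<and> R n `` {0} \<union> S n `` {0} \<subseteq> B n \<and>
           (\<forall>x\<in>A n. \<forall>y\<in>R n `` {x}. \<forall>z\<in>S n `` {x}. y - z \<in> B n)"
    unfolding roof_rel_def by blast
  have "A \<le> rdom R" "A \<le> rdom S" using * by (auto simp: le_fun_def)
  then show thesis
    using that[OF RS, of A B] * \<open>cosmall C X A\<close> \<open>small C Y B\<close>
    by (simp add: agree_def cosmall_iff[OF X] small_iff[OF Y])
qed

lemma equiv_roof_rel:
  assumes X: "X \<in> fgmods" and Y: "Y \<in> fgmods"
  shows "equiv (roofs C X Y) (roof_rel C X Y)"
proof (rule equivI)
  show "roof_rel C X Y \<subseteq> roofs C X Y \<times> roofs C X Y" by (auto simp: roof_rel_def)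
  show "refl_on (roofs C X Y) (roof_rel C X Y)"
  proof (rule refl_onI)
    fix R assume R: "R \<in> roofs C X Y"
    then have a: "arel X Y R" "mkd X k (rdom R) (sp X)" "mkd Y k zero_sub (ramb R)"
      by (auto simp: roofs_iff[OF X Y])
    show "(R, R) \<in> roof_rel C X Y"
      by (rule roof_relI[OF X Y R R submodule_rdom[OF ObD[OF Y] a(1)] a(2) order_refl order_refl
        submodule_ramb[OF ObD[OF X] a(1)] a(3)]) (use arel_diff[OF a(1)] in fastforce)
  qed
  show "sym (roof_rel C X Y)"
  proof (rule symI)
    fix R S assume "(R, S) \<in> roof_rel C X Y"
    then obtain A B where RS: "R \<in> roofs C X Y" "S \<in> roofs C X Y" "agree X Y R S A B"
      by (rule roof_relE[OF X Y])
    note * = RS(1,2) agreeD[OF RS(3)]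
    show "(S, R) \<in> roof_rel C X Y"
    proof (rule roof_relI[OF X Y *(2,1,3,4,6,5,7,8)])
      show "y - z \<in> B n" if "x \<in> A n" "(x, y) \<in> S n" "(x, z) \<in> R n" for n x y z
        using submoduleE(3)[OF *(7) *(9)[OF that(1,3,2)], of "-1"] by simp
    qed
  qed
  show "trans (roof_rel C X Y)"
  proof (rule transI)
    fix R S T assume "(R, S) \<in> roof_rel C X Y"
    then obtain A B where RS1: "R \<in> roofs C X Y" "S \<in> roofs C X Y" "agree X Y R S A B"
      by (rule roof_relE[OF X Y])
    note 1 = RS1(1,2) agreeD[OF RS1(3)]
    assume "(S, T) \<in> roof_rel C X Y"
    then obtain A' B' where RS2: "S \<in> roofs C X Y" "T \<in> roofs C X Y" "agree X Y S T A' B'"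
      by (rule roof_relE[OF X Y])
    note 2 = RS2(1,2) agreeD[OF RS2(3)]
    show "(R, T) \<in> roof_rel C X Y"
    \<comment> \<open>The domains of agreement are intersected and the two errors added.\<close>
    proof (rule roof_relI[OF X Y 1(1) 2(2) submodule_inf[OF 1(3) 2(3)] kd_inf_cosmall[OF ObD[OF X] 1(3,4) 2(3,4)]
      le_infI1[OF 1(5)] le_infI2[OF 2(6)] submodule_sum[OF ObD[OF Y] 1(7) 2(7)] kd_sum_small[OF ObD[OF Y] 1(7,8) 2(7,8)]])
      fix n x y z assume x: "x \<in> inf A A' n" "(x, y) \<in> R n" "(x, z) \<in> T n"
      then obtain s where s: "(x, s) \<in> S n" using 1(6) by (fastforce simp: le_fun_def)
      have "y - s \<in> B n" "s - z \<in> B' n" using 1(9)[of x n y s] 2(9)[of x n s z] x s by auto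
      moreover have "y - z = (y - s) + (s - z)" by simp
      ultimately show "y - z \<in> sub_sum B B' n" unfolding sub_sum_def by blast
    qed
  qed
qed

context
  fixes X Y Z :: "'k hmod"
  assumes X: "X \<in> fgmods" and Y: "Y \<in> fgmods" and Z: "Z \<in> fgmods"
begin

private lemmas hX = ObD[OF X] and hY = ObD[OF Y] and hZ = ObD[OF Z]

text \<open>The domain of the composite is the preimage of the domain of \<open>S\<close>, and its
  ambiguity is the image under \<open>S\<close> of the ambiguity of \<open>R\<close>. By
  \<open>arel_kd\<close> they differ little from the domain of \<open>R\<close> and the ambiguity of
  \<open>S\<close>; closure under extensions does the rest.\<close>

lemma roof_comp:
  assumes R: "R \<in> roofs C X Y" and S: "S \<in> roofs C Y Z"
  shows "rcomp R S \<in> roofs C X Z"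
proof -
  have r: "arel X Y R" "mkd X k (rdom R) (sp X)" "mkd Y k zero_sub (ramb R)"
    using R by (auto simp: roofs_iff[OF X Y])
  have s: "arel Y Z S" "mkd Y k (rdom S) (sp Y)" "mkd Z k zero_sub (ramb S)"
    using S by (auto simp: roofs_iff[OF Y Z])
  interpret LX: modular_lattice "\<lambda>N. submodule N X" sub_sum by (rule submodule_lattice[OF hX])
  interpret LZ: modular_lattice "\<lambda>N. submodule N Z" sub_sum by (rule submodule_lattice[OF hZ])
  have D: "rdom (rcomp R S) = rimg (rconv R) (rdom S)" and A: "ramb (rcomp R S) = rimg S (ramb R)"
    by (auto simp: rimg_def rconv_def fun_eq_iff)
  have "mkd X k (rimg (rconv R) (rdom S)) (rimg (rconv R) (sp Y))"
    by (rule arel_kd[OF hY hX arel_rconv[OF r(1)] submodule_rdom[OF hZ s(1)] submodule_sp[OF hY]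
      submoduleD(4)[OF submodule_rdom[OF hZ s(1)]] s(2)])
  then have 1: "mkd X k (rdom (rcomp R S)) (rdom R)" unfolding D rdom_eq[OF r(1)] .
  have "rdom (rcomp R S) \<le> rdom R" by (auto simp: le_fun_def)
  then have 2: "mkd X k (rdom (rcomp R S)) (sp X)"
    by (rule LX.kd_trans[OF submodule_rdom[OF hZ arel_comp[OF r(1) s(1)]] submodule_rdom[OF hY r(1)]
      submodule_sp[OF hX] _ submoduleD(4)[OF submodule_rdom[OF hY r(1)]] 1 r(2)])
  have "mkd Z k (rimg S zero_sub) (rimg S (ramb R))"
    by (rule arel_kd[OF hY hZ s(1) submodule_zero[OF hY] submodule_ramb[OF hX r(1)]
      zero_sub_le[OF submodule_ramb[OF hX r(1)]] r(3)])
  then have 3: "mkd Z k (ramb S) (ramb (rcomp R S))" unfolding A ramb_eq[of S] .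
  have "ramb S \<le> ramb (rcomp R S)" using arelD(3)[OF r(1)] by (auto simp: le_fun_def)
  then have 4: "mkd Z k zero_sub (ramb (rcomp R S))"
    by (rule LZ.kd_trans[OF submodule_zero[OF hZ] submodule_ramb[OF hY s(1)]
      submodule_ramb[OF hX arel_comp[OF r(1) s(1)]] zero_sub_le[OF submodule_ramb[OF hY s(1)]] _ s(3) 3])
  show ?thesis unfolding roofs_iff[OF X Z] using arel_comp[OF r(1) s(1)] 2 4 by blast
qed

lemma roof_comp_cong_left:
  assumes R: "(R, R') \<in> roof_rel C X Y" and S: "S \<in> roofs C Y Z"
  shows "(rcomp R S, rcomp R' S) \<in> roof_rel C X Z"
proof -
  from R obtain A B where RS: "R \<in> roofs C X Y" "R' \<in> roofs C X Y" "agree X Y R R' A B"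
      by (rule roof_relE[OF X Y])
    note * = RS(1,2) agreeD[OF RS(3)]
  have s: "arel Y Z S" "mkd Y k (rdom S) (sp Y)" "mkd Z k zero_sub (ramb S)"
    using S by (auto simp: roofs_iff[OF Y Z])
  interpret LZ: modular_lattice "\<lambda>N. submodule N Z" sub_sum by (rule submodule_lattice[OF hZ])
  note c = roof_comp[OF *(1) S] roof_comp[OF *(2) S]
  have ca: "arel X Z (rcomp R S)" "mkd X k (rdom (rcomp R S)) (sp X)"
    "arel X Z (rcomp R' S)" "mkd X k (rdom (rcomp R' S)) (sp X)"
    using c by (auto simp: roofs_iff[OF X Z])
  note sub = submodule_rdom[OF hZ ca(1)] submodule_rdom[OF hZ ca(3)]
  define D where "D = inf A (inf (rdom (rcomp R S)) (rdom (rcomp R' S)))"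
  have D: "submodule D X" "mkd X k D (sp X)" unfolding D_def
    by (intro submodule_inf *(3) sub, intro kd_inf_cosmall[OF hX] submodule_inf sub *(3,4) ca)
  \<comment> \<open>Values of \<open>R\<close> and \<open>R'\<close> that differ by an element of
    \<open>B\<close> have images under \<open>S\<close> that differ by an element of this submodule.
    It is small as an extension of the ambiguity of \<open>S\<close> by an image of a part of
    \<open>B\<close>.\<close>
  have SB: "submodule (rimg S B) Z" by (rule submodule_rimg[OF s(1) *(7)])
  have "mkd Z k (rimg S zero_sub) (rimg S B)"
    by (rule arel_kd[OF hY hZ s(1) submodule_zero[OF hY] *(7) zero_sub_le[OF *(7)] *(8)])
  then have SB': "mkd Z k zero_sub (rimg S B)"
    using LZ.kd_trans[OF submodule_zero[OF hZ] submodule_ramb[OF hY s(1)] SB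
      zero_sub_le[OF submodule_ramb[OF hY s(1)]] _ s(3)] rimg_mono[OF zero_sub_le[OF *(7)], of S]
    unfolding ramb_eq by blast
  show ?thesis
  proof (rule roof_relI[OF X Z c D _ _ SB SB'])
    show "D \<le> rdom (rcomp R S)" "D \<le> rdom (rcomp R' S)"
      unfolding D_def by (auto intro: le_infI2)
    fix n x z z' assume x: "x \<in> D n" "(x, z) \<in> rcomp R S n" "(x, z') \<in> rcomp R' S n"
    then obtain y y' where y: "(x, y) \<in> R n" "(y, z) \<in> S n" "(x, y') \<in> R' n" "(y', z') \<in> S n" by auto
    have "y - y' \<in> B n" using *(9)[OF _ y(1,3)] x(1) by (auto simp: D_def)
    then show "z - z' \<in> rimg S B n" using arel_diff[OF s(1) y(2,4)] by (auto simp: rimg_def)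
  qed
qed

lemma roof_comp_cong_right:
  assumes R: "R \<in> roofs C X Y" and S: "(S, S') \<in> roof_rel C Y Z"
  shows "(rcomp R S, rcomp R S') \<in> roof_rel C X Z"
proof -
  from S obtain A B where RS: "S \<in> roofs C Y Z" "S' \<in> roofs C Y Z" "agree Y Z S S' A B"
      by (rule roof_relE[OF Y Z])
    note * = RS(1,2) agreeD[OF RS(3)]
  have r: "arel X Y R" "mkd X k (rdom R) (sp X)" "mkd Y k zero_sub (ramb R)"
    using R by (auto simp: roofs_iff[OF X Y])
  have s: "arel Y Z S" "arel Y Z S'" using *(1,2) by (auto simp: roofs_iff[OF Y Z])
  interpret LX: modular_lattice "\<lambda>N. submodule N X" sub_sum by (rule submodule_lattice[OF hX])
  note c = roof_comp[OF R *(1)] roof_comp[OF R *(2)]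
  have ca: "mkd Z k zero_sub (ramb (rcomp R S))" "mkd Z k zero_sub (ramb (rcomp R S'))"
    using c by (auto simp: roofs_iff[OF X Z])
  note sub = submodule_ramb[OF hX arel_comp[OF r(1) s(1)]] submodule_ramb[OF hX arel_comp[OF r(1) s(2)]]
  define D where "D = rimg (rconv R) A"
  have D: "submodule D X" unfolding D_def by (rule submodule_rimg[OF arel_rconv[OF r(1)] *(3)])
  have "mkd X k D (rimg (rconv R) (sp Y))"
    unfolding D_def by (rule arel_kd[OF hY hX arel_rconv[OF r(1)] *(3) submodule_sp[OF hY] submoduleD(4)[OF *(3)] *(4)])
  then have "mkd X k D (rdom R)" unfolding rdom_eq[OF r(1)] .
  moreover have "D \<le> rdom R" by (auto simp: D_def rimg_def rconv_def le_fun_def)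
  ultimately have D': "mkd X k D (sp X)"
    using LX.kd_trans[OF D submodule_rdom[OF hY r(1)] submodule_sp[OF hX] _ submoduleD(4)[OF submodule_rdom[OF hY r(1)]] _ r(2)] by blast
  \<comment> \<open>The intermediate values over \<open>x\<close> may lie outside \<open>A\<close>.
    Replacing them by one inside \<open>A\<close> costs the ambiguities of both composites in
    addition to \<open>B\<close>.\<close>
  define E where "E = sub_sum B (sub_sum (ramb (rcomp R S)) (ramb (rcomp R S')))"
  have E: "submodule E Z" "mkd Z k zero_sub E" unfolding E_def
    by (intro submodule_sum[OF hZ] *(7) sub, intro kd_sum_small[OF hZ] submodule_sum[OF hZ] sub *(7,8) ca)
  show ?thesis
  proof (rule roof_relI[OF X Z c D D' _ _ E])
    show "D \<le> rdom (rcomp R S)" "D \<le> rdom (rcomp R S')"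
      using *(5,6) by (fastforce simp: D_def rimg_def rconv_def le_fun_def)+
    fix n x z z' assume x: "x \<in> D n" "(x, z) \<in> rcomp R S n" "(x, z') \<in> rcomp R S' n"
    then obtain y y' where y: "(x, y) \<in> R n" "(y, z) \<in> S n" "(x, y') \<in> R n" "(y', z') \<in> S' n" by auto
    obtain u where u: "u \<in> A n" "(x, u) \<in> R n" using x(1) by (auto simp: D_def rimg_def rconv_def)
    then obtain v v' where v: "(u, v) \<in> S n" "(u, v') \<in> S' n" using *(5,6) by (force simp: le_fun_def)
    have "z - v \<in> ramb (rcomp R S) n"
      using arel_diff[OF r(1) y(1) u(2)] arel_diff[OF s(1) y(2) v(1)] by auto
    moreover have "v' - z' \<in> ramb (rcomp R S') n"
      using arel_diff[OF r(1) u(2) y(3)] arel_diff[OF s(2) v(2) y(4)] by auto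
    moreover have "v - v' \<in> B n" by (rule *(9)[OF u(1) v])
    moreover have "z - z' = (v - v') + ((z - v) + (v' - z'))" by simp
    ultimately show "z - z' \<in> E n" unfolding E_def sub_sum_def by blast
  qed
qed

abbreviation SQ :: "('k hmod, 'k roof set) category" where
  "SQ \<equiv> serre_quotient C"

end

section \<open>Classes of roofs and their composition\<close>

abbreviation rcls :: "'k hmod \<Rightarrow> 'k hmod \<Rightarrow> 'k roof \<Rightarrow> 'k roof set" where
  "rcls X Y R \<equiv> roof_rel C X Y `` {R}"

lemma rcls_eq_iff:
  assumes "X \<in> fgmods" "Y \<in> fgmods" "R \<in> roofs C X Y" "S \<in> roofs C X Y"
  shows "rcls X Y R = rcls X Y S \<longleftrightarrow> (R, S) \<in> roof_rel C X Y"
  by (rule eq_equiv_class_iff[OF equiv_roof_rel[OF assms(1,2)] assms(3,4)])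

lemma Mor_serre: "Mor SQ X Y = rcls X Y ` roofs C X Y"
  by (auto simp: serre_quotient_def quotient_def)

lemma Ob_serre: "Ob SQ = fgmods"
  by (simp add: serre_quotient_def)

lemma Cmp_serre:
  assumes X: "X \<in> fgmods" and Y: "Y \<in> fgmods" and Z: "Z \<in> fgmods"
    and R: "R \<in> roofs C X Y" and S: "S \<in> roofs C Y Z"
  shows "Cmp SQ X Y Z (rcls Y Z S) (rcls X Y R) = rcls X Z (rcomp R S)"
proof -
  have "rcls X Z (rcomp R' S') = rcls X Z (rcomp R S)" if "S' \<in> rcls Y Z S" "R' \<in> rcls X Y R" for R' S'
  proof -
    have r: "(R, R') \<in> roof_rel C X Y" "R' \<in> roofs C X Y" and s: "(S, S') \<in> roof_rel C Y Z" "S' \<in> roofs C Y Z"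
      using that by (auto simp: roof_rel_def)
    have "rcls X Z (rcomp R S) = rcls X Z (rcomp R' S)"
      by (rule equiv_class_eq[OF equiv_roof_rel[OF X Z] roof_comp_cong_left[OF X Y Z r(1) S]])
    also have "\<dots> = rcls X Z (rcomp R' S')"
      by (rule equiv_class_eq[OF equiv_roof_rel[OF X Z] roof_comp_cong_right[OF X Y Z r(2) s(1)]])
    finally show ?thesis by simp
  qed
  moreover have "S \<in> rcls Y Z S" "R \<in> rcls X Y R"
    using equiv_class_self[OF equiv_roof_rel] X Y Z R S by auto
  ultimately have "(\<Union>S\<in>rcls Y Z S. \<Union>R\<in>rcls X Y R. rcls X Z (rcomp R S)) = rcls X Z (rcomp R S)"
    by blast
  then show ?thesis by (simp add: serre_quotient_def)
qed

end

section \<open>Subobjects in the Serre quotient\<close>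

lemma restrict_self: "restrict_mod X (sp X) = X"
  by (simp add: restrict_mod_def)

context serre_class
begin

definition idr :: "'k fam \<Rightarrow> 'k roof" where
  "idr N = (\<lambda>n. Id_on (N n))"

lemma idr_roof:
  assumes X: "X \<in> fgmods" and N: "submodule N X" and N': "submodule N' X" and le: "N \<le> N'"
  shows "idr N \<in> roofs C (restrict_mod X N) (restrict_mod X N')"
  unfolding roofs_iff[OF restrict_Ob[OF X N] restrict_Ob[OF X N']]
proof (intro conjI)
  show "arel (restrict_mod X N) (restrict_mod X N') (idr N)"
    by (rule arelI) (use le submoduleE[OF N] submoduleD(3)[OF N] in
      \<open>auto simp: idr_def restrict_mod_simps le_fun_def\<close>)
  have "rdom (idr N) = N" "ramb (idr N) = zero_sub"
    using submoduleE(1)[OF N] by (auto simp: idr_def)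
  then show "mkd (restrict_mod X N) k (rdom (idr N)) (sp (restrict_mod X N))"
    "mkd (restrict_mod X N') k zero_sub (ramb (idr N))"
    by (simp_all add: restrict_mod_simps kd_refl)
qed

lemma idr_roof_sp:
  assumes X: "X \<in> fgmods" and N: "submodule N X"
  shows "idr N \<in> roofs C (restrict_mod X N) X"
  using idr_roof[OF X N submodule_sp[OF ObD[OF X]] submoduleD(4)[OF N]] by (simp add: restrict_self)

lemma rcomp_idr:
  assumes "\<And>n x y. (x, y) \<in> R n \<Longrightarrow> y \<in> N n"
  shows "rcomp R (idr N) = R"
  using assms by (force simp: idr_def fun_eq_iff)

abbreviation sub_ob :: "'k hmod \<Rightarrow> 'k fam \<Rightarrow> 'k hmod \<times> 'k roof set" where
  "sub_ob X N \<equiv> (restrict_mod X N, rcls (restrict_mod X N) X (idr N))"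

text \<open>Two roofs with values in \<open>N\<close> that agree up to a small \<open>B\<close> in
  \<open>X\<close> agree up to \<open>inf B N\<close>, which is small in \<open>N\<close>.\<close>

lemma monic_idr:
  assumes X: "X \<in> fgmods" and N: "submodule N X"
  shows "monic SQ (restrict_mod X N) X (rcls (restrict_mod X N) X (idr N))"
  unfolding monic_def
proof (intro conjI ballI impI)
  let ?N = "restrict_mod X N"
  note NO = restrict_Ob[OF X N] and I = idr_roof_sp[OF X N] and hX = ObD[OF X]
  show "rcls ?N X (idr N) \<in> Mor SQ ?N X"
    unfolding Mor_serre using I by blast
  fix W g h assume "W \<in> Ob SQ" and g: "g \<in> Mor SQ W ?N"
    and h: "h \<in> Mor SQ W ?N"
    and eq: "Cmp SQ W ?N X (rcls ?N X (idr N)) g = Cmp SQ W ?N X (rcls ?N X (idr N)) h"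
  then have W: "W \<in> fgmods" by (simp add: Ob_serre)
  obtain R where R: "R \<in> roofs C W ?N" "g = rcls W ?N R" using g by (auto simp: Mor_serre)
  obtain S where S: "S \<in> roofs C W ?N" "h = rcls W ?N S" using h by (auto simp: Mor_serre)
  have a': "arel W ?N R" "arel W ?N S" using R S by (auto simp: roofs_iff[OF W NO])
  have in_N: "y \<in> N n" if "(x, y) \<in> R n \<or> (x, y) \<in> S n" for x y n
    using that arelD(2)[OF a'(1)] arelD(2)[OF a'(2)] by (auto simp: restrict_mod_simps)
  have RN: "rcomp R (idr N) = R" and SN: "rcomp S (idr N) = S"
    by (rule rcomp_idr, use in_N in blast)+
  note roofs = roof_comp[OF W NO X R(1) I, unfolded RN] roof_comp[OF W NO X S(1) I, unfolded SN]
  have "(R, S) \<in> roof_rel C W X"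
    using eq unfolding R(2) S(2) Cmp_serre[OF W NO X R(1) I] Cmp_serre[OF W NO X S(1) I] RN SN
    by (simp add: rcls_eq_iff[OF W X roofs])
  then obtain A B where ag: "agree W X R S A B" by (rule roof_relE[OF W X])
  note a = agreeD[OF ag]
  have "(R, S) \<in> roof_rel C W ?N"
  proof (rule roof_relI[OF W NO R(1) S(1) a(1-4)])
    have BN: "submodule (inf B N) X" by (rule submodule_inf[OF a(5) N])
    then show "submodule (inf B N) ?N" by (simp add: submodule_restrict[OF N])
    have "mkd X k zero_sub (inf B N)" by (rule kd_mono[OF a(6)]) auto
    then show "mkd ?N k zero_sub (inf B N)"
      using mkd_restrict[OF N submodule_zero[OF hX] BN zero_sub_le[OF BN]] by simp
    show "y - z \<in> inf B N n" if "x \<in> A n" "(x, y) \<in> R n" "(x, z) \<in> S n" for n x y z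
      using a(7)[OF that] in_N that(2,3) submoduleE(4)[OF N, of y n z] by auto
  qed
  then show "g = h" unfolding R(2) S(2) by (simp add: rcls_eq_iff[OF W NO R(1) S(1)])
qed

lemma sub_le_idr:
  assumes X: "X \<in> fgmods" and N: "submodule N X" and N': "submodule N' X" and le: "N \<le> N'"
  shows "sub_le SQ X (sub_ob X N) (sub_ob X N')"
  unfolding sub_le_def prod.case
proof (rule bexI)
  show "rcls (restrict_mod X N) (restrict_mod X N') (idr N) \<in> Mor SQ (restrict_mod X N) (restrict_mod X N')"
    unfolding Mor_serre using idr_roof[OF X N N' le] by blast
  have "rcomp (idr N) (idr N') = idr N"
    using le by (auto simp: idr_def fun_eq_iff le_fun_def)
  then show "rcls (restrict_mod X N) X (idr N) = Cmp SQ (restrict_mod X N) (restrict_mod X N') X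
     (rcls (restrict_mod X N') X (idr N')) (rcls (restrict_mod X N) (restrict_mod X N') (idr N))"
    by (simp add: Cmp_serre[OF restrict_Ob[OF X N] restrict_Ob[OF X N'] X idr_roof[OF X N N' le] idr_roof_sp[OF X N']])
qed

text \<open>A factorization of the inclusion of \<open>N'\<close> through \<open>N\<close> puts a
  large part \<open>A\<close> of \<open>N'\<close> into the sum of \<open>N\<close> and a small
  \<open>B\<close>. The submodule \<open>Z\<close> separates the two contributions: over
  \<open>N\<close> it is small like \<open>B\<close>, and it contains \<open>A\<close>.\<close>

lemma sub_le_idr_reverse:
  assumes X: "X \<in> fgmods" and N: "submodule N X" and N': "submodule N' X" and le: "N \<le> N'"
    and sub: "sub_le SQ X (sub_ob X N') (sub_ob X N)"
  shows "mkd X k N N'"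
proof -
  let ?N = "restrict_mod X N" and ?N' = "restrict_mod X N'"
  note NO = restrict_Ob[OF X N] and NO' = restrict_Ob[OF X N'] and hX = ObD[OF X]
  interpret modular_lattice "\<lambda>N. submodule N X" sub_sum by (rule submodule_lattice[OF hX])
  obtain H where H: "H \<in> roofs C ?N' ?N"
    and eq: "rcls ?N' X (idr N') = Cmp SQ ?N' ?N X (rcls ?N X (idr N)) (rcls ?N' ?N H)"
    using sub unfolding sub_le_def prod.case Mor_serre by blast
  have aH: "arel ?N' ?N H" using H by (auto simp: roofs_iff[OF NO' NO])
  have in_N: "y \<in> N n" if "(x, y) \<in> H n" for x y n
    using arelD(2)[OF aH that] by (simp add: restrict_mod_simps)
  then have HN: "rcomp H (idr N) = H" by (rule rcomp_idr)
  note HX = roof_comp[OF NO' NO X H idr_roof_sp[OF X N], unfolded HN]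
  have "(idr N', H) \<in> roof_rel C ?N' X"
    using eq unfolding Cmp_serre[OF NO' NO X H idr_roof_sp[OF X N]] HN
    by (simp add: rcls_eq_iff[OF NO' X idr_roof_sp[OF X N'] HX])
  then obtain A B where ag: "agree ?N' X (idr N') H A B" by (rule roof_relE[OF NO' X])
  note a = agreeD[OF ag]
  have A: "submodule A X" "A \<le> N'" using a(1) by (auto simp: submodule_restrict[OF N'])
  have kA: "mkd X k A N'"
    using a(2) mkd_restrict[OF N' A(1) N' A(2) order_refl] by (simp add: restrict_mod_simps)
  define Z where "Z = inf (sub_sum B N) N'"
  have Z: "submodule Z X" unfolding Z_def by (intro submodule_inf submodule_sum[OF hX] a(5) N N')
  have NZ: "N \<le> Z" unfolding Z_def using J_ge2[OF a(5) N] le by simp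
  have "A \<le> Z"
  proof (intro le_funI subsetI)
    fix n x assume x: "x \<in> A n"
    then have xN': "x \<in> N' n" using A(2) by (auto simp: le_fun_def)
    obtain y where y: "(x, y) \<in> H n" using a(4) x by (fastforce simp: le_fun_def)
    then have "y \<in> N n" by (rule in_N)
    moreover have "x - y \<in> B n" using x xN' y by (intro a(7)[of x]) (auto simp: idr_def)
    moreover have "x = (x - y) + y" by simp
    ultimately have "x \<in> sub_sum B N n" unfolding sub_sum_def by blast
    then show "x \<in> Z n" unfolding Z_def using xN' by simp
  qed
  then have "mkd X k Z N'" by (rule kd_mono[OF kA _ order_refl])
  moreover have "mkd X k N Z"
    by (rule kd_mono[OF kd_sum_right[OF hX a(5,6) N] order_refl]) (simp add: Z_def)
  ultimately show ?thesis
    using kd_trans[OF N Z N' NZ] by (simp add: Z_def)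
qed

text \<open>The range of a roof depends, up to dimension \<open>k\<close>, only on its class: over
  the domain \<open>A\<close> of agreement the values of \<open>R\<close> lie in the range of
  \<open>S\<close> enlarged by the small error \<open>B\<close>.\<close>

lemma roof_rel_rran:
  assumes X: "X \<in> fgmods" and Y: "Y \<in> fgmods" and RS: "(R, S) \<in> roof_rel C Y X"
  shows "mkd X k (inf (rran R) (rran S)) (rran R)"
proof -
  note hX = ObD[OF X] and hY = ObD[OF Y]
  interpret modular_lattice "\<lambda>N. submodule N X" sub_sum by (rule submodule_lattice[OF hX])
  obtain A B where roofs: "R \<in> roofs C Y X" "S \<in> roofs C Y X" and ag: "agree Y X R S A B"
    using RS by (rule roof_relE[OF Y X])
  note a = agreeD[OF ag]
  have r: "arel Y X R" "arel Y X S" using roofs by (auto simp: roofs_iff[OF Y X])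
  note sub = submodule_rran[OF hY r(1)] submodule_rran[OF hY r(2)]
  define V where "V = rimg R A"
  have V: "submodule V X" unfolding V_def by (rule submodule_rimg[OF r(1) a(1)])
  have 1: "mkd X k V (rran R)"
    unfolding V_def rran_eq[OF r(1)]
    by (rule arel_kd[OF hY hX r(1) a(1) submodule_sp[OF hY] submoduleD(4)[OF a(1)] a(2)])
  have VR: "V \<le> rran R" by (auto simp: V_def rimg_def le_fun_def)
  have VS: "V \<le> sub_sum B (rran S)"
  proof (intro le_funI subsetI)
    fix n x assume "x \<in> V n"
    then obtain y where y: "y \<in> A n" "(y, x) \<in> R n" by (auto simp: V_def rimg_def)
    then obtain z where z: "(y, z) \<in> S n" using a(4) by (fastforce simp: le_fun_def)
    have "x - z \<in> B n" by (rule a(7)[OF y z])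
    moreover have "x = (x - z) + z" by simp
    ultimately show "x \<in> sub_sum B (rran S) n" unfolding sub_sum_def using z by blast
  qed
  have "mkd X k (rran S) (sub_sum V (rran S))"
    by (rule kd_mono[OF kd_sum_right[OF hX a(5,6) sub(2)] order_refl
      J_least[OF V sub(2) P_J[OF a(5) sub(2)] VS J_ge2[OF a(5) sub(2)]]])
  then have "mkd X k (inf V (rran S)) V" by (rule kd_join_imp_inf[OF V sub(2)])
  moreover have "mkd X k (inf (rran R) V) (rran R)" using 1 VR by (simp add: inf.absorb2)
  ultimately show ?thesis using kd_le_trans[OF sub(1) V sub(2)] by blast
qed

text \<open>In the quotient a monomorphism has a small kernel, which may be nonzero. Its inclusion
  and the zero map become equal after composition with \<open>R\<close>, hence are equal as classes,
  so the identity on a large part of the kernel takes values in a small submodule.\<close>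

lemma monic_kernel:
  assumes X: "X \<in> fgmods" and Y: "Y \<in> fgmods" and R: "R \<in> roofs C Y X"
    and mon: "monic SQ Y X (rcls Y X R)"
  shows "mkd Y k zero_sub (ramb (rconv R))"
proof -
  note hX = ObD[OF X] and hY = ObD[OF Y]
  have r: "arel Y X R" "mkd X k zero_sub (ramb R)" using R by (auto simp: roofs_iff[OF Y X])
  define K where "K = ramb (rconv R)"
  have K: "submodule K Y" unfolding K_def by (rule submodule_ramb[OF hX arel_rconv[OF r(1)]])
  have K_iff: "x \<in> K n \<longleftrightarrow> (x, 0) \<in> R n" for x n by (auto simp: K_def rconv_def)
  let ?K = "restrict_mod Y K"
  note KO = restrict_Ob[OF Y K]
  define O' where "O' n = K n \<times> {0 :: 'k poly}" for n
  have O: "O' \<in> roofs C ?K Y"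
    unfolding roofs_iff[OF KO Y]
  proof (intro conjI)
    show "arel ?K Y O'"
      by (rule arelI) (use submoduleE[OF K] submoduleD(3)[OF K] hmodule_0[OF hY]
        linear_map_0[OF hmoduleD(2)[OF hY] hmodule_0[OF hY]] in \<open>auto simp: O'_def restrict_mod_simps\<close>)
    have "rdom O' = K" "ramb O' = zero_sub" using submoduleE(1)[OF K] by (auto simp: O'_def)
    then show "mkd ?K k (rdom O') (sp ?K)" "mkd Y k zero_sub (ramb O')"
      by (simp_all add: restrict_mod_simps kd_refl)
  qed
  note I = idr_roof_sp[OF Y K]
  have roofs: "rcomp (idr K) R \<in> roofs C ?K X" "rcomp O' R \<in> roofs C ?K X"
    using roof_comp[OF KO Y X I R] roof_comp[OF KO Y X O R] by auto
  have "(rcomp (idr K) R, rcomp O' R) \<in> roof_rel C ?K X"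
  proof (rule roof_relI[OF KO X roofs])
    show "submodule K ?K" by (simp add: submodule_restrict[OF K] K)
    show "mkd ?K k K (sp ?K)" by (simp add: restrict_mod_simps kd_refl)
    show "K \<le> rdom (rcomp (idr K) R)" using K_iff by (fastforce simp: le_fun_def idr_def)
    show "K \<le> rdom (rcomp O' R)" using arelD(3)[OF r(1)] by (auto simp: le_fun_def O'_def)
    show "submodule (ramb R) X" by (rule submodule_ramb[OF hY r(1)])
    show "mkd X k zero_sub (ramb R)" by (rule r(2))
    fix n x y z assume "x \<in> K n" "(x, y) \<in> rcomp (idr K) R n" "(x, z) \<in> rcomp O' R n"
    then have "(x, 0) \<in> R n" "(x, y) \<in> R n" "(0, z) \<in> R n" by (auto simp: K_iff idr_def O'_def)
    then have "(0, y) \<in> R n" "(0, z) \<in> R n" using arel_diff[OF r(1), of x y n x 0] by auto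
    then show "y - z \<in> ramb R n" using arel_diff[OF r(1), of 0 y n 0 z] by auto
  qed
  then have "Cmp SQ ?K Y X (rcls Y X R) (rcls ?K Y (idr K)) =
    Cmp SQ ?K Y X (rcls Y X R) (rcls ?K Y O')"
    unfolding Cmp_serre[OF KO Y X I R] Cmp_serre[OF KO Y X O R] by (simp add: rcls_eq_iff[OF KO X roofs])
  then have "rcls ?K Y (idr K) = rcls ?K Y O'"
    using mon KO I O unfolding monic_def Mor_serre Ob_serre by blast
  then have "(idr K, O') \<in> roof_rel C ?K Y" by (simp add: rcls_eq_iff[OF KO Y I O])
  then obtain A B where ag: "agree ?K Y (idr K) O' A B" by (rule roof_relE[OF KO Y])
  note a = agreeD[OF ag]
  have A: "submodule A Y" "A \<le> K" using a(1) by (auto simp: submodule_restrict[OF K])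
  have "mkd ?K k A K" using a(2) by (simp add: restrict_mod_simps)
  then have 1: "mkd Y k A K" using mkd_restrict[OF K A(1) K A(2) order_refl] by simp
  have "A \<le> B"
  proof (intro le_funI subsetI)
    fix n x assume x: "x \<in> A n"
    then have "x \<in> K n" using A(2) by (auto simp: le_fun_def)
    then have "x - 0 \<in> B n" by (intro a(7)[OF x]) (auto simp: idr_def O'_def)
    then show "x \<in> B n" by simp
  qed
  then have 2: "mkd Y k zero_sub A" by (rule kd_mono[OF a(6) order_refl])
  interpret modular_lattice "\<lambda>N. submodule N Y" sub_sum by (rule submodule_lattice[OF hY])
  show ?thesis
    using kd_trans[OF submodule_zero[OF hY] A(1) K zero_sub_le[OF A(1)] A(2) 2 1] by (simp add: K_def)
qed

text \<open>The factorization is \<open>S\<close> followed by the converse of \<open>R\<close>. Its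
  domain is large since the range of \<open>S\<close> is almost contained in that of
  \<open>R\<close>, and its ambiguity is small since \<open>R\<close> is monic.\<close>

lemma sub_le_of_rran:
  assumes X: "X \<in> fgmods" and Y: "Y \<in> fgmods" and Z: "Z \<in> fgmods"
    and R: "R \<in> roofs C Y X" and S: "S \<in> roofs C Z X"
    and mon: "monic SQ Y X (rcls Y X R)"
    and k: "mkd X k (inf (rran S) (rran R)) (rran S)"
  shows "sub_le SQ X (Z, rcls Z X S) (Y, rcls Y X R)"
proof -
  note hX = ObD[OF X] and hY = ObD[OF Y] and hZ = ObD[OF Z]
  have r: "arel Y X R" "mkd X k zero_sub (ramb R)" using R by (auto simp: roofs_iff[OF Y X])
  have s: "arel Z X S" "mkd Z k (rdom S) (sp Z)" "mkd X k zero_sub (ramb S)" using S by (auto simp: roofs_iff[OF Z X])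
  interpret LZ: modular_lattice "\<lambda>N. submodule N Z" sub_sum by (rule submodule_lattice[OF hZ])
  interpret LY: modular_lattice "\<lambda>N. submodule N Y" sub_sum by (rule submodule_lattice[OF hY])
  define H where "H = rcomp S (rconv R)"
  have aH: "arel Z Y H" unfolding H_def by (rule arel_comp[OF s(1) arel_rconv[OF r(1)]])
  have subH: "submodule (rdom H) Z" "submodule (ramb H) Y"
    using submodule_rdom[OF hY aH] submodule_ramb[OF hZ aH] by auto
  let ?I = "inf (rran S) (rran R)"
  have I: "submodule ?I X" by (intro submodule_inf submodule_rran[OF hZ s(1)] submodule_rran[OF hY r(1)])
  have "mkd Z k (rimg (rconv S) ?I) (rimg (rconv S) (rran S))"
    by (rule arel_kd[OF hX hZ arel_rconv[OF s(1)] I submodule_rran[OF hZ s(1)] inf_le1 k])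
  moreover have "rimg (rconv S) ?I = rdom H"
    unfolding H_def by (fastforce simp: rimg_def rconv_def fun_eq_iff)
  moreover have "rimg (rconv S) (rran S) = rdom S"
    by (auto simp: rimg_def rconv_def fun_eq_iff)
  ultimately have "mkd Z k (rdom H) (rdom S)" by simp
  moreover have HS: "rdom H \<le> rdom S" by (auto simp: H_def le_fun_def)
  ultimately have domH: "mkd Z k (rdom H) (sp Z)"
    using LZ.kd_trans[OF subH(1) submodule_rdom[OF hX s(1)] submodule_sp[OF hZ] _
      submoduleD(4)[OF submodule_rdom[OF hX s(1)]] _ s(2)] by blast
  have "mkd Y k (rimg (rconv R) zero_sub) (rimg (rconv R) (ramb S))"
    by (rule arel_kd[OF hX hY arel_rconv[OF r(1)] submodule_zero[OF hX] submodule_ramb[OF hZ s(1)]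
      zero_sub_le[OF submodule_ramb[OF hZ s(1)]] s(3)])
  moreover have "rimg (rconv R) (ramb S) = ramb H"
    unfolding H_def by (fastforce simp: rimg_def rconv_def fun_eq_iff)
  ultimately have "mkd Y k (ramb (rconv R)) (ramb H)" by (simp add: ramb_eq[of "rconv R"])
  moreover have "ramb (rconv R) \<le> ramb H"
    using arelD(3)[OF s(1)] by (auto simp: H_def rconv_def le_fun_def)
  ultimately have ambH: "mkd Y k zero_sub (ramb H)"
    using LY.kd_trans[OF submodule_zero[OF hY] submodule_ramb[OF hX arel_rconv[OF r(1)]] subH(2)
      zero_sub_le[OF submodule_ramb[OF hX arel_rconv[OF r(1)]]] _ monic_kernel[OF X Y R mon]] by blast
  have H: "H \<in> roofs C Z Y" unfolding roofs_iff[OF Z Y] using aH domH ambH by blast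
  note HR = roof_comp[OF Z Y X H R]
  note sub = submodule_ramb[OF hY r(1)] submodule_ramb[OF hZ s(1)]
  have "(S, rcomp H R) \<in> roof_rel C Z X"
  proof (rule roof_relI[OF Z X S HR subH(1) domH HS _
      submodule_sum[OF hX sub] kd_sum_small[OF hX sub(1) r(2) sub(2) s(3)]])
    show "rdom H \<le> rdom (rcomp H R)" unfolding H_def rconv_def le_fun_def by blast
    fix n x z z' assume x: "(x, z) \<in> S n" "(x, z') \<in> rcomp H R n"
    then obtain u y where u: "(x, u) \<in> S n" "(y, u) \<in> R n" "(y, z') \<in> R n"
      by (auto simp: H_def rconv_def)
    have "u - z' \<in> ramb R n" using arel_diff[OF r(1) u(2,3)] by simp
    moreover have "z - u \<in> ramb S n" using arel_diff[OF s(1) x(1) u(1)] by simp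
    moreover have "z - z' = (u - z') + (z - u)" by simp
    ultimately show "z - z' \<in> sub_sum (ramb R) (ramb S) n" unfolding sub_sum_def by blast
  qed
  then have "rcls Z X S = Cmp SQ Z Y X (rcls Y X R) (rcls Z Y H)"
    unfolding Cmp_serre[OF Z Y X H R] by (simp add: rcls_eq_iff[OF Z X S HR])
  then show ?thesis unfolding sub_le_def prod.case Mor_serre using H by blast
qed

lemma finite_length_serre:
  assumes X: "X \<in> fgmods"
  shows "finite_length SQ X \<longleftrightarrow> mkd X (Suc k) zero_sub (sp X)"
proof
  note hX = ObD[OF X]
  assume fl: "finite_length SQ X"
  show "mkd X (Suc k) zero_sub (sp X)"
  proof (rule finite_length_imp_kd[OF hX fl, where s = "sub_ob X"])
    show "sub_ob X N \<in> subobjects SQ X"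
      if "submodule N X" for N
      unfolding subobjects_def Ob_serre using restrict_Ob[OF X that] monic_idr[OF X that] by simp
    show "sub_le SQ X (sub_ob X N) (sub_ob X N')"
      if "submodule N X" "submodule N' X" "N \<le> N'" for N N'
      by (rule sub_le_idr[OF X that])
    show "mkd X k N N'" if "submodule N X" "submodule N' X" "N \<le> N'"
      "sub_le SQ X (sub_ob X N') (sub_ob X N)" for N N'
      by (rule sub_le_idr_reverse[OF X that])
  qed
next
  note hX = ObD[OF X]
  assume kd: "mkd X (Suc k) zero_sub (sp X)"
  \<comment> \<open>A roof is chosen in each class, and its range is the submodule assigned to the
    subobject; by \<open>roof_rel_rran\<close> another choice would change it only up to dimension
    \<open>k\<close>.\<close>
  define rep where "rep s = (SOME R. R \<in> roofs C (fst s) X \<and> snd s = rcls (fst s) X R)" for s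
  have rep: "fst s \<in> fgmods" "rep s \<in> roofs C (fst s) X" "s = (fst s, rcls (fst s) X (rep s))"
    "monic SQ (fst s) X (rcls (fst s) X (rep s))"
    if s: "s \<in> subobjects SQ X" for s
  proof -
    have m: "fst s \<in> fgmods" "monic SQ (fst s) X (snd s)"
      using s by (auto simp: subobjects_def Ob_serre)
    then have "\<exists>R. R \<in> roofs C (fst s) X \<and> snd s = rcls (fst s) X R"
      unfolding monic_def Mor_serre by blast
    then have R: "rep s \<in> roofs C (fst s) X \<and> snd s = rcls (fst s) X (rep s)"
      unfolding rep_def by (rule someI_ex)
    then show "fst s \<in> fgmods" "rep s \<in> roofs C (fst s) X" "s = (fst s, rcls (fst s) X (rep s))"
      "monic SQ (fst s) X (rcls (fst s) X (rep s))"
      using m by (auto simp: prod_eq_iff)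
  qed
  have arel: "arel (fst s) X (rep s)" if "s \<in> subobjects SQ X" for s
    using rep(2)[OF that] by (auto simp: roofs_iff[OF rep(1)[OF that] X])
  show "finite_length SQ X"
  proof (rule kd_imp_finite_length[OF hX kd, where I = "\<lambda>s. rran (rep s)"])
    fix s assume s: "s \<in> subobjects SQ X"
    show "submodule (rran (rep s)) X" by (rule submodule_rran[OF ObD[OF rep(1)[OF s]] arel[OF s]])
    fix t assume t: "t \<in> subobjects SQ X"
    note s' = rep[OF s] and t' = rep[OF t]
    show "sub_le SQ X t s" if "mkd X k (inf (rran (rep t)) (rran (rep s))) (rran (rep t))"
      using sub_le_of_rran[OF X s'(1) t'(1) s'(2) t'(2) s'(4) that]
      unfolding s'(3)[symmetric] t'(3)[symmetric] .
    show "mkd X k (inf (rran (rep s)) (rran (rep t))) (rran (rep s))"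
      if le: "sub_le SQ X s t"
    proof -
      have "sub_le SQ X (fst s, rcls (fst s) X (rep s)) (fst t, rcls (fst t) X (rep t))"
        using le unfolding s'(3)[symmetric] t'(3)[symmetric] .
      then obtain H where H: "H \<in> roofs C (fst s) (fst t)" and
        eq: "rcls (fst s) X (rep s) = Cmp SQ (fst s) (fst t) X (rcls (fst t) X (rep t)) (rcls (fst s) (fst t) H)"
        unfolding sub_le_def prod.case Mor_serre by blast
      have "(rep s, rcomp H (rep t)) \<in> roof_rel C (fst s) X"
        using eq unfolding Cmp_serre[OF s'(1) t'(1) X H t'(2)]
        by (simp add: rcls_eq_iff[OF s'(1) X s'(2) roof_comp[OF s'(1) t'(1) X H t'(2)]])
      then have "mkd X k (inf (rran (rep s)) (rran (rcomp H (rep t)))) (rran (rep s))"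
        by (rule roof_rel_rran[OF X s'(1)])
      moreover have "inf (rran (rep s)) (rran (rcomp H (rep t))) \<le> inf (rran (rep s)) (rran (rep t))"
        by (rule inf_mono) (auto simp: le_fun_def)
      ultimately show ?thesis by (rule kd_mono) simp
    qed
  qed
qed

end

text \<open>The index starts at one because \<open>mkd\<close> at \<open>0\<close> describes trivial
  intervals; each passage to a Serre quotient adds one.\<close>

theorem gk_filtration_aux_eq:
  "(gk_filtration_aux d :: 'k::field hmod set) = {X \<in> fgmods. mkd X (Suc d) zero_sub (sp X)}"
proof (induction d)
  case 0
  then show ?case using finite_length_fgmod by auto
next
  case (Suc d)
  interpret serre_class "gk_filtration_aux d :: 'k hmod set" "Suc d" by unfold_locales (rule Suc)
  show ?case using finite_length_serre by auto
qed

section \<open>A module of large dimension\<close>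

text \<open>Polynomials serve as the free vector space on the natural numbers, with basis vectors
  \<open>monom 1 j\<close>, and \<open>lin h\<close> is the linear extension of
  \<open>h\<close>.\<close>

definition lin :: "(nat \<Rightarrow> nat) \<Rightarrow> 'k::field poly \<Rightarrow> 'k poly" where
  "lin h p = (\<Sum>j\<le>degree p. monom (coeff p j) (h j))"

lemma lin_eq: "degree p \<le> K \<Longrightarrow> lin h p = (\<Sum>j\<le>K. monom (coeff p j) (h j))"
  unfolding lin_def by (rule sum.mono_neutral_left) (auto simp: coeff_eq_0)

lemma lin_add: "lin h (p + q) = lin h p + lin h q"
proof -
  let ?K = "max (degree p) (degree q)"
  have "lin h (p + q) = (\<Sum>j\<le>?K. monom (coeff (p + q) j) (h j))"
    by (rule lin_eq) (rule degree_add_le_max)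
  then show ?thesis by (simp add: lin_eq[of p ?K] lin_eq[of q ?K] sum.distrib flip: add_monom)
qed

lemma lin_smult: "lin h (smult c p) = smult c (lin h p)"
proof -
  have "lin h (smult c p) = (\<Sum>j\<le>degree p. smult c (monom (coeff p j) (h j)))"
    by (simp add: lin_eq[OF degree_smult_le] smult_monom)
  also have "\<dots> = smult c (lin h p)"
    unfolding lin_def by (rule poly_vs.scale_sum_right[symmetric])
  finally show ?thesis .
qed

lemma lin_0 [simp]: "lin h 0 = 0"
  by (simp add: lin_def)

lemma lin_sum: "lin h (\<Sum>i\<in>A. f i) = (\<Sum>i\<in>A. lin h (f i))"
  by (induction A rule: infinite_finite_induct) (auto simp: lin_add)

lemma lin_monom: "lin h (monom c j) = monom c (h j)"
proof -
  have "lin h (monom c j) = (\<Sum>i\<le>j. monom (coeff (monom c j) i) (h i))"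
    by (rule lin_eq) (rule degree_monom_le)
  also have "\<dots> = (\<Sum>i\<in>{j}. monom (coeff (monom c j) i) (h i))"
    by (rule sum.mono_neutral_right) auto
  finally show ?thesis by simp
qed

lemma lin_lin: "lin h (lin h' p) = lin (\<lambda>j. h (h' j)) p"
  by (simp add: lin_def[of h'] lin_def[of "\<lambda>j. h (h' j)"] lin_sum lin_monom)

lemma lin_cong: "(\<And>j. coeff p j \<noteq> 0 \<Longrightarrow> h j = h' j) \<Longrightarrow> lin h p = lin h' p"
  unfolding lin_def by (rule sum.cong, simp, metis monom_eq_0)

lemma lin_id: "lin (\<lambda>j. j) p = p"
  by (simp add: lin_def poly_as_sum_of_monoms)

definition mspan :: "nat set \<Rightarrow> 'k::field poly set" where
  "mspan A = {p. \<forall>j. coeff p j \<noteq> 0 \<longrightarrow> j \<in> A}"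

lemma monom_mspan: "monom (1 :: 'k::field) j \<in> mspan A \<longleftrightarrow> j \<in> A"
  by (auto simp: mspan_def)

lemma subspace_mspan: "subspace (mspan A)"
  unfolding subspace_iff mspan_def by (auto, metis add.left_neutral)

lemma mspan_subset:
  fixes V :: "'k::field poly set"
  assumes V: "subspace V" and mon: "\<And>j. j \<in> A \<Longrightarrow> monom 1 j \<in> V"
  shows "mspan A \<subseteq> V"
proof
  fix p :: "'k poly" assume p: "p \<in> mspan A"
  have "(\<Sum>j\<le>degree p. monom (coeff p j) j) \<in> V"
  proof (rule poly_vs.subspace_sum[OF V])
    fix j
    have "smult (coeff p j) (monom 1 j) \<in> V"
      using p mon[of j] poly_vs.subspace_scale[OF V, of "monom 1 j" "coeff p j"] poly_vs.subspace_0[OF V]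
      by (cases "coeff p j = 0") (auto simp: mspan_def)
    then show "monom (coeff p j) j \<in> V" by (simp add: smult_monom)
  qed
  then show "p \<in> V" by (simp add: poly_as_sum_of_monoms)
qed

lemma lin_mspan:
  assumes "h ` A \<subseteq> B" "p \<in> mspan A"
  shows "lin h p \<in> mspan B"
proof -
  have "mspan A \<subseteq> {p. lin h p \<in> mspan B}"
    by (rule mspan_subset)
      (use assms(1) subspace_mspan[of B] in \<open>auto simp: subspace_iff lin_add lin_smult lin_monom monom_mspan\<close>)
  then show ?thesis using assms(2) by blast
qed

text \<open>The set-valued functor behind the lower bound sends \<open>[m]\<close> to the \<open>D\<close>-tuples of numbers in \<open>1, \<dots>, m\<close>;
  the generator \<open>\<pi>\<^sub>i\<close> replaces all entries \<open>i\<close> by \<open>i + 1\<close>, and the dummy strands do nothing.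
  \<open>tuple_mod D\<close> is the submodule of its linearization generated by \<open>(1, \<dots>, D)\<close>, where the basis
  vector of a tuple \<open>t\<close> is the monomial of degree \<open>list_encode t\<close>.\<close>

definition raise :: "nat \<Rightarrow> nat \<Rightarrow> nat" where
  "raise i x = (if x = i then Suc i else x)"

definition wraise :: "nat list \<Rightarrow> nat \<Rightarrow> nat" where
  "wraise w x = foldr raise w x"

lemma wraise_simps [simp]:
  "wraise [] x = x" "wraise (i # w) x = raise i (wraise w x)" "wraise (u @ v) x = wraise u (wraise v x)"
  by (simp_all add: wraise_def)

lemma wraise_ge: "x \<le> wraise w x"
  by (induction w) (auto simp: raise_def)

lemma wraise_le: "w \<in> words m \<Longrightarrow> x \<le> m \<Longrightarrow> wraise w x \<le> m"
  by (induction w) (auto simp: raise_def)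

text \<open>For the braid relation, both sides send \<open>i\<close> and \<open>i + 1\<close> to
  \<open>i + 2\<close>.\<close>

lemma hecke_step_wraise: "hecke_step n u v \<Longrightarrow> wraise u = wraise v"
  by (induction rule: hecke_step.induct) (auto simp: fun_eq_iff raise_def)

lemma heq_wraise: "heq n u v \<Longrightarrow> wraise u = wraise v"
  unfolding heq_def using equivclp_invariant[of "hecke_step n" u v wraise] hecke_step_wraise by blast

definition hraise :: "hmon \<Rightarrow> nat \<Rightarrow> nat" where
  "hraise y = wraise (SOME w. w \<in> y)"

lemma hraise_hcls:
  assumes w: "w \<in> words m"
  shows "hraise (hcls m w) = wraise w"
proof -
  have "w \<in> hcls m w" using w by (simp add: hcls_eq)
  then have "(SOME w'. w' \<in> hcls m w) \<in> hcls m w" by (rule someI)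
  moreover have "wraise v = wraise w" if "v \<in> hcls m w" for v
    using that heq_wraise[of m w v] by (simp add: hcls_eq[OF w])
  ultimately show ?thesis unfolding hraise_def by blast
qed

definition mraise :: "hmor \<Rightarrow> nat \<Rightarrow> nat" where
  "mraise \<phi> = hraise (SOME y. y \<in> \<phi>)"

text \<open>Dummy letters stand on the right, so they are applied first, and they exceed
  \<open>n\<close>, so they fix positions up to \<open>n\<close>. On larger positions the value may
  depend on the representative.\<close>

lemma mraise_cls:
  assumes w: "w \<in> words m" and x: "x \<le> n"
  shows "mraise (cls n m w) x = wraise w x"
proof -
  have "hcls m w \<in> cls n m w" using w by (auto simp: cls_def dummy_rel_def hmonoid_eq)
  then have "(SOME y. y \<in> cls n m w) \<in> cls n m w" by (rule someI)
  then have "equivclp (dummy_step n m) (hcls m w) (SOME y. y \<in> cls n m w)"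
    by (auto simp: cls_def dummy_rel_def)
  then have "hraise (hcls m w) x = hraise (SOME y. y \<in> cls n m w) x"
  proof (rule equivclp_invariant[where f = "\<lambda>y. hraise y x"])
    fix a b assume "dummy_step n m a b"
    then obtain v j where v: "v \<in> words m" "n + 1 \<le> j" "j < m" "a = hcls m v" "b = hcls m (v @ [j])"
      by (rule dummy_stepE)
    then have "v @ [j] \<in> words m" by simp
    then show "hraise a x = hraise b x" using v x by (simp add: hraise_hcls raise_def)
  qed
  then show ?thesis using w by (simp add: mraise_def hraise_hcls)
qed

text \<open>Starting from a single tuple makes the module cyclic; \<open>orbit_positions\<close>
  shows that the orbit still contains all increasing tuples that fit.\<close>

definition orbit :: "nat \<Rightarrow> nat \<Rightarrow> nat list set" where
  "orbit D m = (if D \<le> m then (\<lambda>w. map (wraise w) [1..<Suc D]) ` words m else {})"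

lemma orbit_step:
  assumes "t \<in> orbit D n" "n \<le> m" "v \<in> words m"
  shows "map (wraise v) t \<in> orbit D m"
proof -
  obtain w where w: "D \<le> n" "w \<in> words n" "t = map (wraise w) [1..<Suc D]"
    using assms(1) by (auto simp: orbit_def split: if_splits)
  have vw: "v @ w \<in> words m" using w(2) assms(2,3) words_mono[of w n m] by simp
  have "D \<le> m" using w(1) assms(2) by simp
  then have "map (wraise (v @ w)) [1..<Suc D] \<in> orbit D m"
    by (simp only: orbit_def if_True) (rule imageI[OF vw])
  moreover have "map (wraise v) t = map (wraise (v @ w)) [1..<Suc D]" by (simp add: w(3))
  ultimately show ?thesis by simp
qed

lemma orbit_bounds:
  assumes "t \<in> orbit D m" "x \<in> set t"
  shows "x \<le> m"
proof -
  obtain w y where "w \<in> words m" "x = wraise w y" "y \<le> D" "D \<le> m"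
    using assms by (auto simp: orbit_def split: if_splits)
  then show ?thesis using wraise_le[of w m y] by simp
qed

definition tuple_mod :: "nat \<Rightarrow> 'k::field hmod" where
  "tuple_mod D = \<lparr>sp = \<lambda>n. mspan (list_encode ` orbit D n),
     act = \<lambda>n m \<phi>. lin (\<lambda>j. list_encode (map (mraise \<phi>) (list_decode j)))\<rparr>"

definition tuple_sub :: "(nat \<Rightarrow> nat list set) \<Rightarrow> 'k::field fam" where
  "tuple_sub T n = mspan (list_encode ` T n)"

lemma sp_tuple_mod: "sp (tuple_mod D) = tuple_sub (orbit D)"
  by (simp add: tuple_mod_def tuple_sub_def fun_eq_iff)

lemma act_tuple_mod:
  assumes "w \<in> words m" "p \<in> tuple_sub (orbit D) n"
  shows "act (tuple_mod D) n m (cls n m w) p = lin (\<lambda>j. list_encode (map (wraise w) (list_decode j))) p"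
  unfolding tuple_mod_def hmod.simps
proof (rule lin_cong)
  fix j assume "coeff p j \<noteq> 0"
  then obtain t where t: "t \<in> orbit D n" "j = list_encode t"
    using assms(2) by (auto simp: tuple_sub_def mspan_def)
  have "map (mraise (cls n m w)) t = map (wraise w) t"
    using orbit_bounds[OF t(1)] mraise_cls[OF assms(1)] by (intro map_cong) auto
  then show "list_encode (map (mraise (cls n m w)) (list_decode j)) = list_encode (map (wraise w) (list_decode j))"
    by (simp only: t(2) list_encode_inverse)
qed

lemma lin_tuple_sub:
  assumes "p \<in> tuple_sub T n" "\<And>t. t \<in> T n \<Longrightarrow> map (wraise w) t \<in> T' m"
  shows "lin (\<lambda>j. list_encode (map (wraise w) (list_decode j))) p \<in> tuple_sub T' m"
  using assms(1) unfolding tuple_sub_def by (rule lin_mspan[rotated]) (use assms(2) in auto)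

lemma tuple_sub_mono: "(\<And>n t. t \<in> T n \<Longrightarrow> t \<in> T' n) \<Longrightarrow> tuple_sub T \<le> tuple_sub T'"
  by (fastforce simp: le_fun_def tuple_sub_def mspan_def)

lemma subspace_tuple_sub: "subspace (tuple_sub T n)"
  unfolding tuple_sub_def by (rule subspace_mspan)

lemma monom_tuple_sub: "monom (1 :: 'k::field) (list_encode t) \<in> tuple_sub T n \<longleftrightarrow> t \<in> T n"
  unfolding tuple_sub_def monom_mspan by (auto dest: list_encode_eq[THEN iffD1])

lemma submodule_tuple_sub:
  assumes "\<And>n t. t \<in> T n \<Longrightarrow> t \<in> orbit D n"
    and "\<And>n m t w. t \<in> T n \<Longrightarrow> n \<le> m \<Longrightarrow> w \<in> words m \<Longrightarrow> map (wraise w) t \<in> T m"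
  shows "submodule (tuple_sub T) (tuple_mod D :: 'k::field hmod)"
proof (rule submoduleI)
  have le: "p \<in> tuple_sub (orbit D) n" if "p \<in> tuple_sub T n" for p :: "'k poly" and n
    using that tuple_sub_mono[of T "orbit D"] assms(1) by (auto simp: le_fun_def)
  then show "p \<in> sp (tuple_mod D) n" if "p \<in> tuple_sub T n" for p :: "'k poly" and n
    using that by (simp add: sp_tuple_mod)
  fix n m \<phi> and p :: "'k poly" assume \<phi>: "\<phi> \<in> Mor hecke_cat n m" and p: "p \<in> tuple_sub T n"
  obtain w where w: "n \<le> m" "w \<in> words m" "\<phi> = cls n m w" using Mor_cases[OF \<phi>] .
  show "act (tuple_mod D) n m \<phi> p \<in> tuple_sub T m"
    unfolding w(3) act_tuple_mod[OF w(2) le[OF p]]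
    by (rule lin_tuple_sub[OF p]) (use assms(2) w in auto)
qed (auto intro: poly_vs.subspace_0[OF subspace_tuple_sub] poly_vs.subspace_add[OF subspace_tuple_sub]
    poly_vs.subspace_scale[OF subspace_tuple_sub])

lemma hmodule_tuple_mod: "hmodule (tuple_mod D :: 'k::field hmod)"
  unfolding hmodule_def sp_tuple_mod
proof (intro conjI allI ballI)
  show "subspace (tuple_sub (orbit D) n)" for n by (rule subspace_tuple_sub)
  have lin_orbit: "lin (\<lambda>j. list_encode (map (wraise w) (list_decode j))) p \<in> tuple_sub (orbit D) m"
    if "p \<in> tuple_sub (orbit D) n" "n \<le> m" "w \<in> words m" for n m w and p :: "'k poly"
    by (rule lin_tuple_sub[OF that(1)]) (rule orbit_step[OF _ that(2,3)])
  show "linear_map (tuple_sub (orbit D) n) (tuple_sub (orbit D) m) (act (tuple_mod D :: 'k hmod) n m \<phi>)"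
    if \<phi>: "\<phi> \<in> Mor hecke_cat n m" for n m \<phi>
  proof -
    obtain w where w: "n \<le> m" "w \<in> words m" "\<phi> = cls n m w" using Mor_cases[OF \<phi>] .
    have "act (tuple_mod D) n m \<phi> p \<in> tuple_sub (orbit D) m" if "p \<in> tuple_sub (orbit D) n" for p :: "'k poly"
      unfolding w(3) act_tuple_mod[OF w(2) that] by (rule lin_orbit[OF that w(1,2)])
    moreover have "act (tuple_mod D) n m \<phi> (p + q) = act (tuple_mod D) n m \<phi> p + act (tuple_mod D) n m \<phi> q"
      "act (tuple_mod D) n m \<phi> (smult c p) = smult c (act (tuple_mod D) n m \<phi> p)" for p q :: "'k poly" and c
      by (simp_all add: tuple_mod_def lin_add lin_smult)
    ultimately show ?thesis unfolding linear_map_def by blast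
  qed
  show "act (tuple_mod D) n n (Idn hecke_cat n) p = p" if "p \<in> tuple_sub (orbit D) n" for n and p :: "'k poly"
    unfolding Idn_eq act_tuple_mod[OF words_Nil that] by (simp add: lin_id map_idI)
  show "act (tuple_mod D) n l (Cmp hecke_cat n m l \<psi> \<phi>) p = act (tuple_mod D) m l \<psi> (act (tuple_mod D) n m \<phi> p)"
    if \<phi>: "\<phi> \<in> Mor hecke_cat n m" and \<psi>: "\<psi> \<in> Mor hecke_cat m l" and p: "p \<in> tuple_sub (orbit D) n"
    for n m l \<phi> \<psi> and p :: "'k poly"
  proof -
    obtain u where u: "n \<le> m" "u \<in> words m" "\<phi> = cls n m u" using Mor_cases[OF \<phi>] .
    obtain v where v: "m \<le> l" "v \<in> words l" "\<psi> = cls m l v" using Mor_cases[OF \<psi>] .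
    have "v @ u \<in> words l" using u v words_mono[of u m l] by simp
    moreover have "map (wraise (v @ u)) t = map (wraise v) (map (wraise u) t)" for t by simp
    ultimately show ?thesis
      using u v by (simp only: Cmp_cls act_tuple_mod[OF _ p] act_tuple_mod[OF v(2) lin_orbit[OF p u(1,2)]]
        lin_lin list_encode_inverse)
  qed
qed

lemma fin_gen_tuple_mod: "fin_gen (tuple_mod D :: 'k::field hmod)"
  unfolding fin_gen_def
proof (intro exI[of _ "{(D, monom 1 (list_encode [1..<Suc D]))}"] conjI allI impI)
  let ?g = "monom (1 :: 'k) (list_encode [1..<Suc D])"
  have g: "[1..<Suc D] \<in> orbit D D" unfolding orbit_def by (auto simp: map_idI intro!: image_eqI[of _ _ "[]"] simp del: upt_Suc)
  then show "{(D, ?g)} \<subseteq> (SIGMA n:UNIV. sp (tuple_mod D) n)" by (simp add: sp_tuple_mod monom_tuple_sub del: upt_Suc)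
  fix N assume "submodule N (tuple_mod D :: 'k hmod) \<and> (\<forall>(n, x)\<in>{(D, ?g)}. x \<in> N n)"
  then have N: "submodule N (tuple_mod D)" and gN: "?g \<in> N D" by auto
  have "sp (tuple_mod D) m \<subseteq> N m" for m
    unfolding sp_tuple_mod tuple_sub_def
  proof (rule mspan_subset[OF submoduleD(1)[OF N]])
    fix j assume "j \<in> list_encode ` orbit D m"
    then obtain w where w: "D \<le> m" "w \<in> words m" "j = list_encode (map (wraise w) [1..<Suc D])"
      by (auto simp: orbit_def split: if_splits)
    have "act (tuple_mod D) D m (cls D m w) ?g \<in> N m"
      by (rule submoduleD(3)[OF N cls_Mor[OF w(1,2)] gN])
    moreover have "act (tuple_mod D) D m (cls D m w) ?g = monom 1 j"
      using g by (subst act_tuple_mod[OF w(2)]) (simp_all add: monom_tuple_sub lin_monom w(3) del: upt_Suc)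
    ultimately show "monom 1 j \<in> N m" by (simp del: upt_Suc)
  qed
  then show "N = sp (tuple_mod D)" using submoduleD(2)[OF N] by (auto simp: fun_eq_iff)
qed simp

text \<open>A word carrying \<open>(a, a + 1, \<dots>)\<close> to an increasing tuple. The rightmost
  letters act first, so later coordinates climb before earlier ones and no two of them meet.\<close>

primrec climb :: "nat \<Rightarrow> nat list \<Rightarrow> nat list" where
  "climb a [] = []"
| "climb a (x # t) = rev [a..<x] @ climb (Suc a) t"

lemma wraise_rev_upt: "a \<le> x \<Longrightarrow> wraise (rev [a..<x]) a = x"
  by (induction x rule: dec_induct) (auto simp: raise_def)

lemma wraise_fix: "(\<And>i. i \<in> set w \<Longrightarrow> i \<noteq> y) \<Longrightarrow> wraise w y = y"
  by (induction w) (auto simp: raise_def)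

lemma climb_ge: "i \<in> set (climb a t) \<Longrightarrow> a \<le> i"
  by (induction t arbitrary: a) (auto dest: Suc_leD)

lemma climb_words: "1 \<le> a \<Longrightarrow> (\<And>x. x \<in> set t \<Longrightarrow> x \<le> m) \<Longrightarrow> climb a t \<in> words m"
proof (induction t arbitrary: a)
  case (Cons x t)
  have "x \<le> m" using Cons.prems by simp
  then have "rev [a..<x] \<in> words m" using Cons.prems(1) by (auto simp: words_def)
  then show ?case using Cons by simp
qed simp

lemma wraise_climb:
  "sorted_wrt (<) t \<Longrightarrow> (\<And>x. x \<in> set t \<Longrightarrow> a \<le> x) \<Longrightarrow> map (wraise (climb a t)) [a..<a + length t] = t"
proof (induction t arbitrary: a)
  case (Cons x t)
  have ax: "a \<le> x" using Cons.prems by simp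
  have "y > x" if "y \<in> set t" for y using Cons.prems(1) that by simp
  then have IH: "map (wraise (climb (Suc a) t)) [Suc a..<Suc a + length t] = t"
    using Cons.prems ax by (intro Cons.IH) fastforce+
  have "wraise (climb (Suc a) t) a = a" using climb_ge[of _ "Suc a" t] by (intro wraise_fix) fastforce
  moreover have "map (wraise (rev [a..<x])) t = t"
    using \<open>\<And>y. y \<in> set t \<Longrightarrow> y > x\<close> by (intro map_idI wraise_fix) fastforce
  moreover have "map (wraise (climb a (x # t))) [Suc a..<Suc a + length t] =
    map (wraise (rev [a..<x])) (map (wraise (climb (Suc a) t)) [Suc a..<Suc a + length t])" by simp
  ultimately have step: "map (wraise (climb a (x # t))) (a # [Suc a..<Suc a + length t]) = x # t"
    using wraise_rev_upt[OF ax] unfolding IH by simp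
  have "[a..<a + length (x # t)] = a # [Suc a..<Suc a + length t]"
    by (simp add: upt_conv_Cons del: upt_Suc)
  then show ?case using step by (simp only:)
qed simp

definition positions :: "nat list \<Rightarrow> bool" where
  "positions t \<longleftrightarrow> sorted_wrt (<) t \<and> (\<forall>x\<in>set t. 1 \<le> x)"

lemma orbit_positions:
  assumes "positions t" "length t = D" "D \<le> m" "\<And>x. x \<in> set t \<Longrightarrow> x \<le> m"
  shows "t \<in> orbit D m"
  using wraise_climb[of t 1] climb_words[of 1 t m] assms unfolding orbit_def positions_def
  by (auto intro!: image_eqI[of _ _ "climb 1 t"] simp del: upt_Suc)

text \<open>Only the first \<open>length t\<close> coordinates of \<open>u\<close> are compared with
  \<open>t\<close>, so that \<open>t\<close> can prescribe an initial segment.\<close>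

primrec lex_ge :: "nat list \<Rightarrow> nat list \<Rightarrow> bool" where
  "lex_ge [] u \<longleftrightarrow> True"
| "lex_ge (a # t) u \<longleftrightarrow> (case u of [] \<Rightarrow> False | b # u' \<Rightarrow> a < b \<or> a = b \<and> lex_ge t u')"

primrec lex_gt :: "nat list \<Rightarrow> nat list \<Rightarrow> bool" where
  "lex_gt [] u \<longleftrightarrow> False"
| "lex_gt (a # t) u \<longleftrightarrow> (case u of [] \<Rightarrow> False | b # u' \<Rightarrow> a < b \<or> a = b \<and> lex_gt t u')"

lemma lex_ge_raise: "(\<And>x. x \<le> f x) \<Longrightarrow> lex_ge t u \<Longrightarrow> lex_ge t (map f u)"
proof (induction t arbitrary: u)
  case (Cons a t)
  show ?case
  proof (cases u)
    case (Cons b u')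
    have "b \<le> f b" by (rule Cons.prems(1))
    then show ?thesis using Cons Cons.IH[OF Cons.prems(1), of u'] Cons.prems(2) by auto
  qed (use Cons.prems in simp)
qed simp

lemma lex_gt_raise: "(\<And>x. x \<le> f x) \<Longrightarrow> lex_gt t u \<Longrightarrow> lex_gt t (map f u)"
proof (induction t arbitrary: u)
  case (Cons a t)
  show ?case
  proof (cases u)
    case (Cons b u')
    have "b \<le> f b" by (rule Cons.prems(1))
    then show ?thesis using Cons Cons.IH[OF Cons.prems(1), of u'] Cons.prems(2) by auto
  qed (use Cons.prems in simp)
qed simp

lemma lex_refl: "lex_ge t t" "\<not> lex_gt t t"
  by (induction t) auto

lemma lex_gt_imp_ge_snoc: "lex_gt t u \<Longrightarrow> lex_ge (t @ [a]) u"
  by (induction t arbitrary: u) (auto split: list.splits)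

lemma lex_ge_snoc_imp_ge: "lex_ge (t @ [a]) u \<Longrightarrow> lex_ge t u"
  by (induction t arbitrary: u) (auto split: list.splits)

lemma lex_ge_snoc_imp_gt: "a < b \<Longrightarrow> lex_ge (t @ [b]) u \<Longrightarrow> lex_gt (t @ [a]) u"
  by (induction t arbitrary: u) (auto split: list.splits)

lemma lex_gt_imp_ge: "lex_gt t u \<Longrightarrow> lex_ge t u"
  by (induction t arbitrary: u) (auto split: list.splits)

text \<open>The tuples in \<open>Fge D t\<close> but not in \<open>Fgt D t\<close> are those that
  begin with \<open>t\<close>: between the two submodules lies the layer in which these coordinates
  are fixed.\<close>

definition Fge :: "nat \<Rightarrow> nat list \<Rightarrow> nat \<Rightarrow> nat list set" where
  "Fge D t n = {u \<in> orbit D n. lex_ge t u}"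

definition Fgt :: "nat \<Rightarrow> nat list \<Rightarrow> nat \<Rightarrow> nat list set" where
  "Fgt D t n = {u \<in> orbit D n. lex_gt t u}"

lemma submodule_Fge: "submodule (tuple_sub (Fge D t)) (tuple_mod D)"
  by (rule submodule_tuple_sub) (auto simp: Fge_def orbit_step lex_ge_raise wraise_ge)

lemma positions_snoc:
  assumes "positions t" "sum_list t < a"
  shows "positions (t @ [a])"
  using assms member_le_sum_list[of _ t] by (fastforce simp: positions_def sorted_wrt_append)

text \<open>Induction on the number of coordinates not yet fixed by \<open>t\<close>: fixing the next coordinate to be
  \<open>a\<close> gives, as \<open>a\<close> grows, an infinite strictly decreasing chain of submodules.\<close>

lemma not_kd_tuple:
  assumes "positions t" "length t + r = D"
  shows "\<not> mkd (tuple_mod D :: 'k::field hmod) (Suc r) (tuple_sub (Fgt D t)) (tuple_sub (Fge D t))"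
  using assms
proof (induction r arbitrary: t)
  case 0
  let ?M = "tuple_mod D :: 'k hmod" and ?S = "tuple_sub :: _ \<Rightarrow> 'k fam"
  \<comment> \<open>All coordinates are fixed, so the layer has at most one basis vector in each
    degree. Keeping it only in degrees from \<open>c\<close> on gives the chain.\<close>
  define T where "T c n = (if c \<le> n then Fge D t n else Fgt D t n)" for c n
  have T: "submodule (?S (T c)) ?M" for c
    by (rule submodule_tuple_sub)
      (auto simp: T_def Fge_def Fgt_def orbit_step lex_ge_raise lex_gt_raise wraise_ge lex_gt_imp_ge split: if_splits)
  show ?case
  proof
    assume "mkd ?M (Suc 0) (?S (Fgt D t)) (?S (Fge D t))"
    then obtain L where L: "\<forall>I x. nonrel_chain (\<lambda>N. submodule N ?M) (mkd ?M 0) (?S (Fgt D t))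
      (?S (Fge D t)) I x \<longrightarrow> card I \<le> L" by (rule kd_SucE)
    \<comment> \<open>The index \<open>i\<close> is subtracted to make the chain increase;
      \<open>D\<close> and \<open>sum_list t\<close> are added so that \<open>t\<close> occurs in
      degree \<open>c j\<close>.\<close>
    define c where "c i = D + sum_list t + (L - i)" for i
    have "card {..<Suc L} \<le> L"
    proof (rule chain_card_le[OF L, where x = "\<lambda>i. ?S (T (c i))"])
      show "\<forall>i\<in>{..<Suc L}. submodule (?S (T (c i))) ?M \<and> ?S (Fgt D t) \<le> ?S (T (c i)) \<and>
        ?S (T (c i)) \<le> ?S (Fge D t)"
        using T by (auto intro!: tuple_sub_mono simp: T_def Fge_def Fgt_def lex_gt_imp_ge split: if_splits)
      show "\<forall>i\<in>{..<Suc L}. \<forall>j\<in>{..<Suc L}. i < j \<longrightarrow> ?S (T (c i)) \<le> ?S (T (c j)) \<and>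
        \<not> mkd ?M 0 (?S (T (c i))) (?S (T (c j)))"
      proof (intro ballI impI conjI notI)
        fix i j assume "i \<in> {..<Suc L}" "j \<in> {..<Suc L}" "i < j"
        then have less: "c j < c i" by (simp add: c_def)
        then show "?S (T (c i)) \<le> ?S (T (c j))"
          by (intro tuple_sub_mono) (auto simp: T_def Fge_def Fgt_def lex_gt_imp_ge split: if_splits)
        assume "mkd ?M 0 (?S (T (c i))) (?S (T (c j)))"
        then have le: "?S (T (c j)) \<le> ?S (T (c i))" by simp
        have "t \<in> orbit D (c j)"
          using 0 member_le_sum_list[of _ t] by (intro orbit_positions) (auto simp: c_def trans_le_add1 trans_le_add2)
        then have "t \<in> T (c j) (c j)" by (simp add: T_def Fge_def lex_refl)
        then have "monom (1 :: 'k) (list_encode t) \<in> ?S (T (c i)) (c j)"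
          using le monom_tuple_sub[of t "T (c j)" "c j"] by (auto simp: le_fun_def)
        then have "t \<in> T (c i) (c j)" by (simp add: monom_tuple_sub)
        then show False using less by (simp add: T_def Fgt_def lex_refl)
      qed
    qed simp
    then show False by simp
  qed
next
  case (Suc r)
  let ?M = "tuple_mod D :: 'k hmod" and ?S = "tuple_sub :: _ \<Rightarrow> 'k fam"
  show ?case
  proof
    assume "mkd ?M (Suc (Suc r)) (?S (Fgt D t)) (?S (Fge D t))"
    then obtain L where L: "\<forall>I x. nonrel_chain (\<lambda>N. submodule N ?M) (mkd ?M (Suc r)) (?S (Fgt D t))
      (?S (Fge D t)) I x \<longrightarrow> card I \<le> L" by (rule kd_SucE)
    \<comment> \<open>Exceeding \<open>sum_list t\<close> keeps the extended tuple strictly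
      increasing.\<close>
    define c where "c i = Suc (sum_list t) + (L - i)" for i
    have "card {..<Suc L} \<le> L"
    proof (rule chain_card_le[OF L, where x = "\<lambda>i. ?S (Fge D (t @ [c i]))"])
      show "\<forall>i\<in>{..<Suc L}. submodule (?S (Fge D (t @ [c i]))) ?M \<and>
        ?S (Fgt D t) \<le> ?S (Fge D (t @ [c i])) \<and>
        ?S (Fge D (t @ [c i])) \<le> ?S (Fge D t)"
        by (auto intro!: submodule_Fge tuple_sub_mono simp: Fge_def Fgt_def
          intro: lex_gt_imp_ge_snoc lex_ge_snoc_imp_ge)
      show "\<forall>i\<in>{..<Suc L}. \<forall>j\<in>{..<Suc L}. i < j \<longrightarrow>
        ?S (Fge D (t @ [c i])) \<le> ?S (Fge D (t @ [c j])) \<and>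
        \<not> mkd ?M (Suc r) (?S (Fge D (t @ [c i]))) (?S (Fge D (t @ [c j])))"
      proof (intro ballI impI conjI notI)
        fix i j assume "i \<in> {..<Suc L}" "j \<in> {..<Suc L}" "i < j"
        then have less: "c j < c i" by (simp add: c_def)
        \<comment> \<open>The step from \<open>c i\<close> to \<open>c j\<close> contains the whole
          layer whose next coordinate is \<open>c j\<close>, and the induction hypothesis applies to
          this layer.\<close>
        then have gt: "?S (Fge D (t @ [c i])) \<le> ?S (Fgt D (t @ [c j]))"
          by (intro tuple_sub_mono) (auto simp: Fge_def Fgt_def intro: lex_ge_snoc_imp_gt)
        have ge: "?S (Fgt D (t @ [c j])) \<le> ?S (Fge D (t @ [c j]))"
          by (intro tuple_sub_mono) (auto simp: Fge_def Fgt_def intro: lex_gt_imp_ge)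
        show "?S (Fge D (t @ [c i])) \<le> ?S (Fge D (t @ [c j]))"
          using gt ge by (rule order_trans)
        assume "mkd ?M (Suc r) (?S (Fge D (t @ [c i]))) (?S (Fge D (t @ [c j])))"
        then have "mkd ?M (Suc r) (?S (Fgt D (t @ [c j]))) (?S (Fge D (t @ [c j])))"
          by (rule kd_mono[OF _ gt order_refl])
        moreover have "positions (t @ [c j])" by (rule positions_snoc[OF Suc.prems(1)]) (simp add: c_def)
        ultimately show False using Suc.IH[of "t @ [c j]"] Suc.prems by simp
      qed
    qed simp
    then show False by simp
  qed
qed

lemma tuple_mod_kd: "\<not> mkd (tuple_mod D :: 'k::field hmod) (Suc D) zero_sub (sp (tuple_mod D))"
proof -
  have "tuple_sub (Fgt D []) = (zero_sub :: 'k fam)"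
    by (auto simp: fun_eq_iff tuple_sub_def Fgt_def mspan_def poly_eq_iff)
  moreover have "tuple_sub (Fge D []) = (tuple_sub (orbit D) :: 'k fam)"
    by (simp add: fun_eq_iff tuple_sub_def Fge_def)
  ultimately show ?thesis
    using not_kd_tuple[of "[]" D D, where 'k = 'k] by (simp add: positions_def sp_tuple_mod)
qed

theorem theorem1p2:
  shows "\<forall>d::int. d \<ge> -1 \<longrightarrow> gk_filtration d \<noteq> Ob (fgmod_cat :: ('k::field hmod, 'k hmodmor) category)"
proof (intro allI impI notI)
  fix d :: int
  \<comment> \<open>With this \<open>D\<close>, \<open>gk_filtration d\<close> is
    \<open>gk_filtration_aux D\<close> and is given by \<open>mkd\<close> at \<open>Suc D\<close>,
    the index at which \<open>tuple_mod D\<close> fails.\<close>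
  define D where "D = nat (d + 1)"
  assume "gk_filtration d = Ob (fgmod_cat :: ('k hmod, 'k hmodmor) category)"
  moreover have "tuple_mod D \<in> Ob (fgmod_cat :: ('k hmod, 'k hmodmor) category)"
    by (simp add: Ob_fgmod hmodule_tuple_mod fin_gen_tuple_mod)
  ultimately have "(tuple_mod D :: 'k hmod) \<in> gk_filtration_aux D"
    by (simp add: gk_filtration_def D_def)
  then show False
    using tuple_mod_kd[of D, where 'k = 'k] by (simp add: gk_filtration_aux_eq del: kd.simps)
qed

end
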